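(* Let $T_1$ and $T_2$ be trees, each with at least two vertices, with $n=|V(T_1)|\ge |V(T_2)|$. Then $R(B^3T_1,B^3T_2)=n+1$ if $|V(T_1)|=|V(T_2)|\le 4$ or $T_1=T_2=S_5$, and $R(B^3T_1,B^3T_2)=n$ otherwise.
   Context: $S_5$ denotes the star with 5 vertices. A 3-uniform hypergraph consists of a vertex set and a set of 3-element subsets (hyperedges); $\mathcal{K}_N^3$ is the complete 3-uniform hypergraph on $N$ vertices. A 3-uniform hypergraph $\mathcal{H}$ contains a Berge-$F$ (for a graph $F$) if there are an injection $\varphi:V(F)\to V(\mathcal{H})$ and an injection $f$ from $E(F)$ to the hyperedges of $\mathcal{H}$ with $\{\varphi(x),\varphi(y)\}\subseteq f(xy)$ for every edge $xy$. $R(B^3T_1,B^3T_2)$ is the smallest $N$ such that for every coloring of the hyperedges of $\mathcal{K}_N^3$ with blue and red, the blue hyperedges contain a Berge-$T_1$ or the red hyperedges contain a Berge-$T_2$.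
   Formalization: The pair |V(T_1)|=3, |V(T_2)|=2 is excluded, since the claimed value n=3 is false there: the single hyperedge on 3 vertices, coloured blue, contains no blue Berge-T_1 and there is no red hyperedge. *)

theory Defs
  imports Main "HOL-Library.Extended_Nat"
begin

text \<open>
  A graph is given by a vertex set V and a set E of edges, each edge being a two-element
  subset of V.
\<close>

definition simple_graph :: "'a set \<Rightarrow> 'a set set \<Rightarrow> bool" where
  "simple_graph V E \<longleftrightarrow> finite V \<and> (\<forall>e\<in>E. e \<subseteq> V \<and> card e = 2)"

definition connected_graph :: "'a set \<Rightarrow> 'a set set \<Rightarrow> bool" where
  "connected_graph V E \<longleftrightarrow> V \<noteq> {} \<and> (\<forall>u\<in>V. \<forall>v\<in>V. (u, v) \<in> {(x, y). {x, y} \<in> E}\<^sup>*)"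

text \<open>
  A cycle is listed without repeating its first vertex; the index is taken modulo the length
  to close it up.
\<close>

definition is_cycle :: "'a set set \<Rightarrow> 'a list \<Rightarrow> bool" where
  "is_cycle E p \<longleftrightarrow> length p \<ge> 3 \<and> distinct p \<and>
     (\<forall>i<length p. {p ! i, p ! (Suc i mod length p)} \<in> E)"

definition tree :: "'a set \<Rightarrow> 'a set set \<Rightarrow> bool" where
  "tree V E \<longleftrightarrow> simple_graph V E \<and> connected_graph V E \<and> \<not> (\<exists>p. is_cycle E p)"

definition star :: "nat \<Rightarrow> 'a set \<Rightarrow> 'a set set \<Rightarrow> bool" where
  "star k V E \<longleftrightarrow> finite V \<and> card V = k \<and> (\<exists>c\<in>V. E = {{c, v} |v. v \<in> V - {c}})"

text \<open>
  In the next definition (V, E) is the graph F, W is the vertex set of the host hypergraph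
  and H is its set of hyperedges.
\<close>

definition contains_berge :: "'a set \<Rightarrow> 'a set set \<Rightarrow> 'b set \<Rightarrow> 'b set set \<Rightarrow> bool" where
  "contains_berge V E W H \<longleftrightarrow>
     (\<exists>\<phi> f. inj_on \<phi> V \<and> \<phi> ` V \<subseteq> W \<and> inj_on f E \<and> f ` E \<subseteq> H \<and>
        (\<forall>x y. {x, y} \<in> E \<longrightarrow> {\<phi> x, \<phi> y} \<subseteq> f {x, y}))"

definition complete3 :: "nat \<Rightarrow> nat set set" where
  "complete3 N = {h. h \<subseteq> {..<N} \<and> card h = 3}"

datatype colour = Blue | Red

definition berge_arrows ::
  "nat \<Rightarrow> 'a set \<Rightarrow> 'a set set \<Rightarrow> 'b set \<Rightarrow> 'b set set \<Rightarrow> bool" where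
  "berge_arrows N V1 E1 V2 E2 \<longleftrightarrow>
     (\<forall>c :: nat set \<Rightarrow> colour.
        contains_berge V1 E1 {..<N} {h \<in> complete3 N. c h = Blue} \<or>
        contains_berge V2 E2 {..<N} {h \<in> complete3 N. c h = Red})"

text \<open>
  The smallest N is taken in the extended naturals, so that an equation with a finite value
  includes the claim that a suitable N exists: the infimum of the empty set is infinity.
\<close>

definition berge_ramsey3 ::
  "'a set \<Rightarrow> 'a set set \<Rightarrow> 'b set \<Rightarrow> 'b set set \<Rightarrow> enat" where
  "berge_ramsey3 V1 E1 V2 E2 = Inf {enat N |N. berge_arrows N V1 E1 V2 E2}"

end

theory Submission
  imports Defs
begin

text \<open>
  A colouring is the set \<open>H\<close> of triples of one colour, the other colour being \<open>- H\<close>. The main claim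
  is that for two trees on \<open>N \<ge> 5\<close> vertices, not both stars if \<open>N = 5\<close>, every colouring on \<open>N\<close>
  vertices has one of the two Berge copies. By induction on \<open>N\<close>: deleting a vertex \<open>v\<close> and a leaf of
  each tree gives, say, a copy in \<open>H\<close>; if it cannot be extended to \<open>v\<close>, then \<open>v\<close> and the image of
  the neighbour of the leaf form a full pair of \<open>- H\<close>, all of whose triples lie in \<open>- H\<close>. So
  every vertex is in a full pair of one of the colours. Any vertex can be attached, in the colour of
  its partner pair, to any vertex of a full pair; hence if one colour covers all vertices it contains
  every tree. If both colours occur, the copies are built from a set covered by one colour (few
  vertices in the other) or from the induction hypothesis for \<open>N - 2\<close>, applied after deleting
  one vertex of each kind together with a cherry or a pendant path of length two of each tree.
\<close>

subsection \<open>Trees grown leaf by leaf\<close>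

text \<open>Two stars on five vertices violate the claim, so the induction cannot run over arbitrary
  pairs of trees: one tree must stay a non-star on every descent. This is why removal of a leaf and
  of a twig is also proved in a form that preserves two disjoint edges, and why five vertices need
  an argument of their own. Two stars are settled apart, from six vertices on: a spanning Berge star
  with centre \<open>c\<close> amounts to giving every other vertex its own edge in the link graph
  of \<open>c\<close>, which is possible as soon as every component of that graph contains a cycle.
  The descent by two vertices reaches the range of the induction only from seven vertices on. On six
  vertices the two colours cover exactly three vertices each, and this balanced case is built by
  hand from copies on four vertices. The sizes zero and two of a colour class are the ones excluded
  beforehand, since then the other colour covers all vertices or all but two.\<close>

inductive grown_tree :: "'a set \<Rightarrow> 'a set set \<Rightarrow> bool" where
  single: "grown_tree {x} {}"
| leaf: "grown_tree V E \<Longrightarrow> y \<in> V \<Longrightarrow> x \<notin> V \<Longrightarrow> grown_tree (insert x V) (insert {x, y} E)"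

lemma grown_tree_finite: "grown_tree V E \<Longrightarrow> finite V \<and> finite E"
  by (induction rule: grown_tree.induct) auto

lemma grown_tree_edge:
  "grown_tree V E \<Longrightarrow> e \<in> E \<Longrightarrow> \<exists>x y. e = {x, y} \<and> x \<in> V \<and> y \<in> V \<and> x \<noteq> y"
proof (induction rule: grown_tree.induct)
  case (leaf V E y x)
  then show ?case by (cases "e = {x, y}") auto
qed simp

lemma grown_tree_edge_subset: "grown_tree V E \<Longrightarrow> e \<in> E \<Longrightarrow> e \<subseteq> V"
  using grown_tree_edge by fastforce

lemma grown_tree_card: "grown_tree V E \<Longrightarrow> card V = Suc (card E)"
proof (induction rule: grown_tree.induct)
  case (leaf V E y x)
  have "{x, y} \<notin> E"
    using grown_tree_edge_subset[OF leaf.hyps(1)] leaf.hyps(3) by auto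
  then show ?case
    using leaf grown_tree_finite[OF leaf.hyps(1)] by simp
qed simp

lemma grown_tree_nonempty: "grown_tree V E \<Longrightarrow> V \<noteq> {}"
  by (auto elim: grown_tree.cases)

definition edge_path :: "'a set set \<Rightarrow> 'a list \<Rightarrow> bool" where
  "edge_path E p \<longleftrightarrow> distinct p \<and> (\<forall>i. Suc i < length p \<longrightarrow> {p ! i, p ! Suc i} \<in> E)"

lemma edge_path_Cons:
  "edge_path E (x # p) \<longleftrightarrow> x \<notin> set p \<and> edge_path E p \<and> (p \<noteq> [] \<longrightarrow> {x, hd p} \<in> E)"
  by (cases p) (auto simp: edge_path_def nth_Cons split: nat.splits)

lemma edge_path_rev: assumes "edge_path E p" shows "edge_path E (rev p)"
  unfolding edge_path_def
proof (intro conjI allI impI)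
  fix i assume i: "Suc i < length (rev p)"
  define j where "j = length p - Suc (Suc i)"
  have "Suc j < length p" "rev p ! i = p ! Suc j" "rev p ! Suc i = p ! j"
    using i by (auto simp: j_def rev_nth Suc_diff_Suc)
  then show "{rev p ! i, rev p ! Suc i} \<in> E"
    using assms by (auto simp: edge_path_def insert_commute)
qed (use assms in \<open>auto simp: edge_path_def\<close>)

lemma edge_path_mono: "edge_path E p \<Longrightarrow> E \<subseteq> F \<Longrightarrow> edge_path F p"
  by (auto simp: edge_path_def)

lemma grown_tree_path:
  "grown_tree V E \<Longrightarrow> a \<in> V \<Longrightarrow> b \<in> V \<Longrightarrow>
     \<exists>p. p \<noteq> [] \<and> hd p = a \<and> last p = b \<and> set p \<subseteq> V \<and> edge_path E p"
proof (induction arbitrary: a b rule: grown_tree.induct)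
  case (single x)
  then show ?case by (intro exI[of _ "[x]"]) (auto simp: edge_path_def)
next
  case (leaf V E y x)
  have new: "\<exists>p. p \<noteq> [] \<and> hd p = x \<and> last p = b \<and> set p \<subseteq> insert x V \<and> edge_path (insert {x, y} E) p"
    if b: "b \<in> V" for b
  proof -
    obtain p where p: "p \<noteq> []" "hd p = y" "last p = b" "set p \<subseteq> V" "edge_path E p"
      using leaf.IH[OF leaf.hyps(2) b] by metis
    have "edge_path (insert {x, y} E) p"
      using edge_path_mono[OF p(5)] by blast
    then show ?thesis
      using p leaf.hyps(3) by (intro exI[of _ "x # p"]) (auto simp: edge_path_Cons)
  qed
  consider "a \<in> V" "b \<in> V" | "a = x" "b \<in> V" | "a \<in> V" "b = x" | "a = x" "b = x"
    using leaf.prems by auto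
  then show ?case
  proof cases
    case 1
    then obtain p where "p \<noteq> []" "hd p = a" "last p = b" "set p \<subseteq> V" "edge_path E p"
      using leaf.IH by metis
    then show ?thesis
      using edge_path_mono[of E p "insert {x, y} E"] by (intro exI[of _ p]) auto
  next
    case 2
    then show ?thesis using new by metis
  next
    case 3
    then obtain p where "p \<noteq> []" "hd p = x" "last p = a" "set p \<subseteq> insert x V"
        "edge_path (insert {x, y} E) p"
      using new by metis
    then show ?thesis
      using 3 edge_path_rev by (intro exI[of _ "rev p"]) (auto simp: hd_rev last_rev)
  next
    case 4
    then show ?thesis by (intro exI[of _ "[x]"]) (auto simp: edge_path_def)
  qed
qed

lemma cycle_from_path:
  assumes "edge_path F p" "F \<subseteq> E" "length p \<ge> 3" "{last p, hd p} \<in> E"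
  shows "is_cycle E p"
  unfolding is_cycle_def
proof (intro conjI allI impI)
  fix i assume i: "i < length p"
  show "{p ! i, p ! (Suc i mod length p)} \<in> E"
  proof (cases "Suc i < length p")
    case True
    then show ?thesis using assms by (auto simp: edge_path_def)
  next
    case False
    then have "Suc i = length p" using i by simp
    then show ?thesis
      using assms(3,4) last_conv_nth[of p] hd_conv_nth[of p] by (cases "p = []") (auto simp flip: \<open>Suc i = length p\<close>)
  qed
qed (use assms in \<open>auto simp: edge_path_def\<close>)

lemma rtrancl_leaves_set:
  assumes "(u, v) \<in> r\<^sup>*" "u \<in> W" "v \<notin> W"
  shows "\<exists>x y. (x, y) \<in> r \<and> x \<in> W \<and> y \<notin> W"
  using assms by (induction rule: rtrancl_induct) auto

text \<open>A largest vertex set \<open>W\<close> that carries a grown subtree is all of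
  \<open>V\<close>, since by connectivity some edge would otherwise leave it and add a leaf. An edge
  of \<open>E\<close> outside the grown edges \<open>F\<close> would close the path in
  \<open>F\<close> between its ends to a cycle.\<close>

lemma tree_grown:
  assumes "tree V E"
  shows "grown_tree V E"
proof -
  have sg: "finite V" "\<And>e. e \<in> E \<Longrightarrow> e \<subseteq> V \<and> card e = 2"
    and ne: "V \<noteq> {}"
    and conn: "\<And>u v. u \<in> V \<Longrightarrow> v \<in> V \<Longrightarrow> (u, v) \<in> {(x, y). {x, y} \<in> E}\<^sup>*"
    and acyc: "\<And>p. \<not> is_cycle E p"
    using assms by (auto simp: tree_def simple_graph_def connected_graph_def)
  let ?P = "\<lambda>W. W \<subseteq> V \<and> (\<exists>F \<subseteq> E. grown_tree W F)"
  obtain x0 where "x0 \<in> V" using ne by blast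
  then have "?P {x0}" using grown_tree.single[of x0] by blast
  moreover have "finite {W. ?P W}"
    by (rule finite_subset[of _ "Pow V"]) (use sg in auto)
  ultimately have "\<exists>W\<in>{W. ?P W}. \<forall>W'\<in>{W. ?P W}. W \<subseteq> W' \<longrightarrow> W = W'"
    by (intro finite_has_maximal) auto
  then obtain W where W: "?P W" and max: "\<And>W'. ?P W' \<Longrightarrow> W \<subseteq> W' \<Longrightarrow> W = W'"
    unfolding Bex_def Ball_def mem_Collect_eq by meson
  obtain F where F: "F \<subseteq> E" "grown_tree W F" using W by blast
  have "W = V"
  proof (rule ccontr)
    assume "W \<noteq> V"
    then obtain v where v: "v \<in> V" "v \<notin> W" using W by blast
    obtain u where u: "u \<in> W" using grown_tree_nonempty[OF F(2)] by blast
    obtain x y where xy: "{x, y} \<in> E" "x \<in> W" "y \<notin> W"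
      using rtrancl_leaves_set[OF conn u v(2)] u v W by blast
    have "grown_tree (insert y W) (insert {y, x} F)"
      using grown_tree.leaf[OF F(2) xy(2,3)] .
    moreover have "insert {y, x} F \<subseteq> E" using xy F by (auto simp: insert_commute)
    moreover have "insert y W \<subseteq> V" using xy sg(2) W by blast
    ultimately show False using max[of "insert y W"] xy(3) by blast
  qed
  moreover have "E \<subseteq> F"
  proof
    fix e assume e: "e \<in> E"
    then obtain a b where ab: "e = {a, b}" "a \<noteq> b" using sg(2) by (metis card_2_iff)
    then have "a \<in> W" "b \<in> W" using e sg(2) \<open>W = V\<close> by auto
    then obtain p where p: "p \<noteq> []" "hd p = a" "last p = b" "edge_path F p"
      using grown_tree_path[OF F(2)] by metis
    show "e \<in> F"
    proof (rule ccontr)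
      assume ne: "e \<notin> F"
      have "length p \<ge> 3"
      proof (rule ccontr)
        assume "\<not> length p \<ge> 3"
        then obtain c d where "p = [c] \<or> p = [c, d]"
          using p(1) by (cases p; cases "tl p"; cases "tl (tl p)") auto
        then show False
          using p ab ne by (auto simp: edge_path_def)
      qed
      moreover have "{last p, hd p} \<in> E" using p ab e by (simp add: insert_commute)
      ultimately show False using cycle_from_path[OF p(4) F(1)] acyc by blast
    qed
  qed
  ultimately show ?thesis using F by auto
qed

section \<open>Stars and trees with two disjoint edges\<close>

definition two_disjoint :: "'a set set \<Rightarrow> bool" where
  "two_disjoint E \<longleftrightarrow> (\<exists>e\<in>E. \<exists>e'\<in>E. e \<inter> e' = {})"

definition spokes :: "'a \<Rightarrow> 'a set \<Rightarrow> 'a set set" where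
  "spokes c V = {{c, v} |v. v \<in> V - {c}}"

lemma spokes_insert: "x \<noteq> c \<Longrightarrow> spokes c (insert x V) = insert {x, c} (spokes c V)"
  by (auto simp: spokes_def insert_commute)

lemma spokes_singleton [simp]: "spokes c {c} = {}"
  by (simp add: spokes_def)

lemma spokesI: "v \<in> V \<Longrightarrow> v \<noteq> c \<Longrightarrow> {c, v} \<in> spokes c V"
  by (auto simp: spokes_def)

lemma center_in_spoke: "e \<in> spokes c V \<Longrightarrow> c \<in> e"
  by (auto simp: spokes_def)

lemma two_disjoint_mono: "two_disjoint E \<Longrightarrow> E \<subseteq> F \<Longrightarrow> two_disjoint F"
  by (auto simp: two_disjoint_def)

lemma not_two_disjoint_spokes: "\<not> two_disjoint (spokes c V)"
  by (auto simp: two_disjoint_def spokes_def)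

text \<open>A leaf edge \<open>{x, y}\<close> with \<open>y\<close> different from the centre
  \<open>c\<close> is disjoint from every spoke \<open>{c, l}\<close> with \<open>l\<close>
  different from \<open>y\<close>. So the old star is the single edge between \<open>c\<close> and
  \<open>y\<close>, and \<open>y\<close> is the new centre. Among trees, \<open>two_disjoint\<close>
  thus expresses being no star, in a form that visibly survives adding edges.\<close>

lemma star_if_not_two_disjoint:
  assumes "grown_tree V E" "\<not> two_disjoint E"
  shows "\<exists>c\<in>V. E = spokes c V"
  using assms
proof (induction rule: grown_tree.induct)
  case (leaf V E y x)
  then obtain c where c: "c \<in> V" "E = spokes c V"
    using two_disjoint_mono[of E "insert {x, y} E"] by blast
  show ?case
  proof (cases "y = c")
    case True
    then have "insert {x, y} E = spokes c (insert x V)"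
      using spokes_insert[of x c V] c leaf.hyps by auto
    then show ?thesis using c by blast
  next
    case False
    have "V \<subseteq> {c, y}"
    proof
      fix l assume l: "l \<in> V"
      show "l \<in> {c, y}"
      proof (rule ccontr)
        assume "l \<notin> {c, y}"
        then have "{c, l} \<in> insert {x, y} E" "{x, y} \<inter> {c, l} = {}"
          using l c leaf.hyps False by (auto intro: spokesI)
        then show False using leaf.prems unfolding two_disjoint_def by blast
      qed
    qed
    then have V: "V = {c, y}" using c leaf.hyps by auto
    have "insert {x, y} E = spokes y (insert x V)"
      using c(2) False leaf.hyps unfolding V by (auto simp: spokes_def insert_commute)
    then show ?thesis using leaf.hyps by blast
  qed
qed simp

lemma grown_tree_spokes: "finite V \<Longrightarrow> c \<in> V \<Longrightarrow> grown_tree V (spokes c V)"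
proof (induction "card V" arbitrary: V)
  case (Suc k)
  show ?case
  proof (cases "V = {c}")
    case True
    then show ?thesis using grown_tree.single[of c] by simp
  next
    case False
    then obtain x where x: "x \<in> V" "x \<noteq> c" using Suc.prems by blast
    have "grown_tree (V - {x}) (spokes c (V - {x}))"
      using Suc x by auto
    from grown_tree.leaf[OF this, of c x]
    show ?thesis using spokes_insert[OF x(2), of "V - {x}"] x Suc.prems
      by (simp add: insert_absorb)
  qed
qed auto

lemma card_remainder_nonempty:
  assumes "finite A" "card A > length xs" shows "\<exists>x\<in>A. x \<notin> set xs"
  by (metis assms card_length card_mono leD le_trans subsetI finite_set)

text \<open>If removing the last leaf \<open>x\<close> leaves a star with centre \<open>c\<close>,
  then \<open>x\<close> hangs at some \<open>y\<close> other than \<open>c\<close>, and another leaf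
  \<open>l\<close> of the star is removed instead. A further leaf \<open>k\<close> keeps
  \<open>{c, k}\<close> disjoint from \<open>{x, y}\<close>. The bound five counts \<open>c\<close>,
  \<open>y\<close>, \<open>l\<close>, \<open>k\<close> and \<open>x\<close>.\<close>

lemma two_disjoint_leaf_removal:
  assumes "grown_tree V E" "two_disjoint E" "card V \<ge> 5"
  shows "\<exists>V' E' x y. grown_tree V' E' \<and> two_disjoint E' \<and> y \<in> V' \<and> x \<notin> V' \<and>
           V = insert x V' \<and> E = insert {x, y} E'"
  using assms(1)
proof cases
  case (leaf V' E' y x)
  show ?thesis
  proof (cases "two_disjoint E'")
    case True
    then show ?thesis using leaf by metis
  next
    case False
    then obtain c where c: "c \<in> V'" "E' = spokes c V'"
      using star_if_not_two_disjoint[OF leaf(3)] by blast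
    have fin: "finite V'" using grown_tree_finite[OF leaf(3)] by blast
    have card: "card V' \<ge> 4" using assms(3) leaf fin by simp
    have "y \<noteq> c"
    proof
      assume "y = c"
      then have "E = spokes c (insert x V')"
        using spokes_insert[of x c V'] c leaf by auto
      then show False using assms(2) not_two_disjoint_spokes by metis
    qed
    obtain l where l: "l \<in> V'" "l \<noteq> c" "l \<noteq> y"
      using card_remainder_nonempty[OF fin, of "[c, y]"] card by auto
    obtain k where k: "k \<in> V'" "k \<noteq> c" "k \<noteq> y" "k \<noteq> l"
      using card_remainder_nonempty[OF fin, of "[c, y, l]"] card by auto
    let ?V = "insert x (V' - {l})" and ?E = "insert {x, y} (spokes c (V' - {l}))"
    have "grown_tree (V' - {l}) (spokes c (V' - {l}))"
      using grown_tree_spokes[of "V' - {l}" c] fin c l by auto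
    then have "grown_tree ?V ?E"
      by (rule grown_tree.leaf) (use leaf l in auto)
    moreover have "two_disjoint ?E"
    proof -
      have "{c, k} \<in> ?E" "{x, y} \<inter> {c, k} = {}"
        using k c leaf \<open>y \<noteq> c\<close> by (auto intro: spokesI)
      then show ?thesis unfolding two_disjoint_def by blast
    qed
    moreover have "V = insert l ?V" unfolding leaf(1) using l(1) by blast
    moreover have "spokes c V' = insert {l, c} (spokes c (V' - {l}))"
      using spokes_insert[OF l(2), of "V' - {l}"] l(1) by (simp add: insert_absorb)
    then have "E = insert {l, c} ?E"
      unfolding leaf(2) c(2) by (simp add: insert_commute)
    moreover have "c \<in> ?V" "l \<notin> ?V" using c(1) l leaf(5) by auto
    ultimately show ?thesis by metis
  qed
qed (use assms in auto)

lemma card_2_tree_edges: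
  assumes "grown_tree V E" "V = {y, z}" "z \<noteq> y"
  shows "E = {{z, y}}"
proof -
  have "e = {z, y}" if "e \<in> E" for e
    using grown_tree_edge[OF assms(1) that] assms(2) by auto
  moreover have "card E = 1"
    using grown_tree_card[OF assms(1)] assms by simp
  ultimately show ?thesis by (metis card_1_singletonE singletonI)
qed

section \<open>Removing two vertices from a tree\<close>

definition two_leaf_extension :: "'a set \<Rightarrow> 'a set set \<Rightarrow> 'a set \<Rightarrow> 'a set set \<Rightarrow> bool" where
  "two_leaf_extension V' E' V E \<longleftrightarrow> (\<exists>a b p q. p \<in> V' \<and> q \<in> V' \<and> a \<notin> V' \<and> b \<notin> V' \<and> a \<noteq> b \<and>
     V = insert b (insert a V') \<and> E = insert {b, q} (insert {a, p} E'))"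

lemma two_leaf_extensionI:
  "p \<in> V' \<Longrightarrow> q \<in> V' \<Longrightarrow> a \<notin> V' \<Longrightarrow> b \<notin> V' \<Longrightarrow> a \<noteq> b \<Longrightarrow> V = insert b (insert a V') \<Longrightarrow>
   E = insert {b, q} (insert {a, p} E') \<Longrightarrow> two_leaf_extension V' E' V E"
  unfolding two_leaf_extension_def by metis

text \<open>Of the two leaves \<open>a\<close> and \<open>b\<close> found so far, a new leaf
  \<open>x\<close> hangs at one at most. The one carrying \<open>x\<close> returns to the rest (if
  there is none, \<open>b\<close> does), and the other is removed together with \<open>x\<close>.
  The induction starts with the path on three vertices, whose two ends are removed.\<close>

lemma ex_two_leaf_extension:
  assumes "grown_tree V E" "card V \<ge> 3"
  shows "\<exists>V' E'. grown_tree V' E' \<and> two_leaf_extension V' E' V E"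
  using assms
proof (induction rule: grown_tree.induct)
  case (leaf V E y x)
  have fin: "finite V" using grown_tree_finite[OF leaf.hyps(1)] by blast
  show ?case
  proof (cases "card V \<ge> 3")
    case True
    then obtain V' E' where IH: "grown_tree V' E'" "two_leaf_extension V' E' V E"
      using leaf.IH by blast
    obtain a b p q where p: "p \<in> V'" "q \<in> V'" "a \<notin> V'" "b \<notin> V'" "a \<noteq> b" and
      V: "V = insert b (insert a V')" and E: "E = insert {b, q} (insert {a, p} E')"
      using IH(2) unfolding two_leaf_extension_def by metis
    have ga: "grown_tree (insert a V') (insert {a, p} E')" and gb: "grown_tree (insert b V') (insert {b, q} E')"
      using grown_tree.leaf[OF IH(1)] p by blast+
    consider "y \<in> insert b V'" | "y = a" using leaf.hyps(2) V by blast
    then show ?thesis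
    proof cases
      case 1
      have "two_leaf_extension (insert b V') (insert {b, q} E') (insert x V) (insert {x, y} E)"
        by (rule two_leaf_extensionI[of p _ y a x])
          (use p V 1 leaf.hyps in \<open>auto simp: E insert_commute\<close>)
      then show ?thesis using gb by blast
    next
      case 2
      have "two_leaf_extension (insert a V') (insert {a, p} E') (insert x V) (insert {x, y} E)"
        by (rule two_leaf_extensionI[of q _ a b x])
          (use p V 2 leaf.hyps in \<open>auto simp: E insert_commute\<close>)
      then show ?thesis using ga by blast
    qed
  next
    case False
    then have "card V = 2" using leaf fin by simp
    then obtain z where z: "V = {y, z}" "z \<noteq> y" using leaf.hyps
      by (metis card_2_iff doubleton_eq_iff insertE singletonD)
    have E: "E = {{z, y}}" using card_2_tree_edges[OF leaf.hyps(1) z] .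
    have "two_leaf_extension {y} {} (insert x V) (insert {x, y} E)"
      by (rule two_leaf_extensionI[of y _ y z x]) (use z leaf.hyps in \<open>auto simp: E\<close>)
    then show ?thesis using grown_tree.single[of y] by blast
  qed
qed simp

text \<open>The vertex \<open>b\<close> hangs at \<open>p\<close> (cherry) or at \<open>a\<close>
  (pendant path). Of the two host vertices deleted in the induction, one lies in a full pair of the
  wanted colour, and the other is reached with its help; hence both removed tree vertices sit at one
  spot of the rest.\<close>

definition twig :: "'a set \<Rightarrow> 'a set set \<Rightarrow> 'a set \<Rightarrow> 'a set set \<Rightarrow> bool" where
  "twig V' E' V E \<longleftrightarrow> (\<exists>a b p. p \<in> V' \<and> a \<notin> V' \<and> b \<notin> V' \<and> a \<noteq> b \<and> V = insert b (insert a V') \<and>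
     (E = insert {b, p} (insert {a, p} E') \<or> E = insert {b, a} (insert {a, p} E')))"

lemma twigI_cherry:
  "p \<in> V' \<Longrightarrow> a \<notin> V' \<Longrightarrow> b \<notin> V' \<Longrightarrow> a \<noteq> b \<Longrightarrow> V = insert b (insert a V') \<Longrightarrow>
   E = insert {b, p} (insert {a, p} E') \<Longrightarrow> twig V' E' V E"
  unfolding twig_def by metis

lemma twigI_path:
  "p \<in> V' \<Longrightarrow> a \<notin> V' \<Longrightarrow> b \<notin> V' \<Longrightarrow> a \<noteq> b \<Longrightarrow> V = insert b (insert a V') \<Longrightarrow>
   E = insert {b, a} (insert {a, p} E') \<Longrightarrow> twig V' E' V E"
  unfolding twig_def by metis

text \<open>A new leaf \<open>x\<close> at a vertex of the rest leaves the twig intact. At an end of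
  a cherry, it makes a pendant path with that end. On a pendant path it makes a cherry with
  \<open>b\<close> if it hangs at \<open>a\<close>, and the pendant path from \<open>a\<close> over
  \<open>b\<close> if it hangs at \<open>b\<close>.\<close>

lemma ex_twig:
  assumes "grown_tree V E" "card V \<ge> 3"
  shows "\<exists>V' E'. grown_tree V' E' \<and> twig V' E' V E"
  using assms
proof (induction rule: grown_tree.induct)
  case (leaf V E y x)
  show ?case
  proof (cases "card V \<ge> 3")
    case True
    then obtain V' E' where IH: "grown_tree V' E'" "twig V' E' V E"
      using leaf.IH[OF True] by metis
    then obtain a b p where p: "p \<in> V'" "a \<notin> V'" "b \<notin> V'" "a \<noteq> b" "V = insert b (insert a V')" and
      E: "E = insert {b, p} (insert {a, p} E') \<or> E = insert {b, a} (insert {a, p} E')"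
      unfolding twig_def by metis
    have ga: "grown_tree (insert a V') (insert {a, p} E')" and gb: "grown_tree (insert b V') (insert {b, p} E')"
      using grown_tree.leaf[OF IH(1)] p(1-3) by blast+
    consider "y \<in> V'" | "y = a" "E = insert {b, p} (insert {a, p} E')" | "y = b" "E = insert {b, p} (insert {a, p} E')"
      | "y = a" "E = insert {b, a} (insert {a, p} E')" | "y = b" "E = insert {b, a} (insert {a, p} E')"
      using leaf.hyps p(5) E by auto
    then show ?thesis
    proof cases
      case 1
      have "grown_tree (insert x V') (insert {x, y} E')"
        by (rule grown_tree.leaf[OF IH(1) 1]) (use p leaf.hyps in auto)
      moreover from E have "twig (insert x V') (insert {x, y} E') (insert x V) (insert {x, y} E)"
      proof
        assume E: "E = insert {b, p} (insert {a, p} E')"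
        show ?thesis
          by (rule twigI_cherry[of p _ a b]) (use p leaf.hyps in \<open>auto simp: E insert_commute\<close>)
      next
        assume E: "E = insert {b, a} (insert {a, p} E')"
        show ?thesis
          by (rule twigI_path[of p _ a b]) (use p leaf.hyps in \<open>auto simp: E insert_commute\<close>)
      qed
      ultimately show ?thesis by blast
    next
      case 2
      have "twig (insert b V') (insert {b, p} E') (insert x V) (insert {x, y} E)"
        by (rule twigI_path[of p _ a x]) (use p 2 leaf.hyps in auto)
      then show ?thesis using gb by blast
    next
      case 3
      have "twig (insert a V') (insert {a, p} E') (insert x V) (insert {x, y} E)"
        by (rule twigI_path[of p _ b x]) (use p 3 leaf.hyps in auto)
      then show ?thesis using ga by blast
    next
      case 4
      have "twig (insert a V') (insert {a, p} E') (insert x V) (insert {x, y} E)"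
        by (rule twigI_cherry[of a _ b x]) (use p 4 leaf.hyps in auto)
      then show ?thesis using ga by blast
    next
      case 5
      have "twig (insert a V') (insert {a, p} E') (insert x V) (insert {x, y} E)"
        by (rule twigI_path[of a _ b x]) (use p 5 leaf.hyps in auto)
      then show ?thesis using ga by blast
    qed
  next
    case False
    have fin: "finite V" using grown_tree_finite[OF leaf.hyps(1)] by blast
    then have "card V = 2" using False leaf by simp
    then obtain z where z: "V = {y, z}" "z \<noteq> y" using leaf.hyps
      by (metis card_2_iff doubleton_eq_iff insertE singletonD)
    show ?thesis
    proof (cases "E = {{z, y}}")
      case True
      have "twig {y} {} (insert x V) (insert {x, y} E)"
        by (rule twigI_cherry[of y _ z x]) (use z True leaf.hyps(2-) in auto)
      then show ?thesis using grown_tree.single[of y] by blast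
    next
      case E: False
      show ?thesis using card_2_tree_edges[OF leaf.hyps(1) z] E by blast
    qed
  qed
qed simp

text \<open>If the rest is a star with centre \<open>c\<close>, the twig is kept and two leaves
  \<open>l\<close>, \<open>k\<close> of the star are removed as a cherry at \<open>c\<close>; a
  third leaf \<open>m\<close> remains for a disjoint edge. The bound seven counts the twig and
  \<open>c\<close>, \<open>p\<close>, \<open>l\<close>, \<open>k\<close>, \<open>m\<close>.\<close>

lemma ex_twig_two_disjoint:
  assumes "grown_tree V E" "two_disjoint E" "card V \<ge> 7"
  shows "\<exists>V' E'. grown_tree V' E' \<and> two_disjoint E' \<and> twig V' E' V E"
proof -
  obtain V' E' where T': "grown_tree V' E'" "twig V' E' V E"
    using ex_twig assms by fastforce
  obtain a b p where p: "p \<in> V'" "a \<notin> V'" "b \<notin> V'" "a \<noteq> b" "V = insert b (insert a V')" and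
    E: "E = insert {b, p} (insert {a, p} E') \<or> E = insert {b, a} (insert {a, p} E')"
    using T'(2) unfolding twig_def by metis
  show ?thesis
  proof (cases "two_disjoint E'")
    case True
    then show ?thesis using T' by blast
  next
    case False
    then obtain c where c: "c \<in> V'" "E' = spokes c V'"
      using star_if_not_two_disjoint[OF T'(1)] by blast
    have fin: "finite V'" using grown_tree_finite[OF T'(1)] by blast
    have card: "card V' \<ge> 5" using assms(3) p fin by simp
    obtain l where l: "l \<in> V'" "l \<noteq> c" "l \<noteq> p"
      using card_remainder_nonempty[OF fin, of "[c, p]"] card by auto
    obtain k where k: "k \<in> V'" "k \<noteq> c" "k \<noteq> p" "k \<noteq> l"
      using card_remainder_nonempty[OF fin, of "[c, p, l]"] card by auto
    obtain m where m: "m \<in> V'" "m \<noteq> c" "m \<noteq> p" "m \<noteq> l" "m \<noteq> k"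
      using card_remainder_nonempty[OF fin, of "[c, p, l, k]"] card by auto
    define W where "W = V' - {l, k}"
    have W: "p \<in> W" "c \<in> W" "m \<in> W" "a \<notin> W" "b \<notin> W" "l \<notin> W" "k \<notin> W" "V' = insert k (insert l W)"
      using p(1-3) c(1) l k m by (auto simp: W_def)
    have "finite W" using fin by (simp add: W_def)
    then have gW: "grown_tree W (spokes c W)" using grown_tree_spokes[of W c] W(2) by simp
    have E': "E' = insert {k, c} (insert {l, c} (spokes c W))"
      unfolding c(2) W(8) using spokes_insert[OF k(2), of "insert l W"] spokes_insert[OF l(2), of W]
      by simp
    \<comment> \<open>The neighbour \<open>q\<close> of \<open>b\<close> covers both shapes of a
      twig at once.\<close>
    have "\<exists>q\<in>{p, a}. E = insert {b, q} (insert {a, p} E')"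
      using E by simp
    then obtain q where q_cases: "q \<in> {p, a}" and E_q: "E = insert {b, q} (insert {a, p} E')"
      by (rule bexE)
    have q: "q \<in> insert a W" using q_cases W(1) by auto
    let ?V = "insert b (insert a W)" and ?E = "insert {b, q} (insert {a, p} (spokes c W))"
    have "grown_tree ?V ?E"
      by (rule grown_tree.leaf[OF grown_tree.leaf[OF gW W(1,4)] q]) (use p(4) W in auto)
    \<comment> \<open>If \<open>p\<close> differs from \<open>c\<close>, the edge
      \<open>{a, p}\<close> avoids \<open>{c, m}\<close>. If \<open>p = c\<close>, then
      \<open>q = c\<close> would make the whole tree a star; so the twig is a path, and
      \<open>{b, a}\<close> avoids \<open>{c, m}\<close>.\<close>
    moreover have "two_disjoint ?E"
    proof (cases "p = c")
      case False
      have "{c, m} \<in> ?E" "{a, p} \<inter> {c, m} = {}"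
        using False m p(1-4) W(1-7) by (auto intro: spokesI)
      then show ?thesis unfolding two_disjoint_def by blast
    next
      case True
      have "q \<noteq> c"
      proof
        assume "q = c"
        then have "E = spokes c V"
          unfolding E_q p(5) c(2)
          using True spokes_insert[of a c V'] spokes_insert[of b c "insert a V'"] p(1-3) by force
        then show False using assms(2) not_two_disjoint_spokes by metis
      qed
      then have "{c, m} \<in> ?E" "{b, q} \<inter> {c, m} = {}"
        using True q_cases m p(1-4) W(1-7) by (auto intro: spokesI)
      then show ?thesis unfolding two_disjoint_def by blast
    qed
    moreover have "twig ?V ?E V E"
    proof (rule twigI_cherry[of c _ l k])
      show "V = insert k (insert l ?V)" unfolding p(5) W(8) by auto
      show "E = insert {k, c} (insert {l, c} ?E)" unfolding E_q E'
        by (simp only: insert_commute)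
    qed (use W(1-7) p(1-4) l k in auto)
    ultimately show ?thesis by blast
  qed
qed

subsection \<open>Attaching leaves to Berge copies\<close>

text \<open>The copy covers exactly \<open>S\<close> and its hyperedges stay inside
  \<open>S\<close>. A triple through a vertex outside \<open>S\<close> is therefore never in use, so
  injectivity of \<open>f\<close> comes for free when a leaf is attached.\<close>

definition berge_map ::
  "'a set \<Rightarrow> 'a set set \<Rightarrow> 'b set \<Rightarrow> 'b set set \<Rightarrow> ('a \<Rightarrow> 'b) \<Rightarrow> ('a set \<Rightarrow> 'b set) \<Rightarrow> bool" where
  "berge_map V E S H \<phi> f \<longleftrightarrow> bij_betw \<phi> V S \<and> inj_on f E \<and>
     (\<forall>e\<in>E. \<phi> ` e \<subseteq> f e \<and> f e \<subseteq> S \<and> card (f e) = 3 \<and> f e \<in> H)"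

definition spans :: "'a set \<Rightarrow> 'a set set \<Rightarrow> 'b set \<Rightarrow> 'b set set \<Rightarrow> bool" where
  "spans V E S H \<longleftrightarrow> (\<exists>\<phi> f. berge_map V E S H \<phi> f)"

lemma spansI: "berge_map V E S H \<phi> f \<Longrightarrow> spans V E S H"
  by (auto simp: spans_def)

lemma berge_map_in: "berge_map V E S H \<phi> f \<Longrightarrow> y \<in> V \<Longrightarrow> \<phi> y \<in> S"
  by (auto simp: berge_map_def bij_betw_def)

lemma bij_betw_extend_point:
  assumes "bij_betw f A B" "a \<notin> A" "b \<notin> B"
  shows "bij_betw (f(a := b)) (insert a A) (insert b B)"
proof -
  have "bij_betw (f(a := b)) A B"
    using assms(1,2) by (subst bij_betw_cong[of _ _ f]) auto
  then show ?thesis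
    using bij_betw_combine[of "f(a := b)" A B "{a}" "{b}"] assms(3) by (simp add: bij_betw_def)
qed

lemma berge_map_attach:
  assumes "berge_map V E S H \<phi> f" "grown_tree V E" "y \<in> V" "x \<notin> V" "s \<notin> S"
    and "{s, \<phi> y, t} \<in> H" "t \<in> S" "t \<noteq> \<phi> y"
  shows "berge_map (insert x V) (insert {x, y} E) (insert s S) H
    (\<phi>(x := s)) (f({x, y} := {s, \<phi> y, t}))"
proof -
  have bij: "bij_betw \<phi> V S" and inj: "inj_on f E" and
    edge: "\<And>e. e \<in> E \<Longrightarrow> \<phi> ` e \<subseteq> f e \<and> f e \<subseteq> S \<and> card (f e) = 3 \<and> f e \<in> H"
    using assms(1) by (auto simp: berge_map_def)
  have sub: "e \<subseteq> V" if "e \<in> E" for e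
    using grown_tree_edge_subset[OF assms(2) that] .
  have new: "{x, y} \<notin> E" using sub assms(4) by blast
  have yS: "\<phi> y \<in> S" using berge_map_in[OF assms(1,3)] .
  have xy: "x \<noteq> y" using assms(3,4) by blast
  have "s \<noteq> \<phi> y" "s \<noteq> t" using yS assms(5,7) by auto
  then have card3: "card {s, \<phi> y, t} = 3" using assms(8) by simp
  have bij': "bij_betw (\<phi>(x := s)) (insert x V) (insert s S)"
    using bij_betw_extend_point[OF bij assms(4,5)] .
  have old: "(f({x, y} := {s, \<phi> y, t})) e = f e" if "e \<in> E" for e
    using new that by auto
  have inj': "inj_on (f({x, y} := {s, \<phi> y, t})) (insert {x, y} E)"
  proof -
    have "{s, \<phi> y, t} \<notin> f ` E" using edge assms(5) by blast
    then show ?thesis using inj new by (auto intro: inj_on_fun_updI)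
  qed
  have "(\<phi>(x := s)) ` e \<subseteq> (f({x, y} := {s, \<phi> y, t})) e \<and>
        (f({x, y} := {s, \<phi> y, t})) e \<subseteq> insert s S \<and>
        card ((f({x, y} := {s, \<phi> y, t})) e) = 3 \<and> (f({x, y} := {s, \<phi> y, t})) e \<in> H"
    if e: "e \<in> insert {x, y} E" for e
  proof (cases "e = {x, y}")
    case True
    then show ?thesis using card3 assms(6,7) yS xy by auto
  next
    case False
    then have eE: "e \<in> E" using e by blast
    have "(\<phi>(x := s)) ` e = \<phi> ` e"
      using sub[OF eE] assms(4) by (intro image_cong) auto
    then show ?thesis using edge[OF eE] old[OF eE] by auto
  qed
  then show ?thesis using bij' inj' by (simp add: berge_map_def del: fun_upd_apply)
qed

section \<open>Full pairs and sets covered by them\<close>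

definition full_pair :: "'b set set \<Rightarrow> 'b set \<Rightarrow> 'b \<Rightarrow> 'b \<Rightarrow> bool" where
  "full_pair H U u v \<longleftrightarrow> u \<in> U \<and> v \<in> U \<and> u \<noteq> v \<and> (\<forall>z\<in>U - {u, v}. {u, v, z} \<in> H)"

lemma full_pair_sym: "full_pair H U u v \<Longrightarrow> full_pair H U v u"
  by (auto simp: full_pair_def insert_commute)

lemma full_pairD:
  "full_pair H U u v \<Longrightarrow> z \<in> U \<Longrightarrow> z \<noteq> u \<Longrightarrow> z \<noteq> v \<Longrightarrow> {u, v, z} \<in> H"
  by (auto simp: full_pair_def)

text \<open>Full pairs are edges of a graph, and this graph has no isolated vertex on
  \<open>S\<close>. Fullness refers to the ambient \<open>U\<close>, but the partner must lie in
  \<open>S\<close>: a copy covering \<open>S\<close> then contains the third vertex that joins an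
  image vertex in \<open>S\<close> to any new vertex of \<open>U\<close>.\<close>

definition self_paired :: "'b set set \<Rightarrow> 'b set \<Rightarrow> 'b set \<Rightarrow> bool" where
  "self_paired H U S \<longleftrightarrow> S \<subseteq> U \<and> (\<forall>y\<in>S. \<exists>q\<in>S. full_pair H U y q)"

lemma self_pairedE:
  assumes "self_paired H U S" "y \<in> S"
  obtains q where "q \<in> S" "q \<noteq> y" "full_pair H U y q"
  using assms unfolding self_paired_def full_pair_def by metis

lemma self_pairedI:
  "S \<subseteq> U \<Longrightarrow> (\<And>y. y \<in> S \<Longrightarrow> \<exists>q\<in>S. full_pair H U y q) \<Longrightarrow> self_paired H U S"
  by (simp add: self_paired_def)

lemma berge_map_attach_paired:
  assumes "berge_map V E S H \<phi> f" "grown_tree V E" "self_paired H U P" "P \<subseteq> S" "s \<in> U" "s \<notin> S"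
    and "y \<in> V" "\<phi> y \<in> P" "x \<notin> V"
  shows "\<exists>f'. berge_map (insert x V) (insert {x, y} E) (insert s S) H (\<phi>(x := s)) f'"
proof -
  obtain q where q: "q \<in> P" "q \<noteq> \<phi> y" "full_pair H U (\<phi> y) q"
    using self_pairedE[OF assms(3,8)] .
  have "{\<phi> y, q, s} \<in> H"
    using full_pairD[OF q(3) assms(5)] assms(4,6,8) q(1) by blast
  then have "{s, \<phi> y, q} \<in> H" by (simp add: insert_commute)
  then show ?thesis
    using berge_map_attach[OF assms(1,2,7,9,6), of q] q(1,2) assms(4) by auto
qed

text \<open>If removing the full pair of \<open>x\<close> and \<open>q\<close> isolates a vertex
  \<open>y\<close>, then \<open>y\<close> has partners only in \<open>{x, q}\<close>, and
  \<open>y\<close> alone can be removed: \<open>x\<close> and \<open>q\<close> keep each other, and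
  no other vertex has \<open>y\<close> as a partner.\<close>

lemma prune_self_paired:
  assumes "self_paired H U S" "x \<in> S"
  shows "(\<exists>y\<in>S. self_paired H U (S - {y})) \<or>
         (\<exists>x\<in>S. \<exists>q\<in>S. full_pair H U x q \<and> self_paired H U (S - {x, q}))"
proof -
  obtain q where q: "q \<in> S" "q \<noteq> x" "full_pair H U x q" using self_pairedE[OF assms] .
  have SU: "S \<subseteq> U" using assms by (simp add: self_paired_def)
  show ?thesis
  proof (cases "self_paired H U (S - {x, q})")
    case True
    then show ?thesis using q assms(2) by blast
  next
    case False
    then obtain y where y: "y \<in> S - {x, q}" and iso: "\<And>r. r \<in> S - {x, q} \<Longrightarrow> \<not> full_pair H U y r"
      using SU unfolding self_paired_def by blast
    have "self_paired H U (S - {y})"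
    proof (rule self_pairedI)
      fix z assume z: "z \<in> S - {y}"
      show "\<exists>r\<in>S - {y}. full_pair H U z r"
      proof (cases "z \<in> {x, q}")
        case True
        then show ?thesis using q full_pair_sym[OF q(3)] y assms(2) by blast
      next
        case zxq: False
        obtain r where r: "r \<in> S" "r \<noteq> z" "full_pair H U z r"
          using self_pairedE[OF assms(1), of z] z by blast
        have "r \<noteq> y" using iso[of z] full_pair_sym[OF r(3)] z zxq by blast
        then show ?thesis using r by blast
      qed
    qed (use SU in blast)
    then show ?thesis using y by blast
  qed
qed

lemma prune_self_paired_three:
  assumes "self_paired H U W" "card W = 3"
  shows "\<exists>y\<in>W. self_paired H U (W - {y})"
proof -
  obtain a b c where W: "W = {a, b, c}" "a \<noteq> b" "a \<noteq> c" "b \<noteq> c"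
    using assms(2) by (metis card_3_iff)
  have ab: "full_pair H U a b \<or> full_pair H U a c"
    using self_pairedE[OF assms(1), of a] W by (metis insert_iff singletonD)
  have "full_pair H U b a \<or> full_pair H U b c"
    using self_pairedE[OF assms(1), of b] W by (metis insert_iff singletonD)
  moreover have "full_pair H U c a \<or> full_pair H U c b"
    using self_pairedE[OF assms(1), of c] W by (metis insert_iff singletonD)
  moreover have WU: "W \<subseteq> U" using assms(1) by (simp add: self_paired_def)
  have two: "\<exists>y\<in>W. self_paired H U (W - {y})"
    if "full_pair H U u v" "y \<in> W" "W - {y} = {u, v}" for u v y
    using that full_pair_sym[OF that(1)] WU by (intro bexI[of _ y]) (auto simp: self_paired_def)
  show ?thesis
    using ab
  proof
    assume "full_pair H U a b"
    then show ?thesis by (rule two[of _ _ c]) (use W in auto)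
  next
    assume "full_pair H U a c"
    then show ?thesis by (rule two[of _ _ b]) (use W in auto)
  qed
qed

text \<open>Removing a pair from five vertices would leave three, too few for the copies, which
  start at four. But the remaining three vertices contain a full pair, and the one left over can be
  removed by itself.\<close>

lemma prune_self_paired_five:
  assumes "self_paired H U S" "card S \<ge> 5"
  shows "(\<exists>y\<in>S. self_paired H U (S - {y})) \<or>
         (card S \<ge> 6 \<and> (\<exists>x\<in>S. \<exists>q\<in>S. full_pair H U x q \<and> self_paired H U (S - {x, q})))"
proof (cases "card S = 5")
  case False
  have "S \<noteq> {}" using assms(2) by auto
  then show ?thesis using prune_self_paired[OF assms(1)] False assms(2) by force
next
  case True
  have fin: "finite S" "S \<noteq> {}" using True card.infinite by fastforce+
  show ?thesis
  proof (cases "\<exists>y\<in>S. self_paired H U (S - {y})")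
    case single: False
    then obtain x q where xq: "x \<in> S" "q \<in> S" "full_pair H U x q" "self_paired H U (S - {x, q})"
      using prune_self_paired[OF assms(1)] fin by blast
    have "x \<noteq> q" using xq(3) by (simp add: full_pair_def)
    then have "card (S - {x, q}) = 3" using xq(1,2) True fin by (simp add: card_Diff_subset)
    then obtain y where y: "y \<in> S - {x, q}" "self_paired H U (S - {x, q} - {y})"
      using prune_self_paired_three[OF xq(4)] by blast
    have "self_paired H U (S - {y})"
    proof (rule self_pairedI)
      show "S - {y} \<subseteq> U" using assms(1) by (auto simp: self_paired_def)
      fix z assume z: "z \<in> S - {y}"
      consider "z = x" | "z = q" | "z \<in> S - {x, q} - {y}" using z by blast
      then show "\<exists>r\<in>S - {y}. full_pair H U z r"
      proof cases
        case 1
        then show ?thesis using xq y by blast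
      next
        case 2
        then show ?thesis using xq y full_pair_sym[OF xq(3)] by blast
      next
        case 3
        then show ?thesis using y(2) unfolding self_paired_def by blast
      qed
    qed
    then show ?thesis using y(1) by blast
  qed blast
qed

text \<open>On a four-element \<open>S\<close> a triple is named by the vertex it omits. The triples
  \<open>S - {t}\<close> with \<open>t\<close> different from \<open>m\<close> are the three that
  contain \<open>m\<close>.\<close>

definition three_at :: "'b set set \<Rightarrow> 'b set \<Rightarrow> 'b \<Rightarrow> bool" where
  "three_at H S m \<longleftrightarrow> m \<in> S \<and> (\<forall>t\<in>S - {m}. S - {t} \<in> H)"

lemma card_4E:
  assumes "card S = 4"
  obtains a b c d where "S = {a, b, c, d}" "distinct [a, b, c, d]"
proof -
  have fin: "finite S" using assms card.infinite by fastforce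
  obtain xs where "set xs = S" "distinct xs" "length xs = 4"
    using finite_distinct_list[OF fin] assms distinct_card by metis
  then obtain a b c d where "xs = [a, b, c, d]"
    by (auto simp: length_Suc_conv eval_nat_numeral)
  then show ?thesis using that[of a b c d] \<open>set xs = S\<close> \<open>distinct xs\<close> by auto
qed

text \<open>Three vertices have no room for disjoint edges, so without its last leaf the tree is a
  star. The leaf does not hang at the centre, since the whole tree is no star.\<close>

lemma path_shape:
  assumes "grown_tree V E" "card V = 4" "two_disjoint E"
  obtains a b c d where "distinct [a, b, c, d]" "V = {a, b, c, d}" "E = {{a, b}, {b, c}, {c, d}}"
  using assms(1)
proof cases
  case (leaf V' E' y x)
  have fin: "finite V'" using grown_tree_finite[OF leaf(3)] by blast
  have card: "card V' = 3" using assms(2) leaf(1,5) fin by simp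
  have "\<not> two_disjoint E'"
  proof
    assume "two_disjoint E'"
    then obtain e e' where e: "e \<in> E'" "e' \<in> E'" "e \<inter> e' = {}" by (auto simp: two_disjoint_def)
    have "card e = 2" "card e' = 2" "e \<subseteq> V'" "e' \<subseteq> V'"
      using grown_tree_edge[OF leaf(3)] e by (auto simp: card_2_iff) (metis)+
    then have "card (e \<union> e') = 4" "card (e \<union> e') \<le> 3"
      using card_mono[OF fin, of "e \<union> e'"] card fin e(3) finite_subset[of _ V']
      by (auto simp: card_Un_disjoint)
    then show False by simp
  qed
  then obtain c where c: "c \<in> V'" "E' = spokes c V'"
    using star_if_not_two_disjoint[OF leaf(3)] by blast
  have "y \<noteq> c"
  proof
    assume "y = c"
    then have "E = spokes c V"
      using leaf(1,2,5) c spokes_insert[of x c V'] by force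
    then show False using assms(3) not_two_disjoint_spokes by metis
  qed
  obtain l where l: "l \<in> V'" "l \<noteq> c" "l \<noteq> y"
    using card_remainder_nonempty[OF fin, of "[c, y]"] card by auto
  have "card {y, c, l} = 3" using l \<open>y \<noteq> c\<close> by auto
  then have V': "V' = {y, c, l}"
    using card_subset_eq[OF fin, of "{y, c, l}"] card c(1) l leaf(4) by auto
  have "E' = {{y, c}, {c, l}}"
    unfolding c(2) V' using l \<open>y \<noteq> c\<close> by (auto simp: spokes_def insert_commute)
  then show ?thesis
    using that[of x y c l] leaf(1,2,5) V' l \<open>y \<noteq> c\<close> by auto
qed (use assms in auto)

subsection \<open>Copies on four vertices and self-paired sets\<close>

lemma ex_bij_betw_point:
  assumes "finite A" "finite B" "card A = card B" "a \<in> A" "b \<in> B"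
  shows "\<exists>f. bij_betw f A B \<and> f a = b"
proof -
  have "card (A - {a}) = card (B - {b})" using assms by simp
  then obtain f where "bij_betw f (A - {a}) (B - {b})"
    using finite_same_card_bij[of "A - {a}" "B - {b}"] assms by blast
  then have "bij_betw (f(a := b)) A B"
    using bij_betw_extend_point[of f "A - {a}" "B - {b}" a b] assms(4,5) by (simp add: insert_absorb)
  then show ?thesis by (intro exI[of _ "f(a := b)"]) simp
qed

lemma ex_bij_betw_two_points:
  assumes "finite A" "finite B" "card A = card B" "a \<in> A" "b \<in> B" "a' \<in> A" "b' \<in> B" "a \<noteq> a'" "b \<noteq> b'"
  shows "\<exists>f. bij_betw f A B \<and> f a = b \<and> f a' = b'"
proof -
  have "card (A - {a}) = card (B - {b})" using assms by simp
  then obtain f where f: "bij_betw f (A - {a}) (B - {b})" "f a' = b'"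
    using ex_bij_betw_point[of "A - {a}" "B - {b}" a' b'] assms by auto
  then have "bij_betw (f(a := b)) A B"
    using bij_betw_extend_point[of f "A - {a}" "B - {b}" a b] assms(4,5) by (simp add: insert_absorb)
  then show ?thesis using f(2) assms(8) by (intro exI[of _ "f(a := b)"]) simp
qed

text \<open>Choosing triples of a four-element set for the edges means choosing the omitted
  vertices: \<open>g e\<close> is the tree vertex whose image the triple of \<open>e\<close> omits.
  It must lie off \<open>e\<close>, depend injectively on \<open>e\<close>, and not be sent to
  \<open>m\<close>.\<close>

lemma berge_map_omit:
  assumes "bij_betw \<phi> V S" "card S = 4" "three_at H S m" "inj_on g E"
    and "\<And>e. e \<in> E \<Longrightarrow> e \<subseteq> V \<and> g e \<in> V - e \<and> \<phi> (g e) \<noteq> m"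
  shows "berge_map V E S H \<phi> (\<lambda>e. S - {\<phi> (g e)})"
  unfolding berge_map_def
proof (intro conjI ballI)
  have inj: "inj_on \<phi> V" and im: "\<phi> ` V = S" using assms(1) by (auto simp: bij_betw_def)
  show "inj_on (\<lambda>e. S - {\<phi> (g e)}) E"
  proof (rule inj_onI)
    fix e e' assume e: "e \<in> E" "e' \<in> E" "S - {\<phi> (g e)} = S - {\<phi> (g e')}"
    have "\<phi> (g e) \<in> S" "\<phi> (g e') \<in> S" using assms(5) e im by blast+
    then have "\<phi> (g e) = \<phi> (g e')" using e(3) by blast
    then have "g e = g e'" using inj_onD[OF inj] assms(5) e by blast
    then show "e = e'" using inj_onD[OF assms(4)] e by blast
  qed
  fix e assume e: "e \<in> E"
  have ge: "e \<subseteq> V" "g e \<in> V" "g e \<notin> e" "\<phi> (g e) \<noteq> m" using assms(5)[OF e] by auto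
  have S: "\<phi> (g e) \<in> S" using ge im by blast
  show "\<phi> ` e \<subseteq> S - {\<phi> (g e)}"
  proof (rule image_subsetI)
    fix x assume x: "x \<in> e"
    then have "\<phi> x \<in> S" using ge(1) im by (metis imageI subsetD)
    moreover have "\<phi> x \<noteq> \<phi> (g e)"
      using inj_onD[OF inj, of x "g e"] ge(1-3) x by auto
    ultimately show "\<phi> x \<in> S - {\<phi> (g e)}" by simp
  qed
  show "card (S - {\<phi> (g e)}) = 3" using assms(2) S by (simp add: card_Diff_singleton)
  show "S - {\<phi> (g e)} \<in> H" using assms(3) S ge(4) by (auto simp: three_at_def)
qed (use assms in auto)

text \<open>No bijection is bad for a path. The three vertices not sent to \<open>m\<close> can
  always be distributed as omitted vertices \<open>u\<close>, \<open>v\<close>, \<open>w\<close> of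
  the three edges; the table at the end lists one distribution for each preimage of
  \<open>m\<close>.\<close>

lemma berge_map_four_path:
  assumes "distinct [a, b, c, d]" "V = {a, b, c, d}" "E = {{a, b}, {b, c}, {c, d}}"
    and bij: "bij_betw \<phi> V S" and m: "three_at H S m"
  shows "\<exists>f. berge_map V E S H \<phi> f"
proof -
  have card: "card S = 4" using bij_betw_same_card[OF bij] assms(1,2) by simp
  have inj: "inj_on \<phi> V" using bij by (simp add: bij_betw_def)
  have neq: "\<phi> x \<noteq> \<phi> y" if "x \<in> V" "y \<in> V" "x \<noteq> y" for x y
    using inj_onD[OF inj] that by blast
  have *: "\<exists>f. berge_map V E S H \<phi> f"
    if "u \<in> {c, d}" "v \<in> {a, d}" "w \<in> {a, b}" "distinct [u, v, w]"
      "\<phi> u \<noteq> m" "\<phi> v \<noteq> m" "\<phi> w \<noteq> m" for u v w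
  proof -
    define g where "g = (\<lambda>_ :: 'a set. w)({a, b} := u, {b, c} := v)"
    have g: "g {a, b} = u" "g {b, c} = v" "g {c, d} = w"
      using assms(1) by (auto simp: g_def doubleton_eq_iff)
    have "inj_on g E"
      unfolding assms(3) inj_on_def using g that(4) by auto
    moreover have "e \<subseteq> V \<and> g e \<in> V - e \<and> \<phi> (g e) \<noteq> m" if "e \<in> E" for e
      using that \<open>u \<in> _\<close> \<open>v \<in> _\<close> \<open>w \<in> _\<close> \<open>\<phi> u \<noteq> m\<close> \<open>\<phi> v \<noteq> m\<close> \<open>\<phi> w \<noteq> m\<close> assms(1) g
      unfolding assms(2,3) by auto
    ultimately show ?thesis using berge_map_omit[OF bij card m] by blast
  qed
  have "m \<in> \<phi> ` V" using m bij by (simp add: three_at_def bij_betw_def)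
  then consider "m = \<phi> a" | "m = \<phi> b" | "m = \<phi> c" | "m = \<phi> d" unfolding assms(2) by blast
  then show ?thesis
  proof cases
    case 1
    then show ?thesis by (intro *[of c d b]) (use assms(1,2) neq in auto)
  next
    case 2
    then show ?thesis by (intro *[of c d a]) (use assms(1,2) neq in auto)
  next
    case 3
    then show ?thesis by (intro *[of d a b]) (use assms(1,2) neq in auto)
  next
    case 4
    then show ?thesis by (intro *[of c a b]) (use assms(1,2) neq in auto)
  qed
qed

text \<open>With the centre on the common vertex of the three triples, the edges to
  \<open>b\<close>, \<open>c\<close>, \<open>d\<close> omit \<open>c\<close>, \<open>d\<close>,
  \<open>b\<close> in cyclic order.\<close>

lemma berge_map_four_star:
  assumes "distinct [a, b, c, d]" "V = {a, b, c, d}" "E = {{a, b}, {a, c}, {a, d}}"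
    and bij: "bij_betw \<phi> V S" and m: "three_at H S (\<phi> a)"
  shows "\<exists>f. berge_map V E S H \<phi> f"
proof -
  have card: "card S = 4" using bij_betw_same_card[OF bij] assms(1,2) by simp
  have inj: "inj_on \<phi> V" using bij by (simp add: bij_betw_def)
  have neq: "\<phi> x \<noteq> \<phi> y" if "x \<in> V" "y \<in> V" "x \<noteq> y" for x y
    using inj_onD[OF inj] that by blast
  define g where "g = (\<lambda>_ :: 'a set. b)({a, b} := c, {a, c} := d)"
  have g: "g {a, b} = c" "g {a, c} = d" "g {a, d} = b"
    using assms(1) by (auto simp: g_def doubleton_eq_iff)
  have "inj_on g E"
    unfolding assms(3) inj_on_def using g assms(1) by auto
  moreover have "\<phi> b \<noteq> \<phi> a" "\<phi> c \<noteq> \<phi> a" "\<phi> d \<noteq> \<phi> a"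
    using neq[of b a] neq[of c a] neq[of d a] assms(1,2) by auto
  then have "e \<subseteq> V \<and> g e \<in> V - e \<and> \<phi> (g e) \<noteq> \<phi> a" if "e \<in> E" for e
    using that assms(1,2) g unfolding assms(3) by (elim insertE emptyE) auto
  ultimately show ?thesis using berge_map_omit[OF bij card m] by blast
qed

text \<open>The vertex \<open>w\<close> plays the part of a vertex without full pair, where no leaf
  can be attached; so \<open>p\<close> and \<open>p'\<close>, which await leaves, are kept off it. A
  path may be placed by any bijection. A star has its centre on \<open>z\<close>, and one of its
  leaves other than \<open>p\<close> and \<open>p'\<close> goes to \<open>w\<close>.\<close>

lemma spans_four:
  assumes "grown_tree V E" "card V = 4" "card S = 4" "three_at H S z" "w \<in> S" "w \<noteq> z"
    and "p \<in> V" "p' \<in> V"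
  shows "\<exists>\<phi> f. berge_map V E S H \<phi> f \<and> \<phi> p \<noteq> w \<and> \<phi> p' \<noteq> w"
proof -
  have fin: "finite V" "finite S" using assms(2,3) card.infinite by fastforce+
  have avoid: "\<phi> q \<noteq> w" if "bij_betw \<phi> V S" "x \<in> V" "\<phi> x = w" "q \<in> V" "q \<noteq> x" for \<phi> x q
    using that by (auto simp: bij_betw_def dest: inj_onD)
  show ?thesis
  proof (cases "two_disjoint E")
    case True
    obtain a b c d where abcd: "distinct [a, b, c, d]" "V = {a, b, c, d}" "E = {{a, b}, {b, c}, {c, d}}"
      using path_shape[OF assms(1,2) True] .
    obtain x where x: "x \<in> V" "x \<noteq> p" "x \<noteq> p'"
      using card_remainder_nonempty[OF fin(1), of "[p, p']"] assms(2) by auto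
    obtain \<phi> where \<phi>: "bij_betw \<phi> V S" "\<phi> x = w"
      using ex_bij_betw_point[OF fin _ x(1) assms(5)] assms(2,3) by auto
    obtain f where "berge_map V E S H \<phi> f"
      using berge_map_four_path[OF abcd \<phi>(1) assms(4)] by blast
    then show ?thesis using avoid[OF \<phi>(1) x(1) \<phi>(2)] x assms(7,8) by metis
  next
    case False
    obtain a where a: "a \<in> V" "E = spokes a V"
      using star_if_not_two_disjoint[OF assms(1) False] by blast
    obtain b where b: "b \<in> V" "b \<noteq> a" "b \<noteq> p" "b \<noteq> p'"
      using card_remainder_nonempty[OF fin(1), of "[a, p, p']"] assms(2) by auto
    obtain c where c: "c \<in> V" "c \<noteq> a" "c \<noteq> b"
      using card_remainder_nonempty[OF fin(1), of "[a, b]"] assms(2) by auto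
    obtain d where d: "d \<in> V" "d \<noteq> a" "d \<noteq> b" "d \<noteq> c"
      using card_remainder_nonempty[OF fin(1), of "[a, b, c]"] assms(2) by auto
    have dist: "distinct [a, b, c, d]" using b c d by auto
    then have V: "V = {a, b, c, d}"
      using card_subset_eq[OF fin(1), of "{a, b, c, d}"] a(1) b(1) c(1) d(1) assms(2) by auto
    have E: "E = {{a, b}, {a, c}, {a, d}}"
      unfolding a(2) V using dist by (auto simp: spokes_def)
    have "z \<in> S" using assms(4) by (simp add: three_at_def)
    then obtain \<phi> where \<phi>: "bij_betw \<phi> V S" "\<phi> a = z" "\<phi> b = w"
      using ex_bij_betw_two_points[OF fin _ a(1) _ b(1) assms(5), of z] assms(2,3,6) b(2) by auto
    obtain f where "berge_map V E S H \<phi> f"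
      using berge_map_four_star[OF dist V E \<phi>(1)] assms(4) \<phi>(2) by blast
    then show ?thesis using avoid[OF \<phi>(1) b(1) \<phi>(3)] b assms(7,8) by metis
  qed
qed

text \<open>The full pair of \<open>a\<close> and \<open>q\<close> yields the triples omitting
  \<open>u\<close> and \<open>v\<close>. The pair of \<open>u\<close> with its partner
  \<open>r\<close> yields a third: the one omitting \<open>a\<close> if \<open>r = q\<close>, and
  the one omitting \<open>q\<close> otherwise. The common vertex is \<open>q\<close> or
  \<open>a\<close>.\<close>

lemma self_paired_three_at:
  assumes "self_paired H U S" "card S = 4"
  shows "\<exists>z. three_at H S z"
proof -
  obtain a b c d where S: "S = {a, b, c, d}" and dist: "distinct [a, b, c, d]"
    using card_4E[OF assms(2)] .
  have full: "S - {t} \<in> H" if "full_pair H U u v" "u \<in> S" "v \<in> S" "t \<in> S" "t \<noteq> u" "t \<noteq> v" for u v t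
  proof -
    have "u \<noteq> v" using that(1) by (simp add: full_pair_def)
    then have "card (S - {u, v, t}) = 1"
      using that assms(2) by (subst card_Diff_subset) auto
    then obtain s where s: "S - {u, v, t} = {s}" by (auto simp: card_1_singleton_iff)
    then have "S - {t} = {u, v, s}" using that by auto
    moreover have "s \<in> U" "s \<noteq> u" "s \<noteq> v" using s assms(1) by (auto simp: self_paired_def)
    ultimately show ?thesis using full_pairD[OF that(1)] by simp
  qed
  obtain q where q: "q \<in> S" "q \<noteq> a" "full_pair H U a q"
    using self_pairedE[OF assms(1), of a] S by auto
  have "card (S - {a, q}) = 2" using q S assms(2) by (subst card_Diff_subset) auto
  then obtain u v where uv: "S - {a, q} = {u, v}" "u \<noteq> v" by (auto simp: card_2_iff)
  have SE: "S = {a, q, u, v}" using uv(1) q(1) S by auto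
  obtain r where r: "r \<in> S" "r \<noteq> u" "full_pair H U u r"
    using self_pairedE[OF assms(1), of u] uv by auto
  have aS: "a \<in> S" "u \<in> S" "v \<in> S" and nv: "v \<noteq> a" "v \<noteq> q" "u \<noteq> a" "u \<noteq> q"
    using S uv by auto
  have uvH: "S - {u} \<in> H" "S - {v} \<in> H"
    using full[OF q(3) aS(1) q(1)] aS nv by auto
  show ?thesis
  proof (cases "r = q")
    case True
    have "S - {a} \<in> H" using full[OF r(3) aS(2) r(1) aS(1)] nv True q(2) by auto
    then have "three_at H S q" using uvH q(1) unfolding three_at_def SE by auto
    then show ?thesis by blast
  next
    case False
    have "S - {q} \<in> H" using full[OF r(3) aS(2) r(1) q(1)] nv False by auto
    then have "three_at H S a" using uvH aS(1) unfolding three_at_def SE by auto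
    then show ?thesis by blast
  qed
qed

text \<open>Pruning the set by a vertex or a full pair is matched by removing one leaf or two leaves
  in succession. The induction starts at four because three vertices carry a single triple while
  their trees have two edges.\<close>

lemma spans_if_self_paired:
  assumes "self_paired H U S" "card S \<ge> 4" "grown_tree V E" "card V = card S"
  shows "spans V E S H"
  using assms
proof (induction "card S" arbitrary: S V E rule: less_induct)
  case less
  have fin: "finite S" using less.prems(2) card.infinite by fastforce
  have finV: "finite V" using grown_tree_finite[OF less.prems(3)] by blast
  have SU: "S \<subseteq> U" using less.prems(1) by (simp add: self_paired_def)
  show ?case
  proof (cases "card S = 4")
    case True
    obtain z where z: "three_at H S z"
      using self_paired_three_at[OF less.prems(1) True] by blast
    obtain w where w: "w \<in> S" "w \<noteq> z"
      using card_remainder_nonempty[OF fin, of "[z]"] True by auto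
    obtain p where p: "p \<in> V" using grown_tree_nonempty[OF less.prems(3)] by blast
    then show ?thesis
      using spans_four[OF less.prems(3) _ True z w p p] less.prems(4) True spansI by metis
  next
    case False
    then have "card S \<ge> 5" using less.prems(2) by simp
    from prune_self_paired_five[OF less.prems(1) this] show ?thesis
    proof (elim disjE conjE bexE)
      fix s assume s: "s \<in> S" "self_paired H U (S - {s})"
      show ?thesis
        using less.prems(3)
      proof cases
        case (leaf V' E' y x)
        have finV': "finite V'" using grown_tree_finite[OF leaf(3)] by blast
        have c: "card (S - {s}) = card V'" "card (S - {s}) < card S" "card (S - {s}) \<ge> 4"
          using s(1) fin less.prems(4) leaf(1,5) finV' \<open>card S \<ge> 5\<close> by auto
        have "spans V' E' (S - {s}) H"
          using less.hyps[OF c(2) s(2) c(3) leaf(3)] c(1) by simp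
        then obtain \<phi> f where f: "berge_map V' E' (S - {s}) H \<phi> f" unfolding spans_def by blast
        have "insert s (S - {s}) = S" "s \<in> U" using s(1) SU by auto
        then show ?thesis
          using berge_map_attach_paired[OF f leaf(3) s(2) order_refl _ _ leaf(4) berge_map_in[OF f leaf(4)] leaf(5)]
            spansI leaf(1,2) by (metis Diff_iff singletonI)
      qed (use less.prems in auto)
    next
      fix s q
      assume six: "6 \<le> card S" and s: "s \<in> S" "q \<in> S" "full_pair H U s q" "self_paired H U (S - {s, q})"
      have sq: "s \<noteq> q" using s(3) by (simp add: full_pair_def)
      let ?S = "S - {s, q}"
      have cS: "card ?S = card S - 2" using s sq fin by (simp add: card_Diff_subset)
      show ?thesis
        using less.prems(3)
      proof cases
        case (leaf V1 E1 y x)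
        have V1: "finite V1" "card V1 = card S - 1"
          using grown_tree_finite[OF leaf(3)] less.prems(4) leaf(1,5) by auto
        note l1 = leaf
        show ?thesis
          using leaf(3)
        proof cases
          case (leaf V2 E2 b a)
          have V2: "finite V2" "card V2 = card ?S"
            using grown_tree_finite[OF leaf(3)] V1 leaf(1,5) cS by auto
          have "spans V2 E2 ?S H"
            using less.hyps[OF _ s(4) _ leaf(3)] cS V2 six by simp
          then obtain \<phi> f where f: "berge_map V2 E2 ?S H \<phi> f" unfolding spans_def by blast
          have sU: "s \<in> U" "q \<in> U" using s SU by auto
          obtain f' where f': "berge_map V1 E1 (insert s ?S) H (\<phi>(a := s)) f'"
            using berge_map_attach_paired[OF f leaf(3) s(4) order_refl sU(1) _ leaf(4) berge_map_in[OF f leaf(4)] leaf(5)]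
              leaf(1,2) by auto
          have q_new: "q \<notin> insert s ?S" using sq by auto
          have full: "insert q (insert s ?S) = S" using s by auto
          show ?thesis
          proof (cases "y = a")
            case False
            then have "y \<in> V2" using l1(4) leaf(1) by blast
            then have "(\<phi>(a := s)) y \<in> ?S" using berge_map_in[OF f] False by simp
            then show ?thesis
              using berge_map_attach_paired[OF f' l1(3) s(4) _ sU(2) q_new l1(4) _ l1(5)] spansI
                l1(1,2) full by (metis subset_insertI)
          next
            case True
            \<comment> \<open>The second leaf hangs at \<open>a\<close>, whose image
              \<open>s\<close> lies outside the pruned set. Here the removed pair helps itself:
              \<open>s\<close> and \<open>q\<close> form a full pair, so any remaining
              \<open>t\<close> completes a triple.\<close>
            have "?S \<noteq> {}" using cS six by (metis card.empty diff_is_0_eq not_numeral_le_zero le_trans numeral_le_iff semiring_norm(69,72) zero_diff le_diff_conv2 add_0 nat_le_linear)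
            then obtain t where t: "t \<in> ?S" by blast
            then have "{q, (\<phi>(a := s)) y, t} \<in> H"
              using full_pairD[OF full_pair_sym[OF s(3)], of t] SU True by auto
            then have "berge_map (insert x V1) (insert {x, y} E1) (insert q (insert s ?S)) H
                ((\<phi>(a := s))(x := q)) (f'({x, y} := {q, (\<phi>(a := s)) y, t}))"
              by (rule berge_map_attach[OF f' l1(3,4,5) q_new]) (use t True in auto)
            then show ?thesis using full l1(1,2) spansI by metis
          qed
        qed (use V1 six in auto)
      qed (use less.prems in auto)
    qed
  qed
qed

subsection \<open>Stars\<close>

text \<open>In the link graph of \<open>c\<close>, with edges \<open>{x, y}\<close> for triples
  \<open>{c, x, y}\<close> of \<open>H\<close>, the map \<open>h\<close> chooses an incident edge at
  each vertex of \<open>G\<close>. The condition on \<open>h (h x)\<close> says that no edge is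
  chosen from both its ends, so that the chosen triples are distinct: they form a Berge star with
  centre \<open>c\<close>.\<close>

definition link_map :: "'b set set \<Rightarrow> 'b \<Rightarrow> 'b set \<Rightarrow> ('b \<Rightarrow> 'b) \<Rightarrow> bool" where
  "link_map H c G h \<longleftrightarrow> c \<notin> G \<and> (\<forall>x\<in>G. h x \<in> G \<and> h x \<noteq> x \<and> h (h x) \<noteq> x \<and> {c, x, h x} \<in> H)"

lemma link_map_triple_inj:
  assumes "link_map H c G h" "x \<in> G" "y \<in> G" "{c, x, h x} = {c, y, h y}"
  shows "x = y"
proof (rule ccontr)
  assume "x \<noteq> y"
  have h: "h x \<noteq> c" "h y \<noteq> c" "x \<noteq> c" "y \<noteq> c" "h (h x) \<noteq> x" "h x \<noteq> x" "h y \<noteq> y"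
    using assms(1-3) by (auto simp: link_map_def)
  then have "{x, h x} = {y, h y}" using assms(4) by (metis insert_ident insertE singletonD)
  then have "x = h y" "y = h x" using \<open>x \<noteq> y\<close> by (auto simp: doubleton_eq_iff)
  then show False using h(5) by simp
qed

lemma spans_star:
  assumes "link_map H c (S - {c}) h" "c \<in> S" "finite S" "finite V" "card V = card S" "a \<in> V"
  shows "spans V (spokes a V) S H"
proof -
  obtain \<phi> where \<phi>: "bij_betw \<phi> V S" "\<phi> a = c"
    using ex_bij_betw_point[OF assms(4,3,5,6,2)] by blast
  have inj: "inj_on \<phi> V" using \<phi>(1) by (simp add: bij_betw_def)
  \<comment> \<open>On a spoke, \<open>e - {a}\<close> contains just the outer vertex; the formula
    thus recovers this vertex from the edge.\<close>
  define f where "f e = insert c (\<phi> ` (e - {a}) \<union> h ` \<phi> ` (e - {a}))" for e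
  have f: "f {a, v} = {c, \<phi> v, h (\<phi> v)}" if "v \<noteq> a" for v
  proof -
    have "{a, v} - {a} = {v}" using that by auto
    then show ?thesis by (simp add: f_def insert_commute)
  qed
  have im: "\<phi> v \<in> S - {c}" if "v \<in> V - {a}" for v
  proof -
    have "\<phi> v \<in> S" using \<phi>(1) that by (auto simp: bij_betw_def)
    moreover have "\<phi> v \<noteq> c" using inj_onD[OF inj, of v a] that \<phi>(2) assms(6) by auto
    ultimately show ?thesis by simp
  qed
  have link: "h z \<in> S - {c}" "h z \<noteq> z" "{c, z, h z} \<in> H" if "z \<in> S - {c}" for z
    using assms(1) that by (auto simp: link_map_def)
  have "inj_on f (spokes a V)"
  proof (rule inj_onI)
    fix e e' assume "e \<in> spokes a V" "e' \<in> spokes a V" and eq: "f e = f e'"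
    then obtain v v' where v: "v \<in> V - {a}" "e = {a, v}" "v' \<in> V - {a}" "e' = {a, v'}"
      by (auto simp: spokes_def)
    then have "\<phi> v = \<phi> v'"
      using link_map_triple_inj[OF assms(1) im im] eq f by auto
    then show "e = e'" using v inj_onD[OF inj] by auto
  qed
  moreover have "\<phi> ` e \<subseteq> f e \<and> f e \<subseteq> S \<and> card (f e) = 3 \<and> f e \<in> H" if "e \<in> spokes a V" for e
  proof -
    obtain v where v: "v \<in> V - {a}" "e = {a, v}" using \<open>e \<in> spokes a V\<close> by (auto simp: spokes_def)
    then have fe: "f e = {c, \<phi> v, h (\<phi> v)}" using f by simp
    have "\<phi> v \<in> S - {c}" using im[OF v(1)] .
    moreover have "\<phi> ` e = {c, \<phi> v}" using v(2) \<phi>(2) by simp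
    ultimately show ?thesis using link[of "\<phi> v"] assms(2) by (auto simp: fe)
  qed
  ultimately show ?thesis
    using \<phi>(1) by (intro spansI[of V _ S H \<phi> f]) (simp add: berge_map_def)
qed

lemma link_map_insert:
  assumes "link_map H c G h" "s \<notin> G" "s \<noteq> c" "y \<in> G" "{c, s, y} \<in> H"
  shows "link_map H c (insert s G) (h(s := y))"
proof -
  have G: "h x \<in> G" "h x \<noteq> x" "h (h x) \<noteq> x" "{c, x, h x} \<in> H" "x \<noteq> s" "h x \<noteq> s" if "x \<in> G" for x
    using assms(1,2) that unfolding link_map_def by metis+
  have "c \<notin> insert s G" using assms(1,3) by (simp add: link_map_def)
  moreover have "(h(s := y)) x \<in> insert s G \<and> (h(s := y)) x \<noteq> x \<and>
      (h(s := y)) ((h(s := y)) x) \<noteq> x \<and> {c, x, (h(s := y)) x} \<in> H"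
    if "x \<in> insert s G" for x
  proof (cases "x = s")
    case True
    then show ?thesis using G[OF assms(4)] assms(4,5) by simp
  next
    case False
    then show ?thesis using G[of x] that by simp
  qed
  ultimately show ?thesis unfolding link_map_def by blast
qed

lemma link_map_triangle:
  assumes "distinct [c, x, y, z]" "{c, x, y} \<in> H" "{c, y, z} \<in> H" "{c, z, x} \<in> H"
  shows "link_map H c {x, y, z} (\<lambda>w. if w = x then y else if w = y then z else x)"
  using assms distinct_rev[of "[c, x, y, z]"] by (simp add: link_map_def)

lemma link_map_pentagon:
  assumes "distinct [c, x, y, z, u, v]"
    "{c, x, y} \<in> H" "{c, y, z} \<in> H" "{c, z, u} \<in> H" "{c, u, v} \<in> H" "{c, v, x} \<in> H"
  shows "link_map H c {x, y, z, u, v} (\<lambda>w. if w = x then y else if w = y then z else if w = z then u else if w = u then v else x)"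
  using assms distinct_rev[of "[c, x, y, z, u, v]"] by (simp add: link_map_def)

text \<open>In the link of \<open>c\<close> the partner \<open>t\<close> is joined to everything
  else. All vertices choose their edge to \<open>t\<close>, except along the oriented triangle
  \<open>t\<close>, \<open>y\<close>, \<open>y'\<close>, which gives \<open>t\<close> an edge of its
  own.\<close>

lemma link_map_full_pair:
  assumes "full_pair H S c t" "y \<in> S - {c, t}" "y' \<in> S - {c, t}" "y \<noteq> y'" "{c, y, y'} \<in> H"
  shows "link_map H c (S - {c}) ((\<lambda>_. t)(t := y, y := y'))"
proof -
  have ct: "c \<noteq> t" "t \<in> S" using assms(1) by (auto simp: full_pair_def)
  have full: "{c, x, t} \<in> H" if "x \<in> S - {c, t}" for x
    using full_pairD[OF assms(1), of x] that by (auto simp: insert_commute)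
  have "{c, t, y} \<in> H" using full[OF assms(2)] by (simp add: insert_commute)
  then show ?thesis using assms(2-5) ct full unfolding link_map_def by auto
qed

text \<open>The centre is an end of a full pair of \<open>u\<close> and \<open>v\<close>; what is
  missing is a link edge away from the partner. A third paired vertex \<open>y\<close> with its
  partner \<open>q\<close> provides it. If \<open>q\<close> is \<open>u\<close> or \<open>v\<close>,
  the centre is \<open>q\<close> and a fourth vertex \<open>x\<close> is used; otherwise the edge is
  that of \<open>y\<close> and \<open>q\<close> in the link of \<open>u\<close>.\<close>

lemma link_map_if_self_paired:
  assumes "self_paired H S R" "card R \<ge> 3" "card S \<ge> 4"
  shows "\<exists>c\<in>S. \<exists>h. link_map H c (S - {c}) h"
proof -
  have fin: "finite R" "finite S" using assms(2,3) card.infinite by fastforce+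
  have RS: "R \<subseteq> S" using assms(1) by (simp add: self_paired_def)
  obtain u where u: "u \<in> R" using assms(2) by fastforce
  obtain v where v: "v \<in> R" "v \<noteq> u" "full_pair H S u v" using self_pairedE[OF assms(1) u] .
  obtain y where y: "y \<in> R" "y \<noteq> u" "y \<noteq> v"
    using card_remainder_nonempty[OF fin(1), of "[u, v]"] assms(2) by auto
  obtain q where q: "q \<in> R" "q \<noteq> y" "full_pair H S y q" using self_pairedE[OF assms(1) y(1)] .
  obtain x where x: "x \<in> S" "x \<noteq> u" "x \<noteq> v" "x \<noteq> y"
    using card_remainder_nonempty[OF fin(2), of "[u, v, y]"] assms(3) by auto
  consider "q = u" | "q = v" | "q \<noteq> u" "q \<noteq> v" by blast
  then show ?thesis
  proof cases
    case 1
    then have "{u, y, x} \<in> H" using full_pairD[OF q(3), of x] x by (simp add: insert_commute)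
    then have "link_map H u (S - {u}) ((\<lambda>_. v)(v := y, y := x))"
      using link_map_full_pair[OF v(3), of y x] x y RS by auto
    then show ?thesis using u RS by blast
  next
    case 2
    then have "{v, y, x} \<in> H" using full_pairD[OF q(3), of x] x by (simp add: insert_commute)
    then have "link_map H v (S - {v}) ((\<lambda>_. u)(u := y, y := x))"
      using link_map_full_pair[OF full_pair_sym[OF v(3)], of y x] x y RS by auto
    then show ?thesis using v RS by blast
  next
    case 3
    then have "{u, y, q} \<in> H" using full_pairD[OF q(3), of u] y u RS by (auto simp: insert_commute)
    then have "link_map H u (S - {u}) ((\<lambda>_. v)(v := y, y := q))"
      using link_map_full_pair[OF v(3), of y q] 3 q y RS by auto
    then show ?thesis using u RS by blast
  qed
qed

text \<open>The oriented four-cycle \<open>y\<close>, \<open>s'\<close>, \<open>y'\<close>,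
  \<open>s\<close> lies in the complete bipartite link between \<open>G\<close> and the rest; every
  other vertex points to \<open>s\<close> or \<open>y\<close> on the opposite side.\<close>

lemma link_map_bipartite:
  assumes "G \<subseteq> L" "c \<notin> L" "\<And>s y. s \<in> L - G \<Longrightarrow> y \<in> G \<Longrightarrow> {c, s, y} \<in> H"
    and "s \<in> L - G" "s' \<in> L - G" "s \<noteq> s'" "y \<in> G" "y' \<in> G" "y \<noteq> y'"
  shows "\<exists>h. link_map H c L h"
proof -
  define h where "h = (\<lambda>x. if x = y then s' else if x \<in> G then s else if x = s' then y' else y)"
  have sym: "{c, y, s} \<in> H" if "s \<in> L - G" "y \<in> G" for s y
    using assms(3)[OF that] by (simp add: insert_commute)
  have "link_map H c L h"
    unfolding link_map_def
  proof (intro conjI ballI)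
    fix x assume x: "x \<in> L"
    show "h x \<in> L" using assms by (auto simp: h_def)
    show "h x \<noteq> x" using assms by (auto simp: h_def)
    show "h (h x) \<noteq> x" using assms by (auto simp: h_def)
    show "{c, x, h x} \<in> H" using x assms(3-9) sym by (auto simp: h_def)
  qed (use assms in blast)
  then show ?thesis by blast
qed

text \<open>Let \<open>M\<close> be a largest set with a link map in \<open>H\<close> that contains
  \<open>G\<close>. Every link edge between \<open>M\<close> and an outside vertex has the other
  colour. Two outside vertices then give a complete bipartite link of that colour with both sides
  large enough; a single outside vertex would form a full pair of \<open>- H\<close> with
  \<open>v\<close>.\<close>

lemma link_map_extend:
  assumes "finite S" "v \<in> S" "link_map H v G h" "G \<subseteq> S" "card G \<ge> 3"
    and "\<And>u. \<not> full_pair (-H) S v u"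
  shows "\<exists>h. link_map H v (S - {v}) h \<or> link_map (-H) v (S - {v}) h"
proof -
  let ?P = "\<lambda>G. G \<subseteq> S - {v} \<and> (\<exists>h. link_map H v G h)"
  have fin: "finite {G. ?P G}"
    by (rule finite_subset[of _ "Pow (S - {v})"]) (use assms(1) in auto)
  have "G \<in> {G. ?P G}" using assms(3,4) by (auto simp: link_map_def)
  then obtain M where M: "M \<in> {G. ?P G}" "G \<subseteq> M" and
    max: "\<forall>M'\<in>{G. ?P G}. M \<subseteq> M' \<longrightarrow> M = M'"
    by (rule bexE[OF finite_has_maximal2[OF fin]]) (elim conjE)
  then obtain k where k: "link_map H v M k" and MS: "M \<subseteq> S - {v}" by auto
  have blue: "{v, s, y} \<in> -H" if "s \<in> (S - {v}) - M" "y \<in> M" for s y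
  proof (rule ccontr)
    assume "{v, s, y} \<notin> -H"
    then have "link_map H v (insert s M) (k(s := y))"
      using link_map_insert[OF k, of s y] that by auto
    then have "insert s M \<in> {G. ?P G}" using MS that by blast
    then have "M = insert s M" using max by blast
    then show False using that by blast
  qed
  show ?thesis
  proof (cases "M = S - {v}")
    case True
    then show ?thesis using k by blast
  next
    case False
    then obtain s where s: "s \<in> (S - {v}) - M" using MS by blast
    have "card M \<ge> 3"
      using card_mono[OF finite_subset[OF MS] M(2)] assms(1,5) by simp
    then have fM: "finite M" "card M > length [s]" using card.infinite by fastforce+
    obtain y where y: "y \<in> M"
      using card_remainder_nonempty[OF fM] by blast
    obtain y' where y': "y' \<in> M" "y' \<noteq> y"
      using card_remainder_nonempty[OF fM(1), of "[y]"] \<open>card M \<ge> 3\<close> by auto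
    show ?thesis
    proof (cases "\<exists>s'\<in>(S - {v}) - M. s' \<noteq> s")
      case True
      then obtain s' where s': "s' \<in> (S - {v}) - M" "s' \<noteq> s" by blast
      have "\<exists>h. link_map (-H) v (S - {v}) h"
        by (rule link_map_bipartite[of M _ _ _ s s' y y']) (use MS blue s s' y y' in auto)
      then show ?thesis by blast
    next
      case False
      have "{v, s, z} \<in> -H" if "z \<in> S - {v, s}" for z
        using blue[OF s] False that by blast
      then have "full_pair (-H) S v s" using s assms(2) by (auto simp: full_pair_def)
      then show ?thesis using assms(6) by blast
    qed
  qed
qed

text \<open>Three neighbours or three non-neighbours of \<open>a\<close> would force a one-coloured
  triangle, so there are two of each: \<open>x\<close>, \<open>y\<close> joined to \<open>a\<close>,
  and \<open>z\<close>, \<open>u\<close> not. Then \<open>x\<close>, \<open>y\<close> are not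
  joined, \<open>z\<close>, \<open>u\<close> are, and the edges between the two pairs form a
  matching, which closes a five-cycle. This is the extremal colouring for two triangles.\<close>

lemma triangle_or_pentagon:
  fixes r :: "'b \<Rightarrow> 'b \<Rightarrow> bool"
  assumes sym: "\<And>x y. r x y = r y x" and dist: "distinct [a, b, c, d, e]"
    and no_tri: "\<And>x y z. distinct [x, y, z] \<Longrightarrow> {x, y, z} \<subseteq> {a, b, c, d, e} \<Longrightarrow>
      \<not> (r x y \<and> r y z \<and> r z x) \<and> (r x y \<or> r y z \<or> r z x)"
  shows "\<exists>x y z u v. distinct [x, y, z, u, v] \<and> {x, y, z, u, v} = {a, b, c, d, e} \<and>
      r x y \<and> r y z \<and> r z u \<and> r u v \<and> r v x"
proof -
  have pent: ?thesis
    if "distinct [x, y, z, u, v]" "{x, y, z, u, v} = {a, b, c, d, e}"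
      "r a x \<and> r a y \<and> \<not> r a z \<and> \<not> r a u" "v = a" for x y z u v
  proof -
    have sub: "x \<in> {a, b, c, d, e}" "y \<in> {a, b, c, d, e}" "z \<in> {a, b, c, d, e}" "u \<in> {a, b, c, d, e}"
      using that(2) by blast+
    have t: "\<not> (r p q \<and> r q s \<and> r s p) \<and> (r p q \<or> r q s \<or> r s p)"
      if "distinct [p, q, s]" "p \<in> {a, x, y, z, u}" "q \<in> {a, x, y, z, u}" "s \<in> {a, x, y, z, u}" for p q s
      by (rule no_tri) (use that sub in auto)
    have "\<not> r x y" "r z u" using t[of a x y] t[of a z u] that sym by auto
    moreover have "\<not> (r x z \<and> r x u)" "r x z \<or> r y z" "r x u \<or> r y u" "\<not> (r y z \<and> r y u)"
      using t[of x z u] t[of y z u] t[of x y z] t[of x y u] that sym \<open>\<not> r x y\<close> \<open>r z u\<close> by auto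
    ultimately consider "r x z" "r u y" | "r x u" "r z y" using sym by blast
    then show ?thesis
    proof cases
      case 1
      show ?thesis
      proof (rule exI[of _ a], rule exI[of _ x], rule exI[of _ z], rule exI[of _ u], rule exI[of _ y], intro conjI)
        show "{a, x, z, u, y} = {a, b, c, d, e}"
          unfolding that(2)[symmetric] that(4) by auto
        show "distinct [a, x, z, u, y]" using that(1,4) by auto
      qed (use 1 that(3) \<open>r z u\<close> sym[of y a] sym[of u z] in simp_all)
    next
      case 2
      show ?thesis
      proof (rule exI[of _ a], rule exI[of _ x], rule exI[of _ u], rule exI[of _ z], rule exI[of _ y], intro conjI)
        show "{a, x, u, z, y} = {a, b, c, d, e}"
          unfolding that(2)[symmetric] that(4) by auto
        show "distinct [a, x, u, z, y]" using that(1,4) by auto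
      qed (use 2 that(3) \<open>r z u\<close> sym[of y a] sym[of u z] in simp_all)
    qed
  qed
  have t: "\<not> (r a p \<and> r a q \<and> r a s)" "r a p \<or> r a q \<or> r a s"
    if "distinct [p, q, s]" "p \<in> {b, c, d, e}" "q \<in> {b, c, d, e}" "s \<in> {b, c, d, e}" for p q s
  proof -
    have "distinct [a, p, q]" "distinct [a, q, s]" "distinct [a, p, s]" using dist that by auto
    moreover have "{a, p, q} \<subseteq> {a, b, c, d, e}" "{a, q, s} \<subseteq> {a, b, c, d, e}"
      "{a, p, s} \<subseteq> {a, b, c, d, e}" "{p, q, s} \<subseteq> {a, b, c, d, e}"
      using that(2-4) by auto
    ultimately show "\<not> (r a p \<and> r a q \<and> r a s)" "r a p \<or> r a q \<or> r a s"
      using no_tri[of a p q] no_tri[of a q s] no_tri[of a p s] no_tri[of p q s] that(1)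
        sym[of q a] sym[of s a] sym[of s p] by blast+
  qed
  have "\<not> (r a b \<and> r a c \<and> r a d)" "\<not> (r a b \<and> r a c \<and> r a e)" "\<not> (r a b \<and> r a d \<and> r a e)"
    "\<not> (r a c \<and> r a d \<and> r a e)" "r a b \<or> r a c \<or> r a d" "r a b \<or> r a c \<or> r a e"
    "r a b \<or> r a d \<or> r a e" "r a c \<or> r a d \<or> r a e"
    using t[of b c d] t[of b c e] t[of b d e] t[of c d e] dist by simp_all
  then consider
      "r a b \<and> r a c \<and> \<not> r a d \<and> \<not> r a e" | "r a b \<and> r a d \<and> \<not> r a c \<and> \<not> r a e"
    | "r a b \<and> r a e \<and> \<not> r a c \<and> \<not> r a d" | "r a c \<and> r a d \<and> \<not> r a b \<and> \<not> r a e"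
    | "r a c \<and> r a e \<and> \<not> r a b \<and> \<not> r a d" | "r a d \<and> r a e \<and> \<not> r a b \<and> \<not> r a c"
    by blast
  then show ?thesis
    using dist by cases (rule pent; auto)+
qed

text \<open>The link of \<open>v\<close> colours the pairs of five other vertices. It contains a
  one-coloured triangle or a pentagon in \<open>H\<close>; either cycle, once oriented, is a link
  map from which \<open>link_map_extend\<close> can start.\<close>

lemma mono_partner_or_star:
  assumes "card S \<ge> 6" "v \<in> S"
    and "\<And>u. \<not> full_pair H S v u" "\<And>u. \<not> full_pair (-H) S v u"
  shows "\<exists>h. link_map H v (S - {v}) h \<or> link_map (-H) v (S - {v}) h"
proof -
  have fin: "finite S" using assms(1) card.infinite by fastforce
  have compl: "- (- H) = H" by simp
  have ext: ?thesis if "link_map H v G h \<or> link_map (-H) v G h" "G \<subseteq> S" "card G \<ge> 3" for G h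
    using that(1)
  proof
    assume "link_map H v G h"
    then show ?thesis using link_map_extend[OF fin assms(2) _ that(2,3) assms(4)] by blast
  next
    assume "link_map (-H) v G h"
    then show ?thesis using link_map_extend[OF fin assms(2) _ that(2,3), of "-H"] assms(3) by auto
  qed
  obtain a where a: "a \<in> S" "a \<noteq> v"
    using card_remainder_nonempty[OF fin, of "[v]"] assms(1) by auto
  obtain b where b: "b \<in> S" "b \<noteq> v" "b \<noteq> a"
    using card_remainder_nonempty[OF fin, of "[v, a]"] assms(1) by auto
  obtain c where c: "c \<in> S" "c \<noteq> v" "c \<noteq> a" "c \<noteq> b"
    using card_remainder_nonempty[OF fin, of "[v, a, b]"] assms(1) by auto
  obtain d where d: "d \<in> S" "d \<noteq> v" "d \<noteq> a" "d \<noteq> b" "d \<noteq> c"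
    using card_remainder_nonempty[OF fin, of "[v, a, b, c]"] assms(1) by auto
  obtain e where e: "e \<in> S" "e \<noteq> v" "e \<noteq> a" "e \<noteq> b" "e \<noteq> c" "e \<noteq> d"
    using card_remainder_nonempty[OF fin, of "[v, a, b, c, d]"] assms(1) by auto
  have dist: "distinct [a, b, c, d, e]" and sub: "{a, b, c, d, e} \<subseteq> S - {v}"
    using a b c d e by auto
  define r where "r x y \<longleftrightarrow> {v, x, y} \<in> H" for x y
  have sym: "r x y = r y x" for x y by (simp add: r_def insert_commute)
  show ?thesis
  proof (cases "\<exists>x y z. distinct [x, y, z] \<and> {x, y, z} \<subseteq> {a, b, c, d, e} \<and>
      ((r x y \<and> r y z \<and> r z x) \<or> \<not> (r x y \<or> r y z \<or> r z x))")
    case True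
    then obtain x y z where xyz: "distinct [x, y, z]" "{x, y, z} \<subseteq> {a, b, c, d, e}"
      and mono: "(r x y \<and> r y z \<and> r z x) \<or> \<not> (r x y \<or> r y z \<or> r z x)" by blast
    have sub': "{x, y, z} \<subseteq> S - {v}" using xyz(2) sub by (rule subset_trans)
    have d4: "distinct [v, x, y, z]" using xyz(1) sub' by auto
    have "link_map H v {x, y, z} (\<lambda>w. if w = x then y else if w = y then z else x) \<or>
          link_map (-H) v {x, y, z} (\<lambda>w. if w = x then y else if w = y then z else x)"
      using link_map_triangle[OF d4, of H] link_map_triangle[OF d4, of "-H"] mono
      unfolding r_def by blast
    then show ?thesis by (rule ext) (use sub' xyz(1) in auto)
  next
    case False
    have "\<exists>x y z u w. distinct [x, y, z, u, w] \<and> {x, y, z, u, w} = {a, b, c, d, e} \<and>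
        r x y \<and> r y z \<and> r z u \<and> r u w \<and> r w x"
      by (rule triangle_or_pentagon[OF sym dist]) (use False in blast)
    then obtain x y z u w where w: "distinct [x, y, z, u, w]" "{x, y, z, u, w} = {a, b, c, d, e}"
      "r x y" "r y z" "r z u" "r u w" "r w x" by metis
    have sub': "{x, y, z, u, w} \<subseteq> S - {v}" unfolding w(2) by (rule sub)
    have "distinct [v, x, y, z, u, w]" using w(1) sub' by auto
    then have "link_map H v {x, y, z, u, w} (\<lambda>p. if p = x then y else if p = y then z else if p = z then u else if p = u then w else x)"
      by (rule link_map_pentagon) (use w(3-7) in \<open>simp_all add: r_def\<close>)
    then show ?thesis
      by (intro ext[of "{x, y, z, u, w}"] disjI1) (use sub' w(1) in auto)
  qed
qed

subsection \<open>Mixed pairs\<close>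

lemma full_pair_if_not_extendable:
  assumes "spans V E (S - {v}) H" "grown_tree V E" "y \<in> V" "x \<notin> V" "v \<in> S"
    and "\<not> spans (insert x V) (insert {x, y} E) S H"
  shows "\<exists>u. full_pair (- H) S v u"
proof -
  obtain \<phi> f where f: "berge_map V E (S - {v}) H \<phi> f" using assms(1) unfolding spans_def by blast
  have y: "\<phi> y \<in> S - {v}" using berge_map_in[OF f assms(3)] .
  have "{v, \<phi> y, z} \<notin> H" if "z \<in> S - {v, \<phi> y}" for z
  proof
    assume "{v, \<phi> y, z} \<in> H"
    then have "spans (insert x V) (insert {x, y} E) (insert v (S - {v})) H"
      by (intro spansI[OF berge_map_attach[OF f assms(2,3,4)]]) (use that in auto)
    then show False using assms(5,6) by (simp add: insert_absorb)
  qed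
  then have "full_pair (- H) S v (\<phi> y)"
    using y assms(5) by (auto simp: full_pair_def)
  then show ?thesis by blast
qed

lemma berge_map_attach_two_paired:
  assumes "berge_map V' E' S' H \<phi> f" "grown_tree V' E'" "self_paired H U P" "P \<subseteq> S'"
    and "p \<in> V'" "q \<in> V'" "\<phi> p \<in> P" "\<phi> q \<in> P" "a \<notin> V'" "b \<notin> V'" "a \<noteq> b"
    and "s \<in> U - S'" "t \<in> U - S'" "s \<noteq> t"
  shows "spans (insert b (insert a V')) (insert {b, q} (insert {a, p} E')) (insert t (insert s S')) H"
proof -
  obtain f' where f': "berge_map (insert a V') (insert {a, p} E') (insert s S') H (\<phi>(a := s)) f'"
    using berge_map_attach_paired[OF assms(1-4) _ _ assms(5,7,9)] assms(12) by blast
  have "q \<noteq> a" using assms(6,9) by blast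
  then show ?thesis
    using berge_map_attach_paired[OF f' grown_tree.leaf[OF assms(2,5,9)] assms(3), of t q b]
      assms(4,6,8,10-14) spansI by fastforce
qed

text \<open>The two uncovered vertices receive leaves whose neighbours both lie in the smaller tree,
  hence have images in \<open>R\<close>, where every outside vertex can be attached.\<close>

lemma spans_if_two_outside:
  assumes "self_paired H S R" "card R \<ge> 4" "card S = card R + 2" "grown_tree V E" "card V = card S"
  shows "spans V E S H"
proof -
  have fin: "finite S" "finite R" using assms(2,3) card.infinite by fastforce+
  have RS: "R \<subseteq> S" using assms(1) by (simp add: self_paired_def)
  have "card (S - R) = 2" using assms(3) fin RS by (simp add: card_Diff_subset)
  then obtain s t where st: "S - R = {s, t}" "s \<noteq> t" by (auto simp: card_2_iff)
  have "card V \<ge> 3" using assms(2,3,5) by simp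
  then obtain V' E' where T': "grown_tree V' E'" "two_leaf_extension V' E' V E"
    using ex_two_leaf_extension[OF assms(4)] by blast
  then obtain a b p q where p: "p \<in> V'" "q \<in> V'" "a \<notin> V'" "b \<notin> V'" "a \<noteq> b" and
      V: "V = insert b (insert a V')" and E: "E = insert {b, q} (insert {a, p} E')"
    unfolding two_leaf_extension_def by metis
  have "card V' = card R"
    using p(3-5) grown_tree_finite[OF T'(1)] assms(3,5) V by simp
  then obtain \<phi> f where f: "berge_map V' E' R H \<phi> f"
    using spans_if_self_paired[OF assms(1,2) T'(1)] unfolding spans_def by blast
  have "insert t (insert s R) = S" using st RS by blast
  then show ?thesis
    using berge_map_attach_two_paired[OF f T'(1) assms(1) order_refl p(1,2) berge_map_in[OF f p(1)]
        berge_map_in[OF f p(2)] p(3-5), of s t] st V E by auto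
qed

text \<open>A graph on three vertices without isolated vertex has two edges with a common end. The
  two full pairs at this end produce its three triples in \<open>R\<close> enlarged by
  \<open>w\<close>.\<close>

lemma self_paired_three:
  assumes "self_paired H S R" "card R = 3" "w \<in> S - R"
  shows "\<exists>z\<in>R. three_at H (insert w R) z"
proof -
  have RS: "R \<subseteq> S" using assms(1) by (simp add: self_paired_def)
  have triple: "\<exists>z\<in>R. three_at H (insert w R) z"
    if "R = {x, y, z}" "distinct [x, y, z]" "full_pair H S x y" "full_pair H S x z" for x y z
  proof -
    have in_S: "y \<in> S" "z \<in> S" "w \<in> S" and neq: "w \<noteq> x" "w \<noteq> y" "w \<noteq> z"
      using that(1) RS assms(3) by auto
    have xyz: "distinct [x, y, z]" by fact
    have "{x, y, z} \<in> H" "{x, y, w} \<in> H" "{x, z, w} \<in> H"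
      using full_pairD[OF that(3), of z] full_pairD[OF that(3), of w] full_pairD[OF that(4), of w]
        in_S neq xyz by auto
    moreover have "insert w R - {w} = {x, y, z}" "insert w R - {z} = {x, y, w}"
      "insert w R - {y} = {x, z, w}"
      using that(1) xyz neq by auto
    ultimately have "insert w R - {t} \<in> H" if "t \<in> insert w R" "t \<noteq> x" for t
      using that \<open>R = {x, y, z}\<close> by (metis insertE singletonD)
    then have "three_at H (insert w R) x" unfolding three_at_def using that(1) by blast
    then show ?thesis using that(1) by simp
  qed
  obtain a b c where R: "R = {a, b, c}" "a \<noteq> b" "a \<noteq> c" "b \<noteq> c"
    using assms(2) by (metis card_3_iff)
  obtain q where q: "q \<in> R" "q \<noteq> a" "full_pair H S a q"
    using self_pairedE[OF assms(1), of a] R by auto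
  obtain r where r: "r \<in> R" "r \<noteq> a" "r \<noteq> q"
    using card_remainder_nonempty[of R "[a, q]"] assms(2) R(1) by auto
  have R': "R = {a, q, r}" using q r R by auto
  obtain u where u: "u \<in> R" "u \<noteq> r" "full_pair H S r u"
    using self_pairedE[OF assms(1) r(1)] .
  then consider "u = a" | "u = q" using R' by auto
  then show ?thesis
  proof cases
    case 1
    show ?thesis
      by (rule triple[OF R' _ q(3)]) (use q r full_pair_sym[OF u(3)] 1 in auto)
  next
    case 2
    show ?thesis
      by (rule triple[of q a r]) (use q r R' full_pair_sym[OF u(3)] full_pair_sym[OF q(3)] 2 in auto)
  qed
qed

text \<open>Three paired vertices are too few for a copy of their own, so an unpaired
  \<open>w\<close> is added. The copy on these four vertices keeps \<open>w\<close> away from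
  \<open>p\<close> and \<open>q\<close>, so the last two leaves are attached at vertices of
  \<open>R\<close>.\<close>

lemma spans_six:
  assumes "self_paired H S R" "card R = 3" "card S = 6" "grown_tree V E" "card V = 6"
  shows "spans V E S H"
proof -
  have fin: "finite S" "finite R" using assms(2,3) card.infinite by fastforce+
  have RS: "R \<subseteq> S" using assms(1) by (simp add: self_paired_def)
  have "card (S - R) = 3" using assms(2,3) fin RS by (simp add: card_Diff_subset)
  then obtain w s t where wst: "S - R = {w, s, t}" "w \<noteq> s" "w \<noteq> t" "s \<noteq> t"
    by (metis card_3_iff)
  then have w: "w \<in> S - R" by blast
  then obtain z where z: "z \<in> R" "three_at H (insert w R) z"
    using self_paired_three[OF assms(1,2)] by blast
  obtain V' E' where T': "grown_tree V' E'" "two_leaf_extension V' E' V E"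
    using ex_two_leaf_extension[OF assms(4)] assms(5) by auto
  then obtain a b p q where p: "p \<in> V'" "q \<in> V'" "a \<notin> V'" "b \<notin> V'" "a \<noteq> b" and
      V: "V = insert b (insert a V')" and E: "E = insert {b, q} (insert {a, p} E')"
    unfolding two_leaf_extension_def by metis
  have c4: "card V' = 4" "card (insert w R) = 4"
    using p(3-5) grown_tree_finite[OF T'(1)] assms(2,5) V w fin by auto
  have "w \<noteq> z" using z(1) w by blast
  then obtain \<phi> f where f: "berge_map V' E' (insert w R) H \<phi> f" "\<phi> p \<noteq> w" "\<phi> q \<noteq> w"
    using spans_four[OF T'(1) c4 z(2) insertI1 _ p(1,2)] by metis
  then have "\<phi> p \<in> R" "\<phi> q \<in> R"
    using berge_map_in[OF f(1) p(1)] berge_map_in[OF f(1) p(2)] by auto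
  moreover have "insert t (insert s (insert w R)) = S" using wst RS by blast
  moreover have "s \<in> S - insert w R" "t \<in> S - insert w R" using wst by auto
  ultimately show ?thesis
    using berge_map_attach_two_paired[OF f(1) T'(1) assms(1) subset_insertI p(1,2) _ _ p(3-5), of s t]
      wst(4) unfolding V E by simp
qed

section \<open>Attaching a twig through a single full pair\<close>

lemma non_neighbour:
  assumes "grown_tree V E" "p \<in> V" "e \<in> E" "p \<notin> e"
  obtains x where "x \<in> V" "x \<noteq> p" "{p, x} \<notin> E"
proof -
  have fin: "finite V" "finite E" using grown_tree_finite[OF assms(1)] by blast+
  have "card (spokes p V) = card (V - {p})"
  proof -
    have "spokes p V = (\<lambda>v. {p, v}) ` (V - {p})" by (auto simp: spokes_def)
    moreover have "inj_on (\<lambda>v. {p, v}) (V - {p})" by (auto simp: inj_on_def doubleton_eq_iff)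
    ultimately show ?thesis by (simp add: card_image)
  qed
  also have "\<dots> = card E" using grown_tree_card[OF assms(1)] assms(2) fin by simp
  \<comment> \<open>The star with centre \<open>p\<close> has as many edges as the tree, so
    containment would force equality and leave no edge off \<open>p\<close>.\<close>
  finally have "spokes p V = E" if "spokes p V \<subseteq> E"
    using card_subset_eq[OF fin(2) that] by simp
  then have "\<not> spokes p V \<subseteq> E" using assms(3,4) center_in_spoke by metis
  then show ?thesis using that unfolding spokes_def by blast
qed

text \<open>
  The vertex \<open>\<phi> p\<close> of the copy is replaced by \<open>v\<close>, which reaches every other vertex through
  \<open>u\<close>; the freed vertex \<open>\<phi> p\<close> becomes the image of a new leaf at \<open>p\<close>.
\<close>

lemma berge_map_move_vertex:
  assumes f: "berge_map V E S' H \<phi> f" and tree: "grown_tree V E" and p: "p \<in> V" and b: "b \<notin> V"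
    and e0: "e0 \<in> E" "p \<notin> e0" and full: "full_pair H S v u"
    and S': "S' \<subseteq> S" "v \<notin> S'" "u \<in> S'" "u \<noteq> \<phi> p"
  shows "\<exists>f'. berge_map (insert b V) (insert {b, p} E) (insert v S') H (\<phi>(p := v, b := \<phi> p)) f'"
proof -
  have bij: "bij_betw \<phi> V S'" and inj_f: "inj_on f E" and
    edge: "\<And>e. e \<in> E \<Longrightarrow> \<phi> ` e \<subseteq> f e \<and> f e \<subseteq> S' \<and> card (f e) = 3 \<and> f e \<in> H"
    using f by (auto simp: berge_map_def)
  obtain x0 where x0: "x0 \<in> V" "x0 \<noteq> p" "{p, x0} \<notin> E" using non_neighbour[OF tree p e0] .
  define \<psi> where "\<psi> = \<phi>(p := v, b := \<phi> p)"
  have bp: "b \<noteq> p" using b p by blast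
  have \<psi>: "\<psi> p = v" "\<psi> b = \<phi> p" "\<And>x. x \<in> V \<Longrightarrow> x \<noteq> p \<Longrightarrow> \<psi> x = \<phi> x"
    using bp b by (auto simp: \<psi>_def)
  have pS: "\<phi> p \<in> S'" using berge_map_in[OF f p] .
  have bij_\<psi>: "bij_betw \<psi> (insert b V) (insert v S')"
  proof -
    have "bij_betw \<phi> (V - {p}) (S' - {\<phi> p})"
      by (rule bij_betw_DiffI[OF bij]) (use p pS in auto)
    then have "bij_betw (\<phi>(p := v)) (insert p (V - {p})) (insert v (S' - {\<phi> p}))"
      by (rule bij_betw_extend_point) (use S'(2) in auto)
    then have "bij_betw (\<phi>(p := v)) V (insert v (S' - {\<phi> p}))"
      using p by (simp add: insert_absorb)
    then have "bij_betw \<psi> (insert b V) (insert (\<phi> p) (insert v (S' - {\<phi> p})))"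
      unfolding \<psi>_def by (rule bij_betw_extend_point) (use S'(2) pS b in auto)
    moreover have "insert (\<phi> p) (insert v (S' - {\<phi> p})) = insert v S'" using pS by blast
    ultimately show ?thesis by simp
  qed
  have inj: "x = y" if "\<psi> x = \<psi> y" "x \<in> insert b V" "y \<in> insert b V" for x y
    using bij_\<psi> that unfolding bij_betw_def inj_on_def by blast
  have tree': "grown_tree (insert b V) (insert {b, p} E)" using grown_tree.leaf[OF tree p b] .
  \<comment> \<open>The edge from \<open>p\<close> to \<open>x\<close> takes the triple of
    \<open>v\<close>, \<open>\<psi> x\<close> and \<open>u\<close>. A neighbour placed on
    \<open>u\<close> itself needs another third vertex, namely \<open>\<psi> x0\<close>; its triple
    is not claimed twice because \<open>x0\<close> is no neighbour of \<open>p\<close>.\<close>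
  define k where "k z = (if z = u then \<psi> x0 else u)" for z
  define g where "g e = (if p \<in> e then insert v (\<psi> ` (e - {p}) \<union> k ` \<psi> ` (e - {p})) else f e)" for e
  have at_p: "\<exists>x. e = {p, x} \<and> x \<in> insert b V \<and> x \<noteq> p \<and> x \<noteq> x0 \<and> g e = {v, \<psi> x, k (\<psi> x)}"
    if e: "e \<in> insert {b, p} E" "p \<in> e" for e
  proof -
    obtain x where x: "e = {p, x}" "x \<in> insert b V" "x \<noteq> p"
      using grown_tree_edge[OF tree' e(1)] e(2) by auto
    have "x \<noteq> x0"
    proof
      assume "x = x0"
      then have "x \<in> V" "{p, x} \<notin> E" "x \<noteq> b" using x0 b by auto
      then show False using e(1) x by (auto simp: doubleton_eq_iff)
    qed
    moreover have "e - {p} = {x}" using x by auto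
    then have "g e = {v, \<psi> x, k (\<psi> x)}" using e(2) by (simp add: g_def insert_commute)
    ultimately show ?thesis using x by blast
  qed
  have off_p: "e \<in> E \<and> g e = f e \<and> \<psi> ` e = \<phi> ` e" if "e \<in> insert {b, p} E" "p \<notin> e" for e
  proof -
    have "e \<in> E" using that by blast
    moreover from this have "e \<subseteq> V" using grown_tree_edge_subset[OF tree] by blast
    then have "\<psi> ` e = \<phi> ` e" using that(2) by (intro image_cong refl \<psi>(3)) auto
    ultimately show ?thesis using that(2) by (simp add: g_def)
  qed
  have in_S': "\<psi> x \<in> S'" if "x \<in> insert b V" "x \<noteq> p" for x
    using bij_\<psi> that inj[of x p] p \<psi>(1) by (auto simp: bij_betw_def)
  have \<psi>x0: "\<psi> x0 \<in> S'" using in_S' x0 by blast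
  have k: "k (\<psi> x) \<in> S' \<and> k (\<psi> x) \<noteq> \<psi> x \<and> {v, \<psi> x, k (\<psi> x)} \<in> H"
    if "x \<in> insert b V" "x \<noteq> p" "x \<noteq> x0" for x
  proof (cases "\<psi> x = u")
    case True
    have "\<psi> x0 \<noteq> u" using inj[of x x0] that x0 True by auto
    moreover have "\<psi> x0 \<noteq> v" using \<psi>x0 S'(2) by blast
    ultimately show ?thesis
      using True \<psi>x0 full_pairD[OF full, of "\<psi> x0"] S'(1) by (auto simp: k_def)
  next
    case False
    have "\<psi> x \<in> S'" "\<psi> x \<noteq> v" using in_S' that S'(2) by blast+
    then show ?thesis
      using False S'(1,3) full_pairD[OF full, of "\<psi> x"] by (auto simp: k_def insert_commute)
  qed
  have "inj_on g (insert {b, p} E)"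
  proof (rule inj_onI)
    fix e e' assume e: "e \<in> insert {b, p} E" "e' \<in> insert {b, p} E" "g e = g e'"
    have mixed: False if "e \<in> insert {b, p} E" "e' \<in> insert {b, p} E" "g e = g e'" "p \<in> e" "p \<notin> e'" for e e'
    proof -
      have "v \<in> g e" using at_p[OF that(1,4)] by auto
      moreover have "g e' \<subseteq> S'" using off_p[OF that(2,5)] edge by auto
      ultimately show False using that(3) S'(2) by blast
    qed
    consider "p \<in> e" "p \<in> e'" | "p \<notin> e" "p \<notin> e'" using mixed[of e e'] mixed[of e' e] e by metis
    then show "e = e'"
    proof cases
      case 1
      obtain x where x: "e = {p, x}" "x \<in> insert b V" "x \<noteq> p" "x \<noteq> x0" "g e = {v, \<psi> x, k (\<psi> x)}"
        using at_p[OF e(1) 1(1)] by blast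
      obtain y where y: "e' = {p, y}" "y \<in> insert b V" "y \<noteq> p" "y \<noteq> x0" "g e' = {v, \<psi> y, k (\<psi> y)}"
        using at_p[OF e(2) 1(2)] by blast
      have v: "v \<notin> {\<psi> x, k (\<psi> x)}" "v \<notin> {\<psi> y, k (\<psi> y)}"
        using in_S'[OF x(2,3)] in_S'[OF y(2,3)] k[OF x(2-4)] k[OF y(2-4)] S'(2) by auto
      then have eq: "{\<psi> x, k (\<psi> x)} = {\<psi> y, k (\<psi> y)}"
        using e(3) x(5) y(5) insert_ident by metis
      have "\<psi> x = \<psi> y"
      proof (rule ccontr)
        assume "\<psi> x \<noteq> \<psi> y"
        then have "\<psi> x = k (\<psi> y)" "\<psi> y = k (\<psi> x)" using eq by (auto simp: doubleton_eq_iff)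
        then have "\<psi> x = \<psi> x0 \<or> \<psi> y = \<psi> x0" unfolding k_def by metis
        then show False using inj[of x x0] inj[of y x0] x y x0(1) by auto
      qed
      then show ?thesis using inj[OF _ x(2) y(2)] x(1) y(1) by simp
    next
      case 2
      then show ?thesis using off_p e inj_onD[OF inj_f] by metis
    qed
  qed
  moreover have "\<psi> ` e \<subseteq> g e \<and> g e \<subseteq> insert v S' \<and> card (g e) = 3 \<and> g e \<in> H"
    if e: "e \<in> insert {b, p} E" for e
  proof (cases "p \<in> e")
    case True
    obtain x where x: "e = {p, x}" "x \<in> insert b V" "x \<noteq> p" "x \<noteq> x0" and ge: "g e = {v, \<psi> x, k (\<psi> x)}"
      using at_p[OF e True] by blast
    have "\<psi> ` e = {v, \<psi> x}" using x(1) \<psi>(1) by simp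
    moreover have "\<psi> x \<in> S'" using in_S'[OF x(2,3)] .
    moreover have "\<psi> x \<noteq> v" "k (\<psi> x) \<noteq> v" using in_S'[OF x(2,3)] k[OF x(2-4)] S'(2) by auto
    ultimately show ?thesis using k[OF x(2-4)] unfolding ge by auto
  next
    case False
    then show ?thesis using off_p[OF e False] edge[of e] by auto
  qed
  ultimately have "berge_map (insert b V) (insert {b, p} E) (insert v S') H \<psi> g"
    using bij_\<psi> by (simp add: berge_map_def)
  then show ?thesis unfolding \<psi>_def by blast
qed

text \<open>The vertex \<open>a\<close> always fits on \<open>v\<close>, which reaches
  \<open>\<phi> p\<close> through \<open>u\<close>, or by any third vertex if
  \<open>\<phi> p\<close> is \<open>u\<close>. On a pendant path, \<open>b\<close> fits on
  \<open>w\<close> by the triple of \<open>v\<close>, \<open>u\<close>, \<open>w\<close>. In a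
  cherry, \<open>b\<close> fits on \<open>w\<close> if some triple of \<open>H\<close> contains
  \<open>w\<close> and \<open>\<phi> p\<close>. Otherwise \<open>p\<close> moves to
  \<open>v\<close>, the freed vertex goes to \<open>b\<close>, and \<open>a\<close> goes to
  \<open>w\<close> by the triple of \<open>v\<close>, \<open>u\<close>, \<open>w\<close>. The move
  needs an edge off \<open>p\<close>, supplied by the two disjoint edges.\<close>

lemma spans_twig:
  assumes twig: "twig V' E' V E" and tree: "grown_tree V' E'" and disj: "two_disjoint E"
    and sp: "spans V' E' (S - {v, w}) H" and full: "full_pair H S v u" and w: "w \<in> S" "w \<noteq> u" "w \<noteq> v"
    and card: "card S \<ge> 4"
  shows "spans V E S H"
proof -
  obtain a b p where p: "p \<in> V'" "a \<notin> V'" "b \<notin> V'" "a \<noteq> b" "V = insert b (insert a V')" and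
    E: "E = insert {b, p} (insert {a, p} E') \<or> E = insert {b, a} (insert {a, p} E')"
    using twig unfolding twig_def by metis
  define S' where "S' = S - {v, w}"
  obtain \<phi> f where f: "berge_map V' E' S' H \<phi> f" using sp unfolding spans_def S'_def by blast
  have vu: "v \<in> S" "u \<in> S" "v \<noteq> u" using full by (auto simp: full_pair_def)
  have fin: "finite S" using card card.infinite by fastforce
  have S: "insert w (insert v S') = S" "v \<notin> S'" "w \<notin> insert v S'" "u \<in> S'"
    using vu w by (auto simp: S'_def)
  define y where "y = \<phi> p"
  have y: "y \<in> S'" using berge_map_in[OF f p(1)] by (simp add: y_def)
  obtain s where s: "s \<in> S" "s \<noteq> v" "s \<noteq> w" "s \<noteq> u"
    using card_remainder_nonempty[OF fin, of "[v, w, u]"] card by auto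
  have "\<exists>t\<in>S'. t \<noteq> y \<and> {v, y, t} \<in> H"
  proof (cases "y = u")
    case True
    have "{v, u, s} \<in> H" using full_pairD[OF full, of s] s by blast
    then show ?thesis using True s by (auto simp: S'_def)
  next
    case False
    have "{v, u, y} \<in> H" using full_pairD[OF full, of y] y False by (auto simp: S'_def)
    then have "{v, y, u} \<in> H" by (simp add: insert_commute)
    then show ?thesis using False S(4) by metis
  qed
  then obtain t where t: "t \<in> S'" "t \<noteq> \<phi> p" "{v, \<phi> p, t} \<in> H" by (auto simp: y_def)
  have f': "berge_map (insert a V') (insert {a, p} E') (insert v S') H
      (\<phi>(a := v)) (f({a, p} := {v, \<phi> p, t}))"
    by (rule berge_map_attach[OF f tree p(1,2) S(2) t(3,1,2)])
  have ta: "grown_tree (insert a V') (insert {a, p} E')" using grown_tree.leaf[OF tree p(1,2)] .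
  have vuw: "{v, u, w} \<in> H" using full_pairD[OF full w(1,3,2)] .
  have bV: "b \<notin> insert a V'" using p by auto
  have pa: "p \<noteq> a" using p by blast
  from E show ?thesis
  proof
    assume E: "E = insert {b, a} (insert {a, p} E')"
    have "spans (insert b (insert a V')) (insert {b, a} (insert {a, p} E')) (insert w (insert v S')) H"
      by (intro spansI[OF berge_map_attach[OF f' ta insertI1 bV S(3), of u]])
        (use vuw S(4) vu in \<open>auto simp: insert_commute\<close>)
    then show ?thesis unfolding E p(5) S(1) .
  next
    assume E: "E = insert {b, p} (insert {a, p} E')"
    show ?thesis
    proof (cases "\<exists>t\<in>S - {w, y}. {w, y, t} \<in> H")
      case True
      then obtain t where t: "t \<in> S - {w, y}" "{w, y, t} \<in> H" by blast
      have "(\<phi>(a := v)) p = y" using pa by (simp add: y_def)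
      then have "spans (insert b (insert a V')) (insert {b, p} (insert {a, p} E')) (insert w (insert v S')) H"
        by (intro spansI[OF berge_map_attach[OF f' ta _ bV S(3), of p t]])
          (use t p(1) in \<open>auto simp: S'_def\<close>)
      then show ?thesis unfolding E p(5) S(1) .
    next
      case False
      \<comment> \<open>With \<open>y = u\<close> the triple of \<open>v\<close>, \<open>u\<close>,
        \<open>w\<close> would contain both \<open>w\<close> and \<open>y\<close>, against the case
        assumption.\<close>
      have "y \<noteq> u"
      proof
        assume "y = u"
        then have "{w, y, v} \<in> H" using vuw by (simp add: insert_commute)
        then show False using False vu w y S(2) by auto
      qed
      obtain e e' where "e \<in> E" "e' \<in> E" "e \<inter> e' = {}"
        using disj by (auto simp: two_disjoint_def)
      then obtain e0 where "e0 \<in> E" "p \<notin> e0" by blast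
      then have e0: "e0 \<in> E'" "p \<notin> e0" unfolding E by auto
      have "\<exists>g. berge_map (insert b V') (insert {b, p} E') (insert v S') H (\<phi>(p := v, b := \<phi> p)) g"
        by (rule berge_map_move_vertex[OF f tree p(1,3) e0 full])
          (use S \<open>y \<noteq> u\<close> in \<open>auto simp: y_def S'_def\<close>)
      then obtain g where g:
        "berge_map (insert b V') (insert {b, p} E') (insert v S') H (\<phi>(p := v, b := \<phi> p)) g" by blast
      have tb: "grown_tree (insert b V') (insert {b, p} E')" using grown_tree.leaf[OF tree p(1,3)] .
      have "(\<phi>(p := v, b := \<phi> p)) p = v" using p by auto
      then have "spans (insert a (insert b V')) (insert {a, p} (insert {b, p} E')) (insert w (insert v S')) H"
        by (intro spansI[OF berge_map_attach[OF g tb _ _ S(3), of p a u]])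
          (use p vuw S(4) vu in \<open>auto simp: insert_commute\<close>)
      then show ?thesis unfolding E p(5) S(1) by (simp add: insert_commute)
    qed
  qed
qed

subsection \<open>Five vertices\<close>

text \<open>The four triples are consecutive in the cyclic order \<open>a\<close>, \<open>b\<close>,
  \<open>c\<close>, \<open>d\<close>, \<open>e\<close>. A tree on five vertices with two disjoint
  edges consists of a path \<open>p\<close>, \<open>q\<close>, \<open>r\<close> and an edge between
  \<open>s\<close> and \<open>t\<close>, joined by an edge from \<open>s\<close> to
  \<open>w\<close>, where \<open>w\<close> is \<open>q\<close> or \<open>r\<close>. Both choices
  work because \<open>{b, c, d}\<close> contains the images of \<open>q\<close>, \<open>r\<close>
  and \<open>s\<close>.\<close>

lemma spans_five_walk:
  assumes tree: "grown_tree V E" "two_disjoint E" "card V = 5"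
    and S: "S = {a, b, c, d, e}" "distinct [a, b, c, d, e]"
    and H: "{a, b, e} \<in> H" "{a, b, c} \<in> H" "{b, c, d} \<in> H" "{c, d, e} \<in> H"
  shows "spans V E S H"
proof -
  have walk: "spans V E S H"
    if "distinct [p, q, r, s, t]" "V = {p, q, r, s, t}" "E = {{p, q}, {q, r}, {w, s}, {s, t}}"
      "w = q \<or> w = r" for p q r s t w
  proof -
    define \<phi> where "\<phi> x = (if x = p then a else if x = q then b else if x = r then c else if x = s then d else e)" for x
    have \<phi>: "\<phi> p = a" "\<phi> q = b" "\<phi> r = c" "\<phi> s = d" "\<phi> t = e"
      using that(1) by (auto simp: \<phi>_def)
    define f where "f x = (if x = {p, q} then {a, b, e} else if x = {q, r} then {a, b, c}
      else if x = {w, s} then {b, c, d} else {c, d, e})" for x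
    have f: "f {p, q} = {a, b, e}" "f {q, r} = {a, b, c}" "f {w, s} = {b, c, d}" "f {s, t} = {c, d, e}"
      using that(1,4) by (auto simp: f_def doubleton_eq_iff)
    have "inj_on \<phi> V"
      using that(1) S(2) \<phi> unfolding that(2) inj_on_def by auto
    moreover have "\<phi> ` V = S" unfolding that(2) S(1) using \<phi> by simp
    moreover have "inj_on f E"
    proof -
      have "d \<notin> {a, b, e}" "d \<notin> {a, b, c}" "d \<in> {b, c, d}" "d \<in> {c, d, e}" "c \<notin> {a, b, e}"
        "c \<in> {a, b, c}" "b \<notin> {c, d, e}" "b \<in> {b, c, d}"
        using S(2) by auto
      then have "{a, b, e} \<noteq> {a, b, c}" "{a, b, e} \<noteq> {b, c, d}" "{a, b, e} \<noteq> {c, d, e}"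
        "{a, b, c} \<noteq> {b, c, d}" "{a, b, c} \<noteq> {c, d, e}" "{b, c, d} \<noteq> {c, d, e}"
        by metis+
      then show ?thesis unfolding that(3) inj_on_def using f by auto
    qed
    moreover have "\<phi> ` x \<subseteq> f x \<and> f x \<subseteq> S \<and> card (f x) = 3 \<and> f x \<in> H" if "x \<in> E" for x
      using \<open>x \<in> E\<close> unfolding \<open>E = _\<close>
    proof (elim insertE emptyE)
      assume x: "x = {p, q}"
      show ?thesis unfolding x f using \<phi> H S by auto
    next
      assume x: "x = {q, r}"
      show ?thesis unfolding x f using \<phi> H S by auto
    next
      assume x: "x = {w, s}"
      have "\<phi> w \<in> {b, c}" using \<open>w = q \<or> w = r\<close> \<phi> by auto
      then show ?thesis unfolding x f using \<phi> H S by auto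
    next
      assume x: "x = {s, t}"
      show ?thesis unfolding x f using \<phi> H S by auto
    qed
    ultimately have "berge_map V E S H \<phi> f" by (simp add: berge_map_def bij_betw_def)
    then show ?thesis by (rule spansI)
  qed
  obtain V' E' x y where T': "grown_tree V' E'" "two_disjoint E'" "y \<in> V'" "x \<notin> V'"
    "V = insert x V'" "E = insert {x, y} E'"
    using two_disjoint_leaf_removal[OF tree(1,2)] tree(3) by auto
  have "card V' = 4" using T'(4,5) tree(3) grown_tree_finite[OF T'(1)] by simp
  then obtain p q r s where path: "distinct [p, q, r, s]" "V' = {p, q, r, s}" "E' = {{p, q}, {q, r}, {r, s}}"
    using path_shape[OF T'(1) _ T'(2)] by blast
  consider "y = p" | "y = q" | "y = r" | "y = s" using T'(3) path(2) by blast
  then show ?thesis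
  proof cases
    case 1
    show ?thesis
      by (rule walk[of x p q r s q]) (use T'(4-6) path 1 in \<open>auto simp: insert_commute\<close>)
  next
    case 2
    show ?thesis
      by (rule walk[of p q x r s q]) (use T'(4-6) path 2 in \<open>auto simp: insert_commute\<close>)
  next
    case 3
    show ?thesis
      by (rule walk[of s r x q p r]) (use T'(4-6) path 3 in \<open>auto simp: insert_commute\<close>)
  next
    case 4
    show ?thesis
      by (rule walk[of p q r s x r]) (use T'(4-6) path 4 in \<open>auto simp: insert_commute\<close>)
  qed
qed

text \<open>Without a suitable leaf the tree is a path on four vertices, which can be placed on
  \<open>S - {v}\<close> by any bijection. So the neighbour \<open>y\<close> of the leaf may sit on
  any \<open>u\<close>. If no placement extends to \<open>v\<close>, then \<open>v\<close> forms a
  full pair of the other colour with every \<open>u\<close>.\<close>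

lemma five_extend_three_at:
  assumes "grown_tree V E" "two_disjoint E" "card V = 5" "card S = 5" "v \<in> S" "three_at H (S - {v}) m"
  shows "spans V E S H \<or> self_paired (- H) S S"
proof (cases "spans V E S H")
  case False
  have finS: "finite S" using assms(4) card.infinite by fastforce
  obtain V' E' x y where T': "grown_tree V' E'" "two_disjoint E'" "y \<in> V'" "x \<notin> V'"
    "V = insert x V'" "E = insert {x, y} E'"
    using two_disjoint_leaf_removal[OF assms(1,2)] assms(3) by auto
  have fin: "finite V'" using grown_tree_finite[OF T'(1)] by blast
  have card: "card V' = 4" using T'(4,5) assms(3) fin by simp
  obtain p q r s where path: "distinct [p, q, r, s]" "V' = {p, q, r, s}" "E' = {{p, q}, {q, r}, {r, s}}"
    using path_shape[OF T'(1) card T'(2)] .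
  have full: "full_pair (- H) S u v" if u: "u \<in> S - {v}" for u
  proof -
    have "card V' = card (S - {v})" using card assms(4,5) by simp
    then obtain \<phi> where \<phi>: "bij_betw \<phi> V' (S - {v})" "\<phi> y = u"
      using ex_bij_betw_point[OF fin _ _ T'(3) u] finS by blast
    obtain f where f: "berge_map V' E' (S - {v}) H \<phi> f"
      using berge_map_four_path[OF path \<phi>(1) assms(6)] by blast
    have "{u, v, z} \<notin> H" if "z \<in> S - {u, v}" for z
    proof
      assume "{u, v, z} \<in> H"
      then have "{v, \<phi> y, z} \<in> H" using \<phi>(2) by (simp add: insert_commute)
      then have "spans V E (insert v (S - {v})) H"
        unfolding T'(5,6)
        by (intro spansI[OF berge_map_attach[OF f T'(1,3,4)]]) (use that \<phi>(2) in auto)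
      then show False using False assms(5) by (simp add: insert_absorb)
    qed
    then show ?thesis using u assms(5) by (auto simp: full_pair_def)
  qed
  obtain u0 where u0: "u0 \<in> S - {v}"
    using card_remainder_nonempty[OF finS, of "[v]"] assms(4) by auto
  have "self_paired (- H) S S"
  proof (rule self_pairedI[OF order_refl])
    fix y assume "y \<in> S"
    then show "\<exists>q\<in>S. full_pair (- H) S y q"
      using full assms(5) u0 full_pair_sym[OF full[OF u0]] by (cases "y = v") auto
  qed
  then show ?thesis by blast
qed simp

lemma three_at_Diff:
  "three_at H (S - {v}) m \<longleftrightarrow> m \<in> S - {v} \<and> (\<forall>u\<in>S - {v, m}. S - {v, u} \<in> H)"
proof -
  have "S - {v} - {u} = S - {v, u}" for u by auto
  then show ?thesis by (simp add: three_at_def)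
qed

text \<open>Complementation turns the triples of a five-element set into pairs, recorded by
  \<open>r\<close>. As no vertex has three triples of one colour avoiding \<open>v\<close>, every
  vertex has exactly two neighbours under \<open>r\<close>, which excludes one-coloured triangles
  and leaves a pentagon. The complements of its edges are consecutive triples, and four of them make
  the walk.\<close>

lemma spans_five_balanced:
  assumes "grown_tree V E" "two_disjoint E" "card V = 5" "card S = 5"
    and no: "\<And>v m. v \<in> S \<Longrightarrow> \<not> three_at H (S - {v}) m" "\<And>v m. v \<in> S \<Longrightarrow> \<not> three_at (- H) (S - {v}) m"
  shows "spans V E S H"
proof -
  have fin: "finite S" using assms(4) card.infinite by fastforce
  obtain xs where xs: "set xs = S" "distinct xs" "length xs = 5"
    using finite_distinct_list[OF fin] assms(4) distinct_card by metis
  then obtain a b c d e where "xs = [a, b, c, d, e]"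
    by (auto simp: length_Suc_conv eval_nat_numeral)
  then have S: "S = {a, b, c, d, e}" and dist: "distinct [a, b, c, d, e]" using xs by auto
  define r where "r x y \<longleftrightarrow> S - {x, y} \<in> H" for x y
  have sym: "r x y = r y x" for x y by (simp add: r_def insert_commute)
  have deg: "\<not> (r t x \<and> r t y \<and> r t z)" "r t x \<or> r t y \<or> r t z"
    if xyz: "distinct [t, x, y, z]" "{t, x, y, z} \<subseteq> S" for t x y z
  proof -
    obtain m where m: "m \<in> S" "m \<notin> set [t, x, y, z]"
      using card_remainder_nonempty[OF fin, of "[t, x, y, z]"] assms(4) by auto
    have "card {t, x, y, z, m} = card S" using xyz(1) m assms(4) by auto
    then have "S = {t, x, y, z, m}"
      using card_subset_eq[OF fin, of "{t, x, y, z, m}"] xyz(2) m(1) by auto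
    then have rest: "S - {t, m} = {x, y, z}" using xyz(1) m(2) by auto
    have mt: "m \<in> S - {t}" "t \<in> S" using m xyz by auto
    have "\<not> (\<forall>u\<in>{x, y, z}. S - {t, u} \<in> H)" "\<not> (\<forall>u\<in>{x, y, z}. S - {t, u} \<in> - H)"
      using no(1)[OF mt(2), of m] no(2)[OF mt(2), of m] mt(1) by (simp_all add: three_at_Diff rest)
    then show "\<not> (r t x \<and> r t y \<and> r t z)" "r t x \<or> r t y \<or> r t z" by (auto simp: r_def)
  qed
  have "\<exists>x y z u v. distinct [x, y, z, u, v] \<and> {x, y, z, u, v} = {a, b, c, d, e} \<and>
      r x y \<and> r y z \<and> r z u \<and> r u v \<and> r v x"
  proof (rule triangle_or_pentagon[OF sym dist])
    fix x y z assume xyz: "distinct [x, y, z]" "{x, y, z} \<subseteq> {a, b, c, d, e}"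
    obtain u where u: "u \<in> S" "u \<notin> set [x, y, z]"
      using card_remainder_nonempty[OF fin, of "[x, y, z]"] assms(4) by auto
    have sub: "{x, y, z, u} \<subseteq> S" using xyz(2) u(1) unfolding S by blast
    have "distinct [x, y, z, u]" "distinct [y, x, z, u]" "distinct [z, x, y, u]" "distinct [u, x, y, z]"
      using xyz(1) u(2) by auto
    moreover have "{y, x, z, u} \<subseteq> S" "{z, x, y, u} \<subseteq> S" "{u, x, y, z} \<subseteq> S" using sub by auto
    ultimately show "\<not> (r x y \<and> r y z \<and> r z x) \<and> (r x y \<or> r y z \<or> r z x)"
      using deg[of x y z u] deg[of y x z u] deg[of z x y u] deg[of u x y z] sub
        sym[of x y] sym[of x z] sym[of y z] sym[of x u] sym[of y u] sym[of z u] by blast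
  qed
  then obtain x y z u v where w: "distinct [x, y, z, u, v]" "{x, y, z, u, v} = {a, b, c, d, e}"
    "r x y" "r y z" "r z u" "r u v" by metis
  have S': "S = {x, y, z, u, v}" using w(2) S by simp
  have t: "S - {x, y} = {u, v, z}" "S - {y, z} = {u, v, x}" "S - {z, u} = {v, x, y}" "S - {u, v} = {x, y, z}"
    unfolding S' using w(1) by auto
  show ?thesis
    by (rule spans_five_walk[OF assms(1-3), of S u v x y z])
      (use S' w(1,3-6) t in \<open>auto simp: r_def insert_commute\<close>)
qed

section \<open>A tree against a star on five vertices\<close>

lemma link_map_square:
  assumes "distinct [c, x, y, z, u]" "{c, x, y} \<in> H" "{c, y, z} \<in> H" "{c, z, u} \<in> H" "{c, u, x} \<in> H"
  shows "link_map H c {x, y, z, u} (\<lambda>w. if w = x then y else if w = y then z else if w = z then u else x)"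
  using assms distinct_rev[of "[c, x, y, z, u]"] by (simp add: link_map_def)

text \<open>The variables are the edges of the complete graph on \<open>w\<close>, \<open>x\<close>,
  \<open>y\<close>, \<open>z\<close>. If the two missing edges are disjoint, a four-cycle is left
  (the first three alternatives); otherwise a triangle with a pendant edge.\<close>

lemma four_of_six:
  fixes wx wy wz xy xz yz :: bool
  assumes "of_bool wx + of_bool wy + of_bool wz + of_bool xy + of_bool xz + of_bool yz \<ge> (4 :: nat)"
  shows "wx \<and> xy \<and> yz \<and> wz \<or> wx \<and> xz \<and> yz \<and> wy \<or> wy \<and> xy \<and> xz \<and> wz \<or>
    wx \<and> xy \<and> wy \<and> (wz \<or> xz \<or> yz) \<or> wx \<and> xz \<and> wz \<and> (wy \<or> xy \<or> yz) \<or>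
    wy \<and> yz \<and> wz \<and> (wx \<or> xy \<or> xz) \<or> xy \<and> yz \<and> xz \<and> (wx \<or> wy \<or> wz)"
  using assms by (cases wx; cases wy; cases wz; cases xy; cases xz; cases yz; simp)

text \<open>Both graphs with four edges on four vertices contain a cycle and are connected: the
  cycle is oriented, and the pendant vertex points to the triangle.\<close>

lemma link_map_four:
  assumes dist: "distinct [c, w, x, y, z]"
    and four: "of_bool ({c, w, x} \<in> H) + of_bool ({c, w, y} \<in> H) + of_bool ({c, w, z} \<in> H) +
      of_bool ({c, x, y} \<in> H) + of_bool ({c, x, z} \<in> H) + of_bool ({c, y, z} \<in> H) \<ge> (4 :: nat)"
  shows "\<exists>h. link_map H c {w, x, y, z} h"
proof -
  have flip: "{c, p, q} = {c, q, p}" for p q by (simp add: insert_commute)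
  have square: ?thesis
    if "distinct [c, p, q, r, s]" "{p, q, r, s} = {w, x, y, z}"
      "{c, p, q} \<in> H \<and> {c, q, r} \<in> H \<and> {c, r, s} \<in> H \<and> {c, s, p} \<in> H" for p q r s
    using link_map_square[OF that(1), of H] that(3) unfolding that(2) by blast
  have triangle: ?thesis
    if "distinct [c, p, q, r, s]" "{s, p, q, r} = {w, x, y, z}"
      "{c, p, q} \<in> H \<and> {c, q, r} \<in> H \<and> {c, r, p} \<in> H"
      and pendant: "{c, s, p} \<in> H \<or> {c, s, q} \<in> H \<or> {c, s, r} \<in> H" for p q r s
  proof -
    have "\<exists>k. link_map H c {p, q, r} k"
      using link_map_triangle[of c p q r H] that(1,3) by auto
    then obtain k where k: "link_map H c {p, q, r} k" by blast
    obtain t where "t \<in> {p, q, r}" "{c, s, t} \<in> H" using pendant by blast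
    then have "link_map H c {s, p, q, r} (k(s := t))"
      using link_map_insert[OF k, of s t] that(1) by auto
    then show ?thesis unfolding that(2) by blast
  qed
  note flips = flip[of x w] flip[of y w] flip[of z w] flip[of y x] flip[of z x] flip[of z y]
  from four_of_six[OF four] show ?thesis
  proof (elim disjE)
    assume "{c, w, x} \<in> H \<and> {c, x, y} \<in> H \<and> {c, y, z} \<in> H \<and> {c, w, z} \<in> H"
    then show ?thesis by (intro square[of w x y z]) (use dist in \<open>auto simp: flips\<close>)
  next
    assume "{c, w, x} \<in> H \<and> {c, x, z} \<in> H \<and> {c, y, z} \<in> H \<and> {c, w, y} \<in> H"
    then show ?thesis by (intro square[of w x z y]) (use dist in \<open>auto simp: flips\<close>)
  next
    assume "{c, w, y} \<in> H \<and> {c, x, y} \<in> H \<and> {c, x, z} \<in> H \<and> {c, w, z} \<in> H"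
    then show ?thesis by (intro square[of w y x z]) (use dist in \<open>auto simp: flips\<close>)
  next
    assume "{c, w, x} \<in> H \<and> {c, x, y} \<in> H \<and> {c, w, y} \<in> H \<and> ({c, w, z} \<in> H \<or> {c, x, z} \<in> H \<or> {c, y, z} \<in> H)"
    then show ?thesis by (intro triangle[of w x y z]) (use dist in \<open>auto simp: flips\<close>)
  next
    assume "{c, w, x} \<in> H \<and> {c, x, z} \<in> H \<and> {c, w, z} \<in> H \<and> ({c, w, y} \<in> H \<or> {c, x, y} \<in> H \<or> {c, y, z} \<in> H)"
    then show ?thesis by (intro triangle[of w x z y]) (use dist in \<open>auto simp: flips\<close>)
  next
    assume "{c, w, y} \<in> H \<and> {c, y, z} \<in> H \<and> {c, w, z} \<in> H \<and> ({c, w, x} \<in> H \<or> {c, x, y} \<in> H \<or> {c, x, z} \<in> H)"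
    then show ?thesis by (intro triangle[of w y z x]) (use dist in \<open>auto simp: flips\<close>)
  next
    assume "{c, x, y} \<in> H \<and> {c, y, z} \<in> H \<and> {c, x, z} \<in> H \<and> ({c, w, x} \<in> H \<or> {c, w, y} \<in> H \<or> {c, w, z} \<in> H)"
    then show ?thesis by (intro triangle[of x y z w]) (use dist in \<open>auto simp: flips\<close>)
  qed
qed

lemma two_of_four:
  fixes p q r s :: bool
  assumes "p \<or> q \<or> r" "p \<or> q \<or> s" "p \<or> r \<or> s" "q \<or> r \<or> s"
  shows "of_bool p + of_bool q + of_bool r + of_bool s \<ge> (2 :: nat)"
  using assms by (cases p; cases q; cases r; cases s; simp)

text \<open>
  The triples of a five-element set correspond to pairs by complementation. Summing over all five
  vertices, the degree conditions force at least six pairs, so some vertex is missed by four of them.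
\<close>

lemma link_map_five:
  assumes "card S = 5" "t \<in> S" "three_at H (S - {t}) m"
    and no: "\<And>v m. v \<in> S \<Longrightarrow> \<not> three_at (- H) (S - {v}) m"
  shows "\<exists>c\<in>S. \<exists>h. link_map H c (S - {c}) h"
proof -
  have fin: "finite S" using assms(1) card.infinite by fastforce
  have m: "m \<in> S" "m \<noteq> t" using assms(3) by (auto simp: three_at_def)
  have "card (S - {t, m}) = 3" using assms(1,2) m fin by (simp add: card_Diff_subset)
  then obtain x y z where xyz: "S - {t, m} = {x, y, z}" "x \<noteq> y" "x \<noteq> z" "y \<noteq> z"
    by (metis card_3_iff)
  have S: "S = {t, m, x, y, z}" using xyz(1) m assms(2) by auto
  have dist: "distinct [t, m, x, y, z]" using xyz m by auto
  define r where "r p q = (of_bool (S - {p, q} \<in> H) :: nat)" for p q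
  have sym: "r p q = r q p" for p q by (simp add: r_def insert_commute)
  have deg: "r v p + r v q + r v u + r v s \<ge> 2"
    if vs: "distinct [v, p, q, u, s]" "{v, p, q, u, s} = S" for v p q u s
  proof -
    have one: "S - {v, a} \<in> H \<or> S - {v, b} \<in> H \<or> S - {v, c} \<in> H"
      if "{a, b, c, d} = S - {v}" "distinct [a, b, c, d]" for a b c d
    proof -
      have "S - {v, d} = S - {v} - {d}" by auto
      also have "\<dots> = {a, b, c}" unfolding that(1)[symmetric] using that(2) by auto
      finally have "S - {v, d} = {a, b, c}" .
      moreover have "d \<in> S - {v}" "v \<in> S" using that(1) vs(2) by auto
      ultimately show ?thesis using no[of v d] unfolding three_at_Diff by auto
    qed
    have eq: "{p, q, u, s} = S - {v}" unfolding vs(2)[symmetric] using vs(1) by auto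
    show ?thesis
      unfolding r_def
    proof (rule two_of_four)
      show "S - {v, p} \<in> H \<or> S - {v, q} \<in> H \<or> S - {v, u} \<in> H"
        by (rule one[of p q u s]) (use eq vs(1) in auto)
      show "S - {v, p} \<in> H \<or> S - {v, q} \<in> H \<or> S - {v, s} \<in> H"
        by (rule one[of p q s u]) (use eq vs(1) in auto)
      show "S - {v, p} \<in> H \<or> S - {v, u} \<in> H \<or> S - {v, s} \<in> H"
        by (rule one[of p u s q]) (use eq vs(1) in auto)
      show "S - {v, q} \<in> H \<or> S - {v, u} \<in> H \<or> S - {v, s} \<in> H"
        by (rule one[of q u s p]) (use eq vs(1) in auto)
    qed
  qed
  have top: "r t x = 1" "r t y = 1" "r t z = 1"
  proof -
    have "S - {t, u} \<in> H" if "u \<in> {x, y, z}" for u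
    proof -
      have "u \<in> S - {t, m}" using that unfolding xyz(1) .
      then show ?thesis using assms(3) unfolding three_at_Diff by blast
    qed
    then show "r t x = 1" "r t y = 1" "r t z = 1" by (auto simp: r_def)
  qed
  \<comment> \<open>The triples through \<open>c\<close> are the complements of the pairs avoiding
    \<open>c\<close>, so four such pairs are four edges in the link of \<open>c\<close>.\<close>
  have good: ?thesis
    if vs: "distinct [c, p, q, u, s]" "{c, p, q, u, s} = S"
      and ge: "r p q + r p u + r p s + r q u + r q s + r u s \<ge> 4" for c p q u s
  proof -
    have "S - {u, s} = {c, p, q}" "S - {q, s} = {c, p, u}" "S - {q, u} = {c, p, s}"
      "S - {p, s} = {c, q, u}" "S - {p, u} = {c, q, s}" "S - {p, q} = {c, u, s}" "S - {c} = {p, q, u, s}"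
      unfolding vs(2)[symmetric] using vs(1) by auto
    then have "\<exists>h. link_map H c (S - {c}) h"
      using link_map_four[OF vs(1), of H] ge unfolding r_def by simp
    then show ?thesis using vs(2) by blast
  qed
  have "r m t + r m x + r m y + r m z \<ge> 2" "r x t + r x m + r x y + r x z \<ge> 2"
    "r y t + r y m + r y x + r y z \<ge> 2" "r z t + r z m + r z x + r z y \<ge> 2"
    by (rule deg; use dist in \<open>auto simp: S\<close>)+
  \<comment> \<open>One degree at least three and four degrees at least two add up to eleven or
    more, so there are at least six pairs. Each pair avoids three of the five vertices, so the five
    sums total at least eighteen and one of them reaches four.\<close>
  then have "r m x + r m y + r m z + r x y + r x z + r y z \<ge> 4 \<or>
      r t x + r t y + r t z + r x y + r x z + r y z \<ge> 4 \<or>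
      r t m + r t y + r t z + r m y + r m z + r y z \<ge> 4 \<or>
      r t m + r t x + r t z + r m x + r m z + r x z \<ge> 4 \<or>
      r t m + r t x + r t y + r m x + r m y + r x y \<ge> 4"
    using top sym[of m t] sym[of x t] sym[of y t] sym[of z t] sym[of x m] sym[of y m] sym[of z m]
      sym[of y x] sym[of z x] sym[of z y] by linarith
  then show ?thesis
  proof (elim disjE)
    assume "r m x + r m y + r m z + r x y + r x z + r y z \<ge> 4"
    then show ?thesis by (intro good[of t m x y z]) (use dist in \<open>auto simp: S\<close>)
  next
    assume "r t x + r t y + r t z + r x y + r x z + r y z \<ge> 4"
    then show ?thesis by (intro good[of m t x y z]) (use dist in \<open>auto simp: S\<close>)
  next
    assume "r t m + r t y + r t z + r m y + r m z + r y z \<ge> 4"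
    then show ?thesis by (intro good[of x t m y z]) (use dist in \<open>auto simp: S\<close>)
  next
    assume "r t m + r t x + r t z + r m x + r m z + r x z \<ge> 4"
    then show ?thesis by (intro good[of y t m x z]) (use dist in \<open>auto simp: S\<close>)
  next
    assume "r t m + r t x + r t y + r m x + r m y + r x y \<ge> 4"
    then show ?thesis by (intro good[of z t m x y]) (use dist in \<open>auto simp: S\<close>)
  qed
qed

text \<open>A \<open>three_at\<close> in \<open>H\<close> yields the first tree, or covers all five
  vertices with full pairs of \<open>- H\<close>, which yields the second. With none in
  \<open>H\<close>, the balanced case leaves only a \<open>three_at\<close> in \<open>- H\<close>.
  There a non-star is treated symmetrically, and a star is obtained from
  \<open>link_map_five\<close>.\<close>

lemma ramsey_five:
  assumes "card S = 5" "grown_tree V1 E1" "two_disjoint E1" "card V1 = 5" "grown_tree V2 E2" "card V2 = 5"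
  shows "spans V1 E1 S H \<or> spans V2 E2 S (- H)"
proof (rule ccontr)
  assume neg: "\<not> ?thesis"
  have no1: "\<not> three_at H (S - {v}) m" if "v \<in> S" for v m
    using five_extend_three_at[OF assms(2-4,1) that, of H m] neg
      spans_if_self_paired[OF _ _ assms(5), of "- H" S S] assms(1,6) by auto
  have "\<exists>v\<in>S. \<exists>m. three_at (- H) (S - {v}) m"
    using spans_five_balanced[OF assms(2-4,1) no1] neg by blast
  then obtain v m where vm: "v \<in> S" "three_at (- H) (S - {v}) m" by blast
  show False
  proof (cases "two_disjoint E2")
    case True
    show False
      using five_extend_three_at[OF assms(5) True assms(6,1) vm] neg
        spans_if_self_paired[OF _ _ assms(2), of H S S] assms(1,4) by auto
  next
    case False
    obtain a where a: "a \<in> V2" "E2 = spokes a V2" using star_if_not_two_disjoint[OF assms(5) False] by blast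
    obtain c h where ch: "c \<in> S" "link_map (- H) c (S - {c}) h"
      using link_map_five[OF assms(1) vm] no1 by auto
    have "finite S" "finite V2" using assms(1,6) card.infinite by fastforce+
    then have "spans V2 E2 S (- H)"
      using spans_star[OF ch(2,1)] assms(1,6) a by simp
    then show False using neg by blast
  qed
qed

subsection \<open>The induction\<close>

lemma twig_card: "twig V' E' V E \<Longrightarrow> finite V' \<Longrightarrow> card V = card V' + 2"
  unfolding twig_def by auto

definition paired_part :: "'b set set \<Rightarrow> 'b set \<Rightarrow> 'b set" where
  "paired_part H S = {v. \<exists>u. full_pair H S v u}"

lemma paired_part_subset: "paired_part H S \<subseteq> S"
  by (auto simp: paired_part_def full_pair_def)

lemma self_paired_paired_part: "self_paired H S (paired_part H S)"
proof (rule self_pairedI[OF paired_part_subset])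
  fix y assume "y \<in> paired_part H S"
  then obtain q where "full_pair H S y q" by (auto simp: paired_part_def)
  moreover from full_pair_sym[OF this] have "q \<in> paired_part H S" by (auto simp: paired_part_def)
  ultimately show "\<exists>q\<in>paired_part H S. full_pair H S y q" by blast
qed

text \<open>If \<open>v\<close> had partners \<open>u\<close> and \<open>w\<close> in the two
  colours, the triple of \<open>v\<close>, \<open>u\<close>, \<open>w\<close> would have both; for
  \<open>u = w\<close> any third vertex serves.\<close>

lemma paired_part_disjoint:
  assumes "finite S" "card S \<ge> 3"
  shows "paired_part H S \<inter> paired_part (- H) S = {}"
proof (rule ccontr)
  assume "\<not> ?thesis"
  then obtain v u w where u: "full_pair H S v u" and w: "full_pair (- H) S v w"
    by (auto simp: paired_part_def)
  obtain z where z: "z \<in> S" "z \<noteq> v" "z \<noteq> u"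
    using card_remainder_nonempty[OF assms(1), of "[v, u]"] assms(2) by auto
  have mem: "u \<in> S" "w \<in> S" "u \<noteq> v" "w \<noteq> v" using u w by (auto simp: full_pair_def)
  show False
  proof (cases "u = w")
    case True
    then show False using full_pairD[OF u z(1,2,3)] full_pairD[OF w z(1,2)] z(3) by simp
  next
    case False
    have "{v, u, w} \<in> H" using full_pairD[OF u mem(2,4)] False by blast
    moreover have "{v, w, u} \<in> - H" using full_pairD[OF w mem(1,3) False] .
    ultimately show False by (simp add: insert_commute)
  qed
qed

lemma paired_part_two:
  assumes "v \<in> paired_part H S"
  obtains u where "u \<in> paired_part H S" "u \<noteq> v" "full_pair H S v u"
  using self_pairedE[OF self_paired_paired_part assms] .

lemma spans_if_missing_few:
  assumes "card S \<ge> 6" "grown_tree V E" "card V = card S"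
    and "card (paired_part H S) + 2 = card S \<or> card (paired_part H S) = card S"
  shows "spans V E S H"
  using assms(4)
proof
  assume "card (paired_part H S) + 2 = card S"
  then show ?thesis
    using spans_if_two_outside[OF self_paired_paired_part _ _ assms(2,3)] assms(1) by simp
next
  assume eq: "card (paired_part H S) = card S"
  have "finite S" using assms(1) card.infinite by fastforce
  then have "paired_part H S = S" using card_subset_eq[OF _ paired_part_subset eq] by simp
  then have "self_paired H S S" using self_paired_paired_part[of H S] by simp
  then show ?thesis using spans_if_self_paired[OF _ _ assms(2,3)] assms(1) by simp
qed

text \<open>A nonempty part contains both ends of a full pair. If one part had no vertex or two, the
  other would have all vertices or all but two, and the tree of its colour would span. So each part
  has at least three.\<close>

lemma spans_or_large_parts:
  assumes card: "card S \<ge> 6" and cover: "S \<subseteq> paired_part H S \<union> paired_part (- H) S"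
    and T: "grown_tree V1 E1" "card V1 = card S" "grown_tree V2 E2" "card V2 = card S"
    and neg: "\<not> spans V1 E1 S H" "\<not> spans V2 E2 S (- H)"
  shows "card (paired_part H S) \<ge> 3 \<and> card (paired_part (- H) S) \<ge> 3 \<and>
    card (paired_part H S) + card (paired_part (- H) S) = card S"
proof -
  let ?R = "paired_part H S" and ?B = "paired_part (- H) S"
  have fin: "finite S" using card card.infinite by fastforce
  have finp: "finite ?R" "finite ?B" using finite_subset[OF paired_part_subset fin] by blast+
  have disj: "?R \<inter> ?B = {}" using paired_part_disjoint[OF fin] card by simp
  have un: "?R \<union> ?B = S" using cover paired_part_subset[of H S] paired_part_subset[of "- H" S] by blast
  have sum: "card ?R + card ?B = card S"
    using card_Un_disjoint[OF finp disj] un by simp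
  have two: "card (paired_part K S) = 0 \<or> card (paired_part K S) \<ge> 2" for K
  proof (cases "paired_part K S = {}")
    case False
    then obtain v where v: "v \<in> paired_part K S" by blast
    then obtain u where "u \<in> paired_part K S" "u \<noteq> v" by (rule paired_part_two)
    then have "card {v, u} \<le> card (paired_part K S)" "card {v, u} = 2"
      using card_mono[OF finite_subset[OF paired_part_subset[of K S] fin], of "{v, u}"] v by simp_all
    then show ?thesis by simp
  qed simp
  have "card ?R + 2 \<noteq> card S" "card ?R \<noteq> card S" using spans_if_missing_few[OF card T(1,2)] neg(1) by blast+
  moreover have "card ?B + 2 \<noteq> card S" "card ?B \<noteq> card S" using spans_if_missing_few[OF card T(3,4)] neg(2) by blast+
  ultimately show ?thesis using sum two[of H] two[of "- H"] by arith
qed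

lemma spans_star_if_large_part:
  assumes "card (paired_part H S) \<ge> 3" "card S \<ge> 4" "grown_tree V E" "\<not> two_disjoint E" "card V = card S"
  shows "spans V E S H"
proof -
  obtain a where a: "a \<in> V" "E = spokes a V"
    using star_if_not_two_disjoint[OF assms(3,4)] by blast
  obtain c h where ch: "c \<in> S" "link_map H c (S - {c}) h"
    using link_map_if_self_paired[OF self_paired_paired_part assms(1,2)] by blast
  have "finite S" "finite V" using assms(2,5) card.infinite by fastforce+
  then show ?thesis using spans_star[OF ch(2,1)] assms(5) a by simp
qed

text \<open>Only the first tree is assumed to be no star. The second one turns out to be none
  whenever a counterexample survives so far, because three paired vertices already yield a star;
  this makes the twig argument available in both colours. On six vertices, where deleting two would
  fall below five, both parts have size three and \<open>spans_six\<close> applies.\<close>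

lemma ramsey_two_disjoint:
  assumes "card S \<ge> 5" "grown_tree V1 E1" "two_disjoint E1" "card V1 = card S"
    and "grown_tree V2 E2" "card V2 = card S"
  shows "spans V1 E1 S H \<or> spans V2 E2 S (- H)"
  using assms
proof (induction "card S" arbitrary: S H V1 E1 V2 E2 rule: less_induct)
  case less
  note T1 = less.prems(2,3,4) and T2 = less.prems(5,6)
  show ?case
  proof (cases "card S = 5")
    case True
    then show ?thesis using ramsey_five[OF _ T1(1,2) _ T2(1)] T1(3) T2(2) by simp
  next
    case False
    then have card: "card S \<ge> 6" using less.prems(1) by simp
    have fin: "finite S" using card card.infinite by fastforce
    show ?thesis
    proof (rule ccontr)
      assume "\<not> ?thesis"
      then have neg: "\<not> spans V1 E1 S H" "\<not> spans V2 E2 S (- H)" by auto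
      let ?R = "paired_part H S" and ?B = "paired_part (- H) S"
      have cover: "S \<subseteq> ?R \<union> ?B"
      proof
        fix v assume v: "v \<in> S"
        obtain V1' E1' x1 y1 where D1: "grown_tree V1' E1'" "two_disjoint E1'" "y1 \<in> V1'" "x1 \<notin> V1'"
          "V1 = insert x1 V1'" "E1 = insert {x1, y1} E1'"
          using two_disjoint_leaf_removal[OF T1(1,2)] T1(3) card by auto
        obtain V2' E2' x2 y2 where D2: "grown_tree V2' E2'" "y2 \<in> V2'" "x2 \<notin> V2'"
          "V2 = insert x2 V2'" "E2 = insert {x2, y2} E2'"
          using T2(1)
        proof cases
          case (single x)
          then show thesis using T2(2) card by simp
        next
          case (leaf V E y x)
          then show thesis using that by metis
        qed
        have cards: "card (S - {v}) < card S" "card (S - {v}) \<ge> 5" "card V1' = card (S - {v})"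
          "card V2' = card (S - {v})"
          using D1(4,5) D2(3,4) T1(3) T2(2) v card fin grown_tree_finite[OF D1(1)] grown_tree_finite[OF D2(1)]
          by auto
        have "spans V1' E1' (S - {v}) H \<or> spans V2' E2' (S - {v}) (- H)"
          using less.hyps[OF cards(1,2) D1(1,2) cards(3) D2(1) cards(4)] .
        then show "v \<in> ?R \<union> ?B"
        proof
          assume sp: "spans V1' E1' (S - {v}) H"
          have "\<exists>u. full_pair (- H) S v u"
            by (rule full_pair_if_not_extendable[OF sp D1(1,3,4) v]) (use neg(1) D1(5,6) in simp)
          then show ?thesis by (auto simp: paired_part_def)
        next
          assume sp: "spans V2' E2' (S - {v}) (- H)"
          have "\<exists>u. full_pair (- (- H)) S v u"
            by (rule full_pair_if_not_extendable[OF sp D2(1-3) v]) (use neg(2) D2(4,5) in simp)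
          then show ?thesis by (auto simp: paired_part_def)
        qed
      qed
      have large: "card ?R \<ge> 3" "card ?B \<ge> 3" and sum: "card ?R + card ?B = card S"
        using spans_or_large_parts[OF card cover T1(1,3) T2 neg] by blast+
      have disj2: "two_disjoint E2"
        using spans_star_if_large_part[OF large(2) _ T2(1) _ T2(2)] neg(2) card by auto
      show False
      proof (cases "card S = 6")
        case True
        then have "card ?R = 3" using sum large by simp
        then show False
          using spans_six[OF self_paired_paired_part _ True T1(1)] T1(3) True neg(1) by simp
      next
        case False
        have "?R \<noteq> {}" "?B \<noteq> {}" using large by fastforce+
        then obtain v w where v: "v \<in> ?R" and w: "w \<in> ?B" by blast
        obtain u where vu: "v \<in> ?R" "full_pair H S v u" "u \<in> ?R"
          using paired_part_two[OF v] v by metis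
        obtain t where wt: "w \<in> ?B" "full_pair (- H) S w t" "t \<in> ?B"
          using paired_part_two[OF w] w by metis
        have RB: "?R \<inter> ?B = {}" using paired_part_disjoint[OF fin] card by simp
        have neq: "w \<noteq> u" "w \<noteq> v" "v \<noteq> t" "v \<noteq> w" using RB vu wt by blast+
        have in_S: "v \<in> S" "w \<in> S" using subsetD[OF paired_part_subset v] subsetD[OF paired_part_subset w] by simp_all
        have "card S \<ge> 7" using False card by simp
        then obtain V1' E1' where D1: "grown_tree V1' E1'" "two_disjoint E1'" "twig V1' E1' V1 E1"
          using ex_twig_two_disjoint[OF T1(1,2)] T1(3) by auto
        obtain V2' E2' where D2: "grown_tree V2' E2'" "twig V2' E2' V2 E2"
          using ex_twig[OF T2(1)] T2(2) card by auto
        have cS: "card (S - {v, w}) = card S - 2" using in_S neq(4) fin by (simp add: card_Diff_subset)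
        have cards: "card (S - {v, w}) < card S" "card (S - {v, w}) \<ge> 5" "card V1' = card (S - {v, w})"
          "card V2' = card (S - {v, w})"
          using cS \<open>card S \<ge> 7\<close> twig_card[OF D1(3)] twig_card[OF D2(2)] T1(3) T2(2)
            grown_tree_finite[OF D1(1)] grown_tree_finite[OF D2(1)] by auto
        have "spans V1' E1' (S - {v, w}) H \<or> spans V2' E2' (S - {v, w}) (- H)"
          using less.hyps[OF cards(1,2) D1(1,2) cards(3) D2(1) cards(4)] .
        then show False
        proof
          assume "spans V1' E1' (S - {v, w}) H"
          then show False
            using spans_twig[OF D1(3,1) T1(2) _ vu(2) in_S(2) neq(1,2)] card neg(1) by simp
        next
          assume "spans V2' E2' (S - {v, w}) (- H)"
          then have "spans V2' E2' (S - {w, v}) (- H)" by (simp add: insert_commute)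
          then show False
            using spans_twig[OF D2(2,1) disj2 _ wt(2) in_S(1) neq(3,4)] card neg(2) by simp
        qed
      qed
    qed
  qed
qed

lemma ramsey_not_both_stars:
  assumes "card S \<ge> 5" "grown_tree V1 E1" "card V1 = card S" "grown_tree V2 E2" "card V2 = card S"
    and "two_disjoint E1 \<or> two_disjoint E2"
  shows "spans V1 E1 S H \<or> spans V2 E2 S (- H)"
  using assms(6)
proof
  assume "two_disjoint E1"
  then show ?thesis using ramsey_two_disjoint[OF assms(1,2) _ assms(3-5)] by blast
next
  assume "two_disjoint E2"
  then show ?thesis using ramsey_two_disjoint[OF assms(1,4) _ assms(5,2,3), of "- H"] by auto
qed

text \<open>For two stars, a vertex in no full pair is the centre of a star in one of the colours.
  If there is no such vertex, either one of the trees spans or the part of colour \<open>H\<close>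
  has three vertices, enough for a star.\<close>

lemma ramsey_large:
  assumes "card S \<ge> 6" "grown_tree V1 E1" "card V1 = card S" "grown_tree V2 E2" "card V2 = card S"
  shows "spans V1 E1 S H \<or> spans V2 E2 S (- H)"
proof (cases "two_disjoint E1 \<or> two_disjoint E2")
  case True
  then show ?thesis using ramsey_not_both_stars[OF _ assms(2-5)] assms(1) by simp
next
  case False
  obtain a b where a: "a \<in> V1" "E1 = spokes a V1" and b: "b \<in> V2" "E2 = spokes b V2"
    using star_if_not_two_disjoint[OF assms(2)] star_if_not_two_disjoint[OF assms(4)] False by metis
  have fin: "finite S" "finite V1" "finite V2" using assms(1,3,5) card.infinite by fastforce+
  show ?thesis
  proof (cases "S \<subseteq> paired_part H S \<union> paired_part (- H) S")
    case True
    show ?thesis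
    proof (rule ccontr)
      assume neg: "\<not> ?thesis"
      then have "card (paired_part H S) \<ge> 3"
        using spans_or_large_parts[OF assms(1) True assms(2-5)] by blast
      then show False using spans_star_if_large_part[OF _ _ assms(2) _ assms(3)] False assms(1) neg by auto
    qed
  next
    case False
    then obtain v where "v \<in> S" "v \<notin> paired_part H S \<union> paired_part (- H) S" by blast
    then obtain h where "link_map H v (S - {v}) h \<or> link_map (- H) v (S - {v}) h"
      using mono_partner_or_star[OF assms(1), of v H] unfolding paired_part_def by blast
    then show ?thesis
      using spans_star[of H v S h V1 a] spans_star[of "- H" v S h V2 b] \<open>v \<in> S\<close> fin a b assms(3,5) by auto
  qed
qed

subsection \<open>Ramsey numbers\<close>

text \<open>The copy need not cover \<open>S\<close>. The hosts on three and four vertices require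
  this, since a tree there may have fewer vertices than the host.\<close>

definition embeds :: "'a set \<Rightarrow> 'a set set \<Rightarrow> 'b set \<Rightarrow> 'b set set \<Rightarrow> bool" where
  "embeds V E S H \<longleftrightarrow> (\<exists>\<phi> f. inj_on \<phi> V \<and> \<phi> ` V \<subseteq> S \<and> inj_on f E \<and>
     (\<forall>e\<in>E. \<phi> ` e \<subseteq> f e \<and> f e \<subseteq> S \<and> card (f e) = 3 \<and> f e \<in> H))"

lemma embeds_if_spans:
  assumes "spans V E S H"
  shows "embeds V E S H"
proof -
  obtain \<phi> f where "berge_map V E S H \<phi> f" using assms by (auto simp: spans_def)
  then show ?thesis
    unfolding embeds_def by (intro exI[of _ \<phi>] exI[of _ f]) (auto simp: berge_map_def bij_betw_def)
qed

text \<open>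
  Extending a tree by new leaves needs fresh vertices, so trees are first transported to the
  natural numbers.
\<close>

definition subtree_of :: "'a set \<Rightarrow> 'a set set \<Rightarrow> nat set \<Rightarrow> nat set set \<Rightarrow> bool" where
  "subtree_of V E V' E' \<longleftrightarrow> grown_tree V' E' \<and> (\<exists>g. inj_on g V \<and> g ` V \<subseteq> V' \<and> (`) g ` E \<subseteq> E')"

lemma grown_tree_image:
  "grown_tree V E \<Longrightarrow> inj_on g V \<Longrightarrow> grown_tree (g ` V) ((`) g ` E)"
proof (induction rule: grown_tree.induct)
  case (single x)
  then show ?case using grown_tree.single[of "g x"] by simp
next
  case (leaf V E y x)
  have "g x \<notin> g ` V" using leaf.prems leaf.hyps(3) by (auto simp: inj_on_def)
  then have "grown_tree (insert (g x) (g ` V)) (insert {g x, g y} ((`) g ` E))"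
    using grown_tree.leaf[of "g ` V" "(`) g ` E" "g y" "g x"] leaf by auto
  then show ?case by simp
qed

lemma two_disjoint_image:
  assumes "grown_tree V E" "inj_on g V" "two_disjoint E"
  shows "two_disjoint ((`) g ` E)"
proof -
  obtain e e' where e: "e \<in> E" "e' \<in> E" "e \<inter> e' = {}" using assms(3) by (auto simp: two_disjoint_def)
  have "e \<subseteq> V" "e' \<subseteq> V" using grown_tree_edge_subset[OF assms(1)] e by auto
  then have "g ` e \<inter> g ` e' = {}"
    using inj_on_image_Int[OF assms(2), of e e'] e(3) by simp
  then show ?thesis using e(1,2) unfolding two_disjoint_def by blast
qed

lemma fresh_nat: "finite (V :: nat set) \<Longrightarrow> \<exists>x. x \<notin> V"
  by (rule ex_new_if_finite[OF infinite_UNIV_nat])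

lemma grow_to_card:
  fixes V :: "nat set"
  assumes "grown_tree V E" "card V \<le> n"
  shows "\<exists>V' E'. grown_tree V' E' \<and> card V' = n \<and> V \<subseteq> V' \<and> E \<subseteq> E'"
  using assms
proof (induction "n - card V" arbitrary: V E)
  case 0
  then show ?case by force
next
  case (Suc k)
  have fin: "finite V" using grown_tree_finite[OF Suc.prems(1)] by blast
  obtain x where x: "x \<notin> V" using fresh_nat[OF fin] by blast
  obtain y where y: "y \<in> V" using grown_tree_nonempty[OF Suc.prems(1)] by blast
  have "grown_tree (insert x V) (insert {x, y} E)" using grown_tree.leaf[OF Suc.prems(1) y x] .
  moreover have "card (insert x V) = Suc (card V)" using x fin by simp
  then have "k = n - card (insert x V)" "card (insert x V) \<le> n" using Suc.hyps(2) by simp_all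
  ultimately obtain V' E' where "grown_tree V' E'" "card V' = n" "insert x V \<subseteq> V'" "insert {x, y} E \<subseteq> E'"
    using Suc.hyps(1)[of "insert x V" "insert {x, y} E"] by metis
  then show ?case by blast
qed

text \<open>Two stars are the failing pair on five vertices, so padding must be able to produce a
  non-star. A star with at least two spokes gets a leaf at the end \<open>l\<close> of one of them.
  A single edge needs a path of two new vertices, which explains \<open>4 \<le> n\<close>.\<close>

lemma grow_to_card_two_disjoint:
  fixes V :: "nat set"
  assumes tree: "grown_tree V E" and card: "2 \<le> card V" "card V < n" "4 \<le> n"
  shows "\<exists>V' E'. grown_tree V' E' \<and> card V' = n \<and> two_disjoint E' \<and> V \<subseteq> V' \<and> E \<subseteq> E'"
proof -
  have grow: ?thesis
    if W: "grown_tree W F" "card W \<le> n" "two_disjoint F" "V \<subseteq> W" "E \<subseteq> F" for W F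
  proof -
    obtain V' E' where "grown_tree V' E'" "card V' = n" "W \<subseteq> V'" "F \<subseteq> E'"
      using grow_to_card[OF W(1,2)] by metis
    then show ?thesis using two_disjoint_mono[OF W(3)] W(4,5) by (metis order_trans)
  qed
  have fin: "finite V" using grown_tree_finite[OF tree] by blast
  show ?thesis
  proof (cases "two_disjoint E")
    case True
    then show ?thesis using grow[OF tree] card by simp
  next
    case False
    then obtain c where c: "c \<in> V" "E = spokes c V" using star_if_not_two_disjoint[OF tree] by blast
    obtain l where l: "l \<in> V" "l \<noteq> c"
      using card_remainder_nonempty[OF fin, of "[c]"] card by auto
    obtain x where x: "x \<notin> V" using fresh_nat[OF fin] by blast
    have tx: "grown_tree (insert x V) (insert {x, l} E)" using grown_tree.leaf[OF tree l(1) x] .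
    show ?thesis
    proof (cases "card V = 2")
      case True
      obtain y where y: "y \<notin> insert x V" using fresh_nat[of "insert x V"] fin by blast
      have ty: "grown_tree (insert y (insert x V)) (insert {y, x} (insert {x, l} E))"
        using grown_tree.leaf[OF tx insertI1 y] .
      have "{c, l} \<in> E" unfolding c(2) using l by (intro spokesI)
      moreover have "{y, x} \<inter> {c, l} = {}" using x y c(1) l(1) by auto
      ultimately have "two_disjoint (insert {y, x} (insert {x, l} E))"
        unfolding two_disjoint_def by blast
      then show ?thesis using grow[OF ty] True fin x y card by auto
    next
      case False
      then obtain k where k: "k \<in> V" "k \<noteq> c" "k \<noteq> l"
        using card_remainder_nonempty[OF fin, of "[c, l]"] card by auto
      have "{c, k} \<in> E" unfolding c(2) using k by (intro spokesI)
      moreover have "{x, l} \<inter> {c, k} = {}" using x c(1) l k by auto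
      ultimately have "two_disjoint (insert {x, l} E)" unfolding two_disjoint_def by blast
      then show ?thesis using grow[OF tx] fin x card by auto
    qed
  qed
qed

lemma subtree_nat:
  assumes "grown_tree V E"
  obtains V' E' where "subtree_of V E V' E'" "card V' = card V" "two_disjoint E \<Longrightarrow> two_disjoint E'"
proof -
  have "finite V" using grown_tree_finite[OF assms] by blast
  then obtain g :: "'a \<Rightarrow> nat" where g: "inj_on g V" using finite_imp_inj_to_nat_seg by metis
  show ?thesis
  proof (rule that)
    show "subtree_of V E (g ` V) ((`) g ` E)"
      unfolding subtree_of_def using grown_tree_image[OF assms g] g by (intro conjI exI[of _ g]) simp_all
    show "card (g ` V) = card V" using card_image[OF g] .
    show "two_disjoint ((`) g ` E)" if "two_disjoint E" using two_disjoint_image[OF assms g that] .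
  qed
qed

lemma subtree_of_mono:
  assumes "subtree_of V E V' E'" "grown_tree W F" "V' \<subseteq> W" "E' \<subseteq> F"
  shows "subtree_of V E W F"
proof -
  obtain g where "inj_on g V" "g ` V \<subseteq> V'" "(`) g ` E \<subseteq> E'"
    using assms(1) unfolding subtree_of_def by (elim exE conjE) (rule that)
  then show ?thesis
    using assms(2-4) unfolding subtree_of_def by (intro conjI exI[of _ g]) (auto dest: order_trans)
qed

lemma subtree_extend:
  assumes "grown_tree V E" "card V \<le> n"
  obtains V' E' where "subtree_of V E V' E'" "card V' = n"
proof -
  obtain W F where W: "subtree_of V E W F" "card W = card V" using subtree_nat[OF assms(1)] by metis
  then obtain V' E' where "grown_tree V' E'" "card V' = n" "W \<subseteq> V'" "F \<subseteq> E'"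
    using grow_to_card[of W F n] assms(2) unfolding subtree_of_def by auto
  then show ?thesis using that subtree_of_mono[OF W(1)] by blast
qed

lemma subtree_extend_two_disjoint:
  assumes "grown_tree V E" "2 \<le> card V" "card V < n" "4 \<le> n"
  obtains V' E' where "subtree_of V E V' E'" "card V' = n" "two_disjoint E'"
proof -
  obtain W F where W: "subtree_of V E W F" "card W = card V" using subtree_nat[OF assms(1)] by metis
  then obtain V' E' where "grown_tree V' E'" "card V' = n" "two_disjoint E'" "W \<subseteq> V'" "F \<subseteq> E'"
    using grow_to_card_two_disjoint[of W F n] assms(2-) unfolding subtree_of_def by auto
  then show ?thesis using that subtree_of_mono[OF W(1)] by blast
qed

lemma contains_berge_if_embeds:
  assumes tree: "grown_tree V E" and sub: "subtree_of V E V' E'" and emb: "embeds V' E' {..<N} H"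
  shows "contains_berge V E {..<N} {h \<in> complete3 N. h \<in> H}"
proof -
  obtain g where g: "inj_on g V" "g ` V \<subseteq> V'" "(`) g ` E \<subseteq> E'"
    using sub unfolding subtree_of_def by (elim exE conjE) (rule that)
  obtain \<phi> f where \<phi>: "inj_on \<phi> V'" "\<phi> ` V' \<subseteq> {..<N}" "inj_on f E'" and
    edge: "\<forall>e\<in>E'. \<phi> ` e \<subseteq> f e \<and> f e \<subseteq> {..<N} \<and> card (f e) = 3 \<and> f e \<in> H"
    using emb unfolding embeds_def by (elim exE conjE) (rule that)
  have "inj_on ((`) g) E"
    by (rule inj_on_subset[OF inj_on_image_Pow[OF g(1)]])
      (use grown_tree_edge_subset[OF tree] in blast)
  then have "inj_on (f \<circ> (`) g) E" using inj_on_subset[OF \<phi>(3) g(3)] by (rule comp_inj_on)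
  moreover have "inj_on (\<phi> \<circ> g) V" using g(1) inj_on_subset[OF \<phi>(1) g(2)] by (rule comp_inj_on)
  moreover have "(\<phi> \<circ> g) ` V \<subseteq> {..<N}" using g(2) \<phi>(2) by fastforce
  moreover have im: "g ` e \<in> E'" if "e \<in> E" for e using g(3) that by blast
  then have "(f \<circ> (`) g) ` E \<subseteq> {h \<in> complete3 N. h \<in> H}"
    using edge by (force simp: complete3_def)
  moreover have "{(\<phi> \<circ> g) x, (\<phi> \<circ> g) y} \<subseteq> (f \<circ> (`) g) {x, y}" if "{x, y} \<in> E" for x y
    using edge im[OF that] by fastforce
  ultimately show ?thesis
    unfolding contains_berge_def by (intro exI[of _ "\<phi> \<circ> g"] exI[of _ "f \<circ> (`) g"] conjI) simp_all
qed

lemma berge_arrowsI: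
  assumes "grown_tree V1 E1" "subtree_of V1 E1 V1' E1'" "grown_tree V2 E2" "subtree_of V2 E2 V2' E2'"
    and "\<And>H. embeds V1' E1' {..<N} H \<or> embeds V2' E2' {..<N} (- H)"
  shows "berge_arrows N V1 E1 V2 E2"
  unfolding berge_arrows_def
proof
  fix c :: "nat set \<Rightarrow> colour"
  have "{h \<in> complete3 N. h \<in> {h. c h = Blue}} = {h \<in> complete3 N. c h = Blue}"
    "{h \<in> complete3 N. h \<in> - {h. c h = Blue}} = {h \<in> complete3 N. c h = Red}"
    by (auto intro: colour.exhaust)
  then show "contains_berge V1 E1 {..<N} {h \<in> complete3 N. c h = Blue} \<or>
      contains_berge V2 E2 {..<N} {h \<in> complete3 N. c h = Red}"
    using assms(5)[of "{h. c h = Blue}"] contains_berge_if_embeds[OF assms(1,2), of N "{h. c h = Blue}"]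
      contains_berge_if_embeds[OF assms(3,4), of N "- {h. c h = Blue}"] by auto
qed

section \<open>Hosts on three and four vertices\<close>

lemma embeds_path_three:
  assumes "grown_tree V E" "card V = 3" "card S = 4" "t \<in> S" "t' \<in> S" "t \<noteq> t'" "S - {t} \<in> H" "S - {t'} \<in> H"
  shows "embeds V E S H"
proof -
  have fin: "finite S" "finite V" using assms(2,3) card.infinite by fastforce+
  have "\<not> two_disjoint E"
  proof
    assume "two_disjoint E"
    then obtain e e' where e: "e \<in> E" "e' \<in> E" "e \<inter> e' = {}" by (auto simp: two_disjoint_def)
    obtain x y where x: "e = {x, y}" "x \<in> V" "y \<in> V" "x \<noteq> y" using grown_tree_edge[OF assms(1) e(1)] by blast
    obtain z w where z: "e' = {z, w}" "z \<in> V" "w \<in> V" "z \<noteq> w" using grown_tree_edge[OF assms(1) e(2)] by blast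
    have "card {x, y, z, w} = 4" using x z e(3) by auto
    moreover have "card {x, y, z, w} \<le> card V" by (rule card_mono[OF fin(2)]) (use x z in auto)
    ultimately show False using assms(2) by simp
  qed
  then obtain c where c: "c \<in> V" "E = spokes c V" using star_if_not_two_disjoint[OF assms(1)] by blast
  have "card (V - {c}) = 2" using c(1) assms(2) fin by simp
  then obtain l k where lk: "V - {c} = {l, k}" "l \<noteq> k" by (auto simp: card_2_iff)
  have lkc: "l \<noteq> c" "k \<noteq> c" using lk(1) by auto
  have V: "V = {c, l, k}" using lk(1) c(1) by auto
  have E: "E = {{c, l}, {c, k}}" unfolding c(2) spokes_def lk(1) by auto
  obtain p where p: "p \<in> S" "p \<noteq> t" "p \<noteq> t'"
    using card_remainder_nonempty[OF fin(1), of "[t, t']"] assms(3) by auto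
  \<comment> \<open>The centre lies in both triples. The leaf on \<open>t'\<close> uses the triple
    omitting \<open>t\<close>, and the leaf on \<open>t\<close> uses the triple omitting
    \<open>t'\<close>.\<close>
  define \<phi> where "\<phi> x = (if x = c then p else if x = l then t' else t)" for x
  define f where "f e = (if e = {c, l} then S - {t} else S - {t'})" for e
  have \<phi>: "\<phi> c = p" "\<phi> l = t'" "\<phi> k = t" using lk lkc by (auto simp: \<phi>_def)
  have f: "f {c, l} = S - {t}" "f {c, k} = S - {t'}" using lk lkc by (auto simp: f_def doubleton_eq_iff)
  have "S - {t} \<noteq> S - {t'}" using assms(4-6) by blast
  then have "inj_on f E" unfolding E inj_on_def using f by auto
  moreover have "inj_on \<phi> V" unfolding V inj_on_def using \<phi> p assms(6) by auto
  moreover have "\<phi> ` V \<subseteq> S" unfolding V using \<phi> p assms(4,5) by auto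
  moreover have "\<phi> ` e \<subseteq> f e \<and> f e \<subseteq> S \<and> card (f e) = 3 \<and> f e \<in> H" if "e \<in> E" for e
    using that unfolding E
  proof (elim insertE emptyE)
    assume e: "e = {c, l}"
    show ?thesis unfolding e f using \<phi> p assms(3-8) by (auto simp: card_Diff_singleton)
  next
    assume e: "e = {c, k}"
    show ?thesis unfolding e f using \<phi> p assms(3-8) by (auto simp: card_Diff_singleton)
  qed
  ultimately show ?thesis unfolding embeds_def by blast
qed

text \<open>Three triples of \<open>H\<close> at a common vertex give the tree on four vertices.
  Otherwise every vertex lies in a triple missing from \<open>H\<close>; applied to the vertex
  omitted by one missing triple, this yields a second one, and two suffice for a path.\<close>

lemma ramsey_four_three:
  assumes "card S = 4" "grown_tree V1 E1" "card V1 = 4" "grown_tree V2 E2" "card V2 = 3"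
  shows "embeds V1 E1 S H \<or> embeds V2 E2 S (- H)"
proof (cases "\<exists>z. three_at H S z")
  case True
  then obtain z where z: "three_at H S z" by blast
  have fin: "finite S" using assms(1) card.infinite by fastforce
  obtain w where w: "w \<in> S" "w \<noteq> z"
    using card_remainder_nonempty[OF fin, of "[z]"] assms(1) by auto
  obtain p where p: "p \<in> V1" using grown_tree_nonempty[OF assms(2)] by blast
  then show ?thesis
    using spans_four[OF assms(2,3,1) z w p p] spansI embeds_if_spans by metis
next
  case False
  then have miss: "\<exists>t\<in>S - {m}. S - {t} \<in> - H" if "m \<in> S" for m
    using that unfolding three_at_def by blast
  have "S \<noteq> {}" using assms(1) by auto
  then obtain t where t: "t \<in> S" "S - {t} \<in> - H" using miss by blast
  obtain t' where t': "t' \<in> S - {t}" "S - {t'} \<in> - H" using miss[OF t(1)] by blast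
  have "embeds V2 E2 S (- H)"
    by (rule embeds_path_three[OF assms(4,5,1), of t t']) (use t t' in auto)
  then show ?thesis by blast
qed

text \<open>Among three triples of a four-element set two have the same colour, and any two of them
  give a path.\<close>

lemma ramsey_three_three:
  assumes "card S = 4" "grown_tree V1 E1" "card V1 = 3" "grown_tree V2 E2" "card V2 = 3"
  shows "embeds V1 E1 S H \<or> embeds V2 E2 S (- H)"
proof -
  obtain a b c d where S: "S = {a, b, c, d}" "distinct [a, b, c, d]" using card_4E[OF assms(1)] .
  have in_S: "a \<in> S" "b \<in> S" "c \<in> S" and neq: "a \<noteq> b" "a \<noteq> c" "b \<noteq> c" using S by auto
  have one: "embeds V1 E1 S H" if "t \<in> S" "t' \<in> S" "t \<noteq> t'" "S - {t} \<in> H" "S - {t'} \<in> H" for t t'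
    by (rule embeds_path_three[OF assms(2,3,1) that])
  have two: "embeds V2 E2 S (- H)" if "t \<in> S" "t' \<in> S" "t \<noteq> t'" "S - {t} \<notin> H" "S - {t'} \<notin> H" for t t'
    by (rule embeds_path_three[OF assms(4,5,1) that(1-3)]) (use that in auto)
  show ?thesis
    using one[OF in_S(1,2) neq(1)] one[OF in_S(1,3) neq(2)] one[OF in_S(2,3) neq(3)]
      two[OF in_S(1,2) neq(1)] two[OF in_S(1,3) neq(2)] two[OF in_S(2,3) neq(3)] by blast
qed

lemma embeds_edge:
  assumes "grown_tree V E" "card V = 2" "card S = 3" "S \<in> H"
  shows "embeds V E S H"
proof -
  have fin: "finite S" "finite V" using assms(2,3) card.infinite by fastforce+
  have "card E = 1" using grown_tree_card[OF assms(1)] assms(2) by simp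
  then obtain e0 where E: "E = {e0}" by (auto simp: card_1_singleton_iff)
  obtain \<phi> where \<phi>: "inj_on \<phi> V" "\<phi> ` V \<subseteq> S"
    using card_le_inj[OF fin(2,1)] assms(2,3) by auto
  have "e0 \<subseteq> V" using grown_tree_edge_subset[OF assms(1)] E by blast
  then show ?thesis
    unfolding embeds_def E using \<phi> assms(3,4)
    by (intro exI[of _ \<phi>] exI[of _ "\<lambda>_. S"]) auto
qed

section \<open>Lower bounds by counting vertices, triples and degrees\<close>

lemma card_le_if_contains_berge:
  assumes "contains_berge V E W K" "finite K"
  shows "card E \<le> card K"
proof -
  obtain f where "inj_on f E" "f ` E \<subseteq> K"
    using assms(1) unfolding contains_berge_def by (elim exE conjE) (rule that)
  then show ?thesis by (rule card_inj_on_le) (rule assms(2))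
qed

lemma card_vertices_le_if_contains_berge:
  assumes "contains_berge V E W K" "finite W"
  shows "card V \<le> card W"
proof -
  obtain \<phi> where "inj_on \<phi> V" "\<phi> ` V \<subseteq> W"
    using assms(1) unfolding contains_berge_def by (elim exE conjE) (rule that)
  then show ?thesis by (rule card_inj_on_le) (rule assms(2))
qed

lemma degree_ge_if_contains_star:
  assumes "contains_berge V E W K" "finite K" "c \<in> V" "E = {{c, v} |v. v \<in> V - {c}}" "card E = k"
  shows "\<exists>x\<in>W. k \<le> card {h \<in> K. x \<in> h}"
proof -
  obtain \<phi> f where f: "\<phi> ` V \<subseteq> W" "inj_on f E" "f ` E \<subseteq> K" and
    edge: "\<forall>x y. {x, y} \<in> E \<longrightarrow> {\<phi> x, \<phi> y} \<subseteq> f {x, y}"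
    using assms(1) unfolding contains_berge_def by (elim exE conjE) (rule that)
  have "\<phi> c \<in> f e" if "e \<in> E" for e
  proof -
    obtain v where "e = {c, v}" using \<open>e \<in> E\<close> unfolding assms(4) by blast
    then show ?thesis using that edge by auto
  qed
  then have "f ` E \<subseteq> {h \<in> K. \<phi> c \<in> h}" using f(3) by blast
  then have "k \<le> card {h \<in> K. \<phi> c \<in> h}"
    using card_inj_on_le[OF f(2)] assms(2,5) by simp
  then show ?thesis using f(1) assms(3) by blast
qed

lemma finite_complete3: "finite (complete3 N)"
  by (rule finite_subset[of _ "Pow {..<N}"]) (auto simp: complete3_def)

text \<open>With all triples blue, the first tree lacks vertices and the second lacks
  triples.\<close>

lemma not_berge_arrows_small:
  assumes "N < card V1" "grown_tree V2 E2" "2 \<le> card V2"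
  shows "\<not> berge_arrows N V1 E1 V2 E2"
proof
  assume "berge_arrows N V1 E1 V2 E2"
  then have "contains_berge V1 E1 {..<N} {h \<in> complete3 N. Blue = Blue} \<or>
      contains_berge V2 E2 {..<N} {h \<in> complete3 N. Blue = Red}"
    unfolding berge_arrows_def by (rule allE[of _ "\<lambda>_. Blue"])
  then show False
  proof
    assume "contains_berge V1 E1 {..<N} {h \<in> complete3 N. Blue = Blue}"
    then show False using card_vertices_le_if_contains_berge assms(1) by fastforce
  next
    assume "contains_berge V2 E2 {..<N} {h \<in> complete3 N. Blue = Red}"
    then have "card E2 \<le> 0" using card_le_if_contains_berge by fastforce
    then show False using grown_tree_card[OF assms(2)] assms(3) by simp
  qed
qed

lemma not_berge_arrowsI:
  assumes "\<not> contains_berge V1 E1 {..<N} {h \<in> complete3 N. h \<in> B}"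
    and "\<not> contains_berge V2 E2 {..<N} {h \<in> complete3 N. h \<notin> B}"
  shows "\<not> berge_arrows N V1 E1 V2 E2"
proof
  assume "berge_arrows N V1 E1 V2 E2"
  then have "contains_berge V1 E1 {..<N} {h \<in> complete3 N. (if h \<in> B then Blue else Red) = Blue} \<or>
      contains_berge V2 E2 {..<N} {h \<in> complete3 N. (if h \<in> B then Blue else Red) = Red}"
    unfolding berge_arrows_def by (rule allE[of _ "\<lambda>h. if h \<in> B then Blue else Red"])
  moreover have "((if h \<in> B then Blue else Red) = Blue) \<longleftrightarrow> h \<in> B"
    "((if h \<in> B then Blue else Red) = Red) \<longleftrightarrow> h \<notin> B" for h by auto
  ultimately show False using assms by simp
qed

lemma lessThan_numerals:
  "{..<3 :: nat} = {0, 1, 2}" "{..<4 :: nat} = {0, 1, 2, 3}" "{..<5 :: nat} = {0, 1, 2, 3, 4}"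
  by auto

lemma complete3_three: "complete3 3 \<subseteq> {{0, 1, 2}}"
proof
  fix h assume "h \<in> complete3 3"
  then have "h \<in> Pow {0, 1, 2}" "card h = 3" by (auto simp: complete3_def lessThan_numerals)
  then show "h \<in> {{0, 1, 2}}" by (simp only: Pow_insert Pow_empty) auto
qed

lemma complete3_four: "complete3 4 \<subseteq> {{0, 1, 2}, {0, 1, 3}, {0, 2, 3}, {1, 2, 3}}"
proof
  fix h assume "h \<in> complete3 4"
  then have "h \<in> Pow {0, 1, 2, 3}" "card h = 3" by (auto simp: complete3_def lessThan_numerals)
  then show "h \<in> {{0, 1, 2}, {0, 1, 3}, {0, 2, 3}, {1, 2, 3}}"
    by (simp only: Pow_insert Pow_empty) auto
qed

text \<open>The rotations of \<open>{0, 1, 2}\<close> modulo five; \<open>pentagram_triples\<close>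
  are those of \<open>{0, 1, 3}\<close>. Together they are all ten triples, and every vertex lies in
  three of each kind, whereas a Berge star with five vertices needs four triples at the image of its
  centre.\<close>

definition pentagon_triples :: "nat set set" where
  "pentagon_triples = {{0, 1, 2}, {1, 2, 3}, {2, 3, 4}, {0, 3, 4}, {0, 1, 4}}"

definition pentagram_triples :: "nat set set" where
  "pentagram_triples = {{0, 1, 3}, {1, 2, 4}, {0, 2, 3}, {1, 3, 4}, {0, 2, 4}}"

lemma complete3_five:
  "complete3 5 \<subseteq> pentagon_triples \<union> pentagram_triples"
proof
  fix h assume "h \<in> complete3 5"
  then have h: "h \<subseteq> {0, 1, 2, 3, 4}" "card h = 3" by (auto simp: complete3_def lessThan_numerals)
  show "h \<in> pentagon_triples \<union> pentagram_triples"
  proof (cases "4 \<in> h")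
    case False
    then have "h \<in> complete3 4" using h by (auto simp: complete3_def lessThan_numerals)
    from subsetD[OF complete3_four this] show ?thesis
      unfolding pentagon_triples_def pentagram_triples_def by (elim insertE emptyE) simp_all
  next
    case True
    have fin: "finite h" using h(1) finite_subset by blast
    define p where "p = h - {4}"
    have p: "p \<in> Pow {0, 1, 2, 3}" "card p = 2" using h True fin by (auto simp: p_def)
    have "h = insert 4 p" using True by (auto simp: p_def)
    moreover have "p \<in> {{0, 1}, {0, 2}, {0, 3}, {1, 2}, {1, 3}, {2, 3}}"
      using p by (simp only: Pow_insert Pow_empty) auto
    ultimately show ?thesis
      unfolding pentagon_triples_def pentagram_triples_def
      by (elim insertE emptyE) (simp_all add: insert_commute)
  qed
qed

lemma card_le_list: "A \<subseteq> set xs \<Longrightarrow> card A \<le> length xs"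
  by (meson card_length card_mono finite_set le_trans)

text \<open>The four triples are split evenly, and a tree with three edges needs three triples of
  one colour.\<close>

lemma not_berge_arrows_four:
  assumes "card E1 = 3" "card E2 = 3"
  shows "\<not> berge_arrows 4 V1 E1 V2 E2"
proof (rule not_berge_arrowsI[of _ _ _ "{{0, 1, 2}, {0, 1, 3}}"])
  have "card {h \<in> complete3 4. h \<in> {{0, 1, 2}, {0, 1, 3}}} \<le> length [{0, 1, 2}, {0, 1, 3 :: nat}]"
    by (rule card_le_list) auto
  then show "\<not> contains_berge V1 E1 {..<4} {h \<in> complete3 4. h \<in> {{0, 1, 2}, {0, 1, 3}}}"
    using card_le_if_contains_berge finite_complete3 assms(1) by fastforce
  have "card {h \<in> complete3 4. h \<notin> {{0, 1, 2}, {0, 1, 3}}} \<le> length [{0, 2, 3}, {1, 2, 3 :: nat}]"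
    by (rule card_le_list) (use complete3_four in auto)
  then show "\<not> contains_berge V2 E2 {..<4} {h \<in> complete3 4. h \<notin> {{0, 1, 2}, {0, 1, 3}}}"
    using card_le_if_contains_berge finite_complete3 assms(2) by fastforce
qed

text \<open>There is only one triple, so no colouring provides the two triples that either tree
  needs.\<close>

lemma not_berge_arrows_three:
  assumes "card E1 = 2" "card E2 = 2"
  shows "\<not> berge_arrows 3 V1 E1 V2 E2"
proof (rule not_berge_arrowsI[of _ _ _ UNIV])
  have "card (complete3 3) \<le> length [{0, 1, 2 :: nat}]"
    by (rule card_le_list) (use complete3_three in auto)
  then show "\<not> contains_berge V1 E1 {..<3} {h \<in> complete3 3. h \<in> UNIV}"
    using card_le_if_contains_berge[of V1 E1 _ "complete3 3"] finite_complete3 assms(1) by fastforce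
  show "\<not> contains_berge V2 E2 {..<3} {h \<in> complete3 3. h \<notin> UNIV}"
    using card_le_if_contains_berge[of V2 E2 _ "{}"] assms(2) by fastforce
qed

lemma not_berge_arrows_two:
  assumes "card E1 = 1" "card E2 = 1"
  shows "\<not> berge_arrows 2 V1 E1 V2 E2"
proof -
  have "h \<notin> complete3 2" for h
    using card_mono[of "{..<2 :: nat}" h] by (auto simp: complete3_def)
  then have empty: "complete3 2 = {}" by blast
  show ?thesis
    using card_le_if_contains_berge[of V1 E1 _ "{}"] card_le_if_contains_berge[of V2 E2 _ "{}"] assms
    by (intro not_berge_arrowsI[of _ _ _ UNIV]) (auto simp: empty)
qed

lemma card_degree_le:
  assumes "K \<subseteq> set hs" "length (filter (\<lambda>h. x \<in> h) hs) \<le> k"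
  shows "card {h \<in> K. x \<in> h} \<le> k"
proof -
  have "{h \<in> K. x \<in> h} \<subseteq> set (filter (\<lambda>h. x \<in> h) hs)" using assms(1) by auto
  from card_le_list[OF this] show ?thesis using assms(2) by simp
qed

lemma pentagon_degree:
  fixes x :: nat
  assumes "x < 5"
  shows "K \<subseteq> pentagon_triples \<Longrightarrow> card {h \<in> K. x \<in> h} \<le> 3"
    and "K \<subseteq> pentagram_triples \<Longrightarrow> card {h \<in> K. x \<in> h} \<le> 3"
proof -
  have x: "x = 0 \<or> x = 1 \<or> x = 2 \<or> x = 3 \<or> x = 4" using assms by auto
  show "card {h \<in> K. x \<in> h} \<le> 3" if "K \<subseteq> pentagon_triples"
    by (rule card_degree_le[of _ "[{0, 1, 2}, {1, 2, 3}, {2, 3, 4}, {0, 3, 4}, {0, 1, 4}]"])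
      (use that x in \<open>auto simp: pentagon_triples_def\<close>)
  show "card {h \<in> K. x \<in> h} \<le> 3" if "K \<subseteq> pentagram_triples"
    by (rule card_degree_le[of _ "[{0, 1, 3}, {1, 2, 4}, {0, 2, 3}, {1, 3, 4}, {0, 2, 4}]"])
      (use that x in \<open>auto simp: pentagram_triples_def\<close>)
qed

lemma not_berge_arrows_five_stars:
  assumes "star 5 V1 E1" "card E1 = 4" "star 5 V2 E2" "card E2 = 4"
  shows "\<not> berge_arrows 5 V1 E1 V2 E2"
proof (rule not_berge_arrowsI[of _ _ _ pentagon_triples])
  obtain c1 where c1: "c1 \<in> V1" "E1 = {{c1, v} |v. v \<in> V1 - {c1}}" using assms(1) unfolding star_def by blast
  obtain c2 where c2: "c2 \<in> V2" "E2 = {{c2, v} |v. v \<in> V2 - {c2}}" using assms(3) unfolding star_def by blast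
  let ?K1 = "{h \<in> complete3 5. h \<in> pentagon_triples}"
  let ?K2 = "{h \<in> complete3 5. h \<notin> pentagon_triples}"
  have fin: "finite ?K1" "finite ?K2" using finite_complete3 by simp_all
  show "\<not> contains_berge V1 E1 {..<5} ?K1"
  proof
    assume "contains_berge V1 E1 {..<5} ?K1"
    then obtain x where "x \<in> {..<5}" "4 \<le> card {h \<in> ?K1. x \<in> h}"
      using degree_ge_if_contains_star[OF _ fin(1) c1 assms(2)] by blast
    moreover have "?K1 \<subseteq> pentagon_triples" by blast
    ultimately show False using pentagon_degree(1)[of x ?K1] by simp
  qed
  show "\<not> contains_berge V2 E2 {..<5} ?K2"
  proof
    assume "contains_berge V2 E2 {..<5} ?K2"
    then obtain x where "x \<in> {..<5}" "4 \<le> card {h \<in> ?K2. x \<in> h}"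
      using degree_ge_if_contains_star[OF _ fin(2) c2 assms(4)] by blast
    moreover have "?K2 \<subseteq> pentagram_triples" using complete3_five by blast
    ultimately show False using pentagon_degree(2)[of x ?K2] by simp
  qed
qed

lemma berge_ramsey3_eqI:
  assumes "berge_arrows m V1 E1 V2 E2" "\<And>N. N < m \<Longrightarrow> \<not> berge_arrows N V1 E1 V2 E2"
  shows "berge_ramsey3 V1 E1 V2 E2 = enat m"
  unfolding berge_ramsey3_def
proof (rule antisym)
  show "Inf {enat N |N. berge_arrows N V1 E1 V2 E2} \<le> enat m"
    by (rule Inf_lower) (use assms(1) in blast)
  show "enat m \<le> Inf {enat N |N. berge_arrows N V1 E1 V2 E2}"
  proof (rule Inf_greatest)
    fix x assume "x \<in> {enat N |N. berge_arrows N V1 E1 V2 E2}"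
    then obtain N where "x = enat N" "berge_arrows N V1 E1 V2 E2" by blast
    then show "enat m \<le> x" using assms(2)[of N] by (cases "N < m") auto
  qed
qed

lemma star_iff_spokes: "star k V E \<longleftrightarrow> finite V \<and> card V = k \<and> (\<exists>c\<in>V. E = spokes c V)"
  by (simp add: star_def spokes_def)

text \<open>The sizes three and two are set apart because three vertices carry a single triple:
  coloured blue, it gives neither the two triples of a Berge path on three vertices nor a red
  triple. The value for that pair is therefore 4 and not \<open>n\<close>. In the remaining cases
  the trees are padded to sizes for which a two-colour statement has been proved.\<close>

theorem theorem6:
  fixes V1 :: "'a set" and E1 :: "'a set set" and V2 :: "'b set" and E2 :: "'b set set"
    and n :: nat
  assumes "tree V1 E1" and "tree V2 E2"
    and "card V1 \<ge> 2" and "card V2 \<ge> 2"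
    and "n = card V1" and "card V1 \<ge> card V2"
    and not_P3_K2: "\<not> (card V1 = 3 \<and> card V2 = 2)"
  shows "berge_ramsey3 V1 E1 V2 E2 =
    (if (card V1 = card V2 \<and> card V1 \<le> 4) \<or> (star 5 V1 E1 \<and> star 5 V2 E2)
     then enat (n + 1) else enat n)"
proof -
  have g1: "grown_tree V1 E1" and g2: "grown_tree V2 E2" using tree_grown assms(1,2) by blast+
  have cE: "card V1 = Suc (card E1)" "card V2 = Suc (card E2)" using grown_tree_card g1 g2 by blast+
  have small: "\<not> berge_arrows N V1 E1 V2 E2" if "N < n" for N
    using not_berge_arrows_small[OF _ g2 assms(4)] that assms(5) by blast
  show ?thesis
  proof (cases "(card V1 = card V2 \<and> card V1 \<le> 4) \<or> (star 5 V1 E1 \<and> star 5 V2 E2)")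
    case exceptional: True
    have "n = 2 \<and> card V2 = 2 \<or> n = 3 \<and> card V2 = 3 \<or> n = 4 \<and> card V2 = 4"
      if "card V1 = card V2" "card V1 \<le> 4"
      using that assms(3,5) by arith
    moreover have "n = 5" if "star 5 V1 E1" using that assms(5) by (simp add: star_def)
    ultimately consider "n = 2" "card V2 = 2" | "n = 3" "card V2 = 3" | "n = 4" "card V2 = 4"
      | "n = 5" "star 5 V1 E1" "star 5 V2 E2"
      using exceptional by blast
    then have "berge_arrows (n + 1) V1 E1 V2 E2 \<and> \<not> berge_arrows n V1 E1 V2 E2"
    proof cases
      case 1
      obtain W1 F1 where s1: "subtree_of V1 E1 W1 F1" "card W1 = 2"
        using subtree_extend[OF g1, of 2] 1 assms(5) by auto
      obtain W2 F2 where s2: "subtree_of V2 E2 W2 F2" "card W2 = 2"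
        using subtree_extend[OF g2, of 2] 1 by auto
      have g: "grown_tree W1 F1" "grown_tree W2 F2" using s1 s2 by (auto simp: subtree_of_def)
      have "embeds W1 F1 {..<3 :: nat} H \<or> embeds W2 F2 {..<3 :: nat} (- H)" for H
        using embeds_edge[OF g(1) s1(2), of "{..<3}" H] embeds_edge[OF g(2) s2(2), of "{..<3}" "- H"]
        by (cases "{..<3} \<in> H") simp_all
      then have "berge_arrows 3 V1 E1 V2 E2" by (rule berge_arrowsI[OF g1 s1(1) g2 s2(1)])
      moreover have "card E1 = 1" "card E2 = 1" using cE 1 assms(5) by simp_all
      ultimately show ?thesis using not_berge_arrows_two[of E1 E2 V1 V2] unfolding 1(1) by simp
    next
      case 2
      obtain W1 F1 where s1: "subtree_of V1 E1 W1 F1" "card W1 = 3"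
        using subtree_extend[OF g1, of 3] 2 assms(5) by auto
      obtain W2 F2 where s2: "subtree_of V2 E2 W2 F2" "card W2 = 3"
        using subtree_extend[OF g2, of 3] 2 by auto
      have g: "grown_tree W1 F1" "grown_tree W2 F2" using s1 s2 by (auto simp: subtree_of_def)
      have "berge_arrows 4 V1 E1 V2 E2"
        by (rule berge_arrowsI[OF g1 s1(1) g2 s2(1) ramsey_three_three[OF _ g(1) s1(2) g(2) s2(2)]]) simp
      moreover have "card E1 = 2" "card E2 = 2" using cE 2 assms(5) by simp_all
      ultimately show ?thesis using not_berge_arrows_three[of E1 E2 V1 V2] unfolding 2(1) by simp
    next
      case 3
      \<comment> \<open>The host has \<open>n + 1 = 5\<close> vertices, where a pair of stars fails;
        the first tree is therefore padded to a non-star.\<close>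
      obtain W1 F1 where s1: "subtree_of V1 E1 W1 F1" "card W1 = 5" "two_disjoint F1"
        using subtree_extend_two_disjoint[OF g1, of 5] 3 assms(5) by auto
      obtain W2 F2 where s2: "subtree_of V2 E2 W2 F2" "card W2 = 5"
        using subtree_extend[OF g2, of 5] 3 by auto
      have g: "grown_tree W1 F1" "grown_tree W2 F2" using s1 s2 by (auto simp: subtree_of_def)
      have "spans W1 F1 {..<5 :: nat} H \<or> spans W2 F2 {..<5 :: nat} (- H)" for H
        by (rule ramsey_not_both_stars) (use g s1 s2 in auto)
      then have "berge_arrows 5 V1 E1 V2 E2"
        by (intro berge_arrowsI[OF g1 s1(1) g2 s2(1)]) (use embeds_if_spans in blast)
      moreover have "card E1 = 3" "card E2 = 3" using cE 3 assms(5) by simp_all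
      ultimately show ?thesis using not_berge_arrows_four[of E1 E2 V1 V2] unfolding 3(1) by simp
    next
      case 4
      have c: "card V1 = 5" "card V2 = 5" using 4 by (auto simp: star_def)
      obtain W1 F1 where s1: "subtree_of V1 E1 W1 F1" "card W1 = 6"
        using subtree_extend[OF g1, of 6] c by auto
      obtain W2 F2 where s2: "subtree_of V2 E2 W2 F2" "card W2 = 6"
        using subtree_extend[OF g2, of 6] c by auto
      have g: "grown_tree W1 F1" "grown_tree W2 F2" using s1 s2 by (auto simp: subtree_of_def)
      have "spans W1 F1 {..<6 :: nat} H \<or> spans W2 F2 {..<6 :: nat} (- H)" for H
        by (rule ramsey_large) (use g s1 s2 in auto)
      then have "berge_arrows 6 V1 E1 V2 E2"
        by (intro berge_arrowsI[OF g1 s1(1) g2 s2(1)]) (use embeds_if_spans in blast)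
      moreover have "card E1 = 4" "card E2 = 4" using cE c by simp_all
      ultimately show ?thesis using not_berge_arrows_five_stars[OF 4(2) _ 4(3)] unfolding 4(1) by simp
    qed
    then have "berge_ramsey3 V1 E1 V2 E2 = enat (n + 1)"
      using berge_ramsey3_eqI[of "n + 1" V1 E1 V2 E2] small less_Suc_eq by auto
    then show ?thesis using exceptional by (simp only: if_True)
  next
    case generic: False
    then have "\<not> (card V1 = card V2 \<and> card V1 \<le> 4)" by blast
    \<comment> \<open>Equal sizes up to four belong to the exceptional case, and three against two
      is excluded.\<close>
    then have "n \<ge> 4" using assms(3-7) by arith
    then consider "n = 4" "card V2 \<le> 3" | "n = 5" "card V2 \<le> 4" | "n = 5" "card V2 = 5" | "n \<ge> 6"
      using generic assms(5,6) by linarith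
    then have "berge_arrows n V1 E1 V2 E2"
    proof cases
      case 1
      obtain W1 F1 where s1: "subtree_of V1 E1 W1 F1" "card W1 = 4"
        using subtree_extend[OF g1, of 4] 1 assms(5) by auto
      obtain W2 F2 where s2: "subtree_of V2 E2 W2 F2" "card W2 = 3"
        using subtree_extend[OF g2 1(2)] .
      have g: "grown_tree W1 F1" "grown_tree W2 F2" using s1 s2 by (auto simp: subtree_of_def)
      show ?thesis
        by (rule berge_arrowsI[OF g1 s1(1) g2 s2(1) ramsey_four_three[OF _ g(1) s1(2) g(2) s2(2)]])
          (simp add: 1(1))
    next
      case 2
      obtain W1 F1 where s1: "subtree_of V1 E1 W1 F1" "card W1 = n"
        using subtree_extend[OF g1, of n] assms(5) by auto
      \<comment> \<open>Here the smaller tree has a vertex to spare and becomes the non-star, so the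
        first tree may be any, even a star.\<close>
      obtain W2 F2 where s2: "subtree_of V2 E2 W2 F2" "card W2 = n" "two_disjoint F2"
        using subtree_extend_two_disjoint[OF g2 assms(4), of n] 2 by auto
      have g: "grown_tree W1 F1" "grown_tree W2 F2" using s1 s2 by (auto simp: subtree_of_def)
      have "spans W1 F1 {..<n} H \<or> spans W2 F2 {..<n} (- H)" for H
        by (rule ramsey_not_both_stars) (use g s1 s2 2 in auto)
      then show ?thesis
        by (intro berge_arrowsI[OF g1 s1(1) g2 s2(1)]) (use embeds_if_spans in blast)
    next
      case 3
      have "two_disjoint E1 \<or> two_disjoint E2"
        using generic star_if_not_two_disjoint[OF g1] star_if_not_two_disjoint[OF g2] 3 assms(5)
          grown_tree_finite[OF g1] grown_tree_finite[OF g2] unfolding star_iff_spokes by auto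
      moreover obtain W1 F1 where s1: "subtree_of V1 E1 W1 F1" "card W1 = card V1"
        "two_disjoint E1 \<Longrightarrow> two_disjoint F1"
        using subtree_nat[OF g1] by metis
      moreover obtain W2 F2 where s2: "subtree_of V2 E2 W2 F2" "card W2 = card V2"
        "two_disjoint E2 \<Longrightarrow> two_disjoint F2"
        using subtree_nat[OF g2] by metis
      ultimately have disj: "two_disjoint F1 \<or> two_disjoint F2" by blast
      have g: "grown_tree W1 F1" "grown_tree W2 F2" using s1 s2 by (auto simp: subtree_of_def)
      have "spans W1 F1 {..<n} H \<or> spans W2 F2 {..<n} (- H)" for H
        by (rule ramsey_not_both_stars[OF _ g(1) _ g(2) _ disj]) (use s1 s2 3 assms(5) in auto)
      then show ?thesis
        by (intro berge_arrowsI[OF g1 s1(1) g2 s2(1)]) (use embeds_if_spans in blast)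
    next
      case 4
      obtain W1 F1 where s1: "subtree_of V1 E1 W1 F1" "card W1 = n"
        using subtree_extend[OF g1, of n] assms(5) by auto
      obtain W2 F2 where s2: "subtree_of V2 E2 W2 F2" "card W2 = n"
        using subtree_extend[OF g2, of n] assms(5,6) by auto
      have g: "grown_tree W1 F1" "grown_tree W2 F2" using s1 s2 by (auto simp: subtree_of_def)
      have "spans W1 F1 {..<n} H \<or> spans W2 F2 {..<n} (- H)" for H
        by (rule ramsey_large[OF _ g(1) _ g(2)]) (use s1 s2 4 in auto)
      then show ?thesis
        by (intro berge_arrowsI[OF g1 s1(1) g2 s2(1)]) (use embeds_if_spans in blast)
    qed
    then have "berge_ramsey3 V1 E1 V2 E2 = enat n"
      using berge_ramsey3_eqI small by blast
    then show ?thesis using generic by (simp only: if_False)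
  qed
qed

end
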